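(* Let $\mathcal E$ be a Hilbert space, let $\{A_{(\alpha_1,\dots,\alpha_k;\beta_1,\dots,\beta_k)}\}$ be a family of operators in $B(\mathcal E)$, where $\alpha_i,\beta_i\in\mathbb F_{n_i}^+$, $|\alpha_i|=m_i^-$, $|\beta_i|=m_i^+$, $m_i\in\mathbb Z$, $i\in\{1,\dots,k\}$, and let $$\varphi(\mathbf S):=\sum_{m_1\in\mathbb Z}\cdots\sum_{m_k\in\mathbb Z}\ \sum_{\alpha_i,\beta_i\in\mathbb F_{n_i}^+,\ |\alpha_i|=m_i^-,\ |\beta_i|=m_i^+}A_{(\alpha_1,\dots,\alpha_k;\beta_1,\dots,\beta_k)}\otimes\mathbf S_{1,\alpha_1}\cdots\mathbf S_{k,\alpha_k}\mathbf S_{1,\beta_1}^*\cdots\mathbf S_{k,\beta_k}^*$$ be the associated formal Fourier series. Then $\varphi(\mathbf S)$ is the formal Fourier series of a $k$-multi-Toeplitz operator $A$ on $\mathcal E\otimes\bigotimes_{i=1}^kF^2(H_{n_i})$ if and only if the series defining $\varphi(r\mathbf S)$ is convergent in the operator norm topology for any $r\in[0,1)$, and $\sup_{r\in[0,1)}\|\varphi(r\mathbf S)\|<\infty$. Moreover, if $A$ is a $k$-multi-Toeplitz operator on $\mathcal E\otimes\bigotimes_{i=1}^kF^2(H_{n_i})$ with formal Fourier series $\varphi(\mathbf S)$, then $\varphi(r\mathbf S)=\boldsymbol{\mathcal B}^{ext}_{r\mathbf S}[A]$ for $r\in[0,1)$ and $\text{SOT-}\lim_{r\to1}\boldsymbol{\mathcal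 B}^{ext}_{r\mathbf S}[A]=A$, where $$\boldsymbol{\mathcal B}^{ext}_{r\mathbf S}[u]:=(I_{\mathcal E}\otimes\mathbf K_{r\mathbf S}^* )(u\otimes I_{\bigotimes_{i=1}^kF^2(H_{n_i})})(I_{\mathcal E}\otimes\mathbf K_{r\mathbf S}),\qquad u\in B\Big(\mathcal E\otimes\bigotimes_{i=1}^kF^2(H_{n_i})\Big),$$ and $\mathbf K_{r\mathbf S}$ is the noncommutative Berezin kernel associated with $r\mathbf S$.
   Context: Let $k\ge1$, $\mathbf n=(n_1,\dots,n_k)\in\mathbb N^k$, $\mathbb N=\{1,2,\dots\}$. For $i=1,\dots,k$ let $H_{n_i}$ be an $n_i$-dimensional complex Hilbert space with orthonormal basis $e^i_1,\dots,e^i_{n_i}$, $F^2(H_{n_i})=\mathbb C1\oplus\bigoplus_{p\ge1}H_{n_i}^{\otimes p}$ its full Fock space, and $\mathbb F_{n_i}^+$ the unital free semigroup with generators $g^i_1,\dots,g^i_{n_i}$ and identity $g^i_0$. For $\alpha=g^i_{j_1}\cdots g^i_{j_p}$ put $|\alpha|=p$ and $e^i_\alpha=e^i_{j_1}\otimes\cdots\otimes e^i_{j_p}$; also $|g^i_0|=0$, $e^i_{g^i_0}=1$. The left and right creation operators on $F^2(H_{n_i})$ are $S_{i,j}e^i_\alpha=e^i_{g^i_j\alpha}$ and $R_{i,j}e^i_\alpha=e^i_{\alpha g^i_j}$; $\mathbf S_{i,j}$ and $\mathbf R_{i,j}$ are their ampliations to $\bigotimes_{i=1}^kF^2(H_{n_i})$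 (acting on the $i$-th factor, identity on the others). For operators $T_{i,1},\dots,T_{i,n_i}$ put $T_{i,\alpha}=T_{i,j_1}\cdots T_{i,j_p}$, $T_{i,g^i_0}=I$; $T_{i,\alpha}^*$ means $(T_{i,\alpha})^*$. For $m\in\mathbb Z$, $m^+=\max\{m,0\}$, $m^-=\max\{-m,0\}$. A bounded operator $A$ on $\mathcal E\otimes\bigotimes_{i=1}^kF^2(H_{n_i})$ is $k$-multi-Toeplitz if $(I_{\mathcal E}\otimes\mathbf R_{i,s}^* )A(I_{\mathcal E}\otimes\mathbf R_{i,t})=\delta_{st}A$ for all $i$ and $s,t\in\{1,\dots,n_i\}$. Its formal Fourier series is the formal series of the form displayed in the claim with coefficients $\langle A_{(\alpha_1,\dots,\alpha_k;\beta_1,\dots,\beta_k)}h,\ell\rangle=\langle A(h\otimes x),\ell\otimes y\rangle$, $h,\ell\in\mathcal E$, where $x=x_1\otimes\cdots\otimes x_k$, $y=y_1\otimes\cdots\otimes y_k$, with $x_i=e^i_{\beta_i}$, $y_i=1$ if $m_i\ge0$ and $x_i=1$, $y_i=e^i_{\alpha_i}$ if $m_i<0$. The series $\varphi(r\mathbf S)$ is obtained by multiplying the $(\alpha_1,\dots,\alpha_k;\beta_1,\dots,\beta_k)$ term of $\varphi(\mathbf S)$ by $r^{\sum_{i=1}^k(|\alpha_i|+|\beta_i|)}$. A series $\sum_{m\in\mathbb Z}$ is convergent if the parts over $m<0$ and $m\ge0$ both converge, its sum being the sum of the two. Berezin kernel: for $\mathbf X=(X_1,\dots,X_k)$, $X_i=(X_{i,1},\dots,X_{i,n_i})\in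 B(\mathcal H)^{n_i}$, put $\Phi_{X_i}(Y)=\sum_jX_{i,j}YX_{i,j}^*$ and $\boldsymbol\Delta_{\mathbf X}=(id-\Phi_{X_1})\circ\cdots\circ(id-\Phi_{X_k})$. With $\mathcal H=\bigotimes_{i=1}^kF^2(H_{n_i})$ and $\mathbf X=r\mathbf S$, the kernel is $\mathbf K_{r\mathbf S}:\mathcal H\to\left(\bigotimes_{i=1}^kF^2(H_{n_i})\right)\otimes\mathcal H$, $$\mathbf K_{\mathbf X}h=\sum_{\beta_i\in\mathbb F_{n_i}^+,\,i=1,\dots,k}e^1_{\beta_1}\otimes\cdots\otimes e^k_{\beta_k}\otimes\boldsymbol\Delta_{\mathbf X}(I)^{1/2}X_{1,\beta_1}^*\cdots X_{k,\beta_k}^*h .$$ *)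

theory Defs
  imports "HOL-Analysis.Analysis"
begin

section \<open>Complex Hilbert spaces\<close>

text \<open>The inner product is linear in the first variable.\<close>

class chilbert_space = banach +
  fixes scaleC :: "complex \<Rightarrow> 'a \<Rightarrow> 'a"  (infixr \<open>*\<^sub>C\<close> 75)
    and cinner :: "'a \<Rightarrow> 'a \<Rightarrow> complex"
  assumes scaleC_add_right: "c *\<^sub>C (x + y) = c *\<^sub>C x + c *\<^sub>C y"
    and scaleC_add_left: "(c + d) *\<^sub>C x = c *\<^sub>C x + d *\<^sub>C x"
    and scaleC_scaleC: "c *\<^sub>C d *\<^sub>C x = (c * d) *\<^sub>C x"
    and scaleC_of_real: "complex_of_real r *\<^sub>C x = r *\<^sub>R x"
    and cinner_add_left: "cinner (x + y) z = cinner x z + cinner y z"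
    and cinner_scaleC_left: "cinner (c *\<^sub>C x) y = c * cinner x y"
    and cinner_commute: "cinner x y = cnj (cinner y x)"
    and cinner_self: "cinner x x = complex_of_real ((norm x)\<^sup>2)"

instantiation complex :: chilbert_space
begin

definition scaleC_complex :: "complex \<Rightarrow> complex \<Rightarrow> complex" where "scaleC_complex c x = c * x"
definition cinner_complex :: "complex \<Rightarrow> complex \<Rightarrow> complex" where "cinner_complex x y = x * cnj y"

instance
proof
  fix x :: complex
  show "cinner x x = complex_of_real ((norm x)\<^sup>2)"
    by (simp only: cinner_complex_def complex_norm_square)
qed (simp_all add: scaleC_complex_def cinner_complex_def algebra_simps scaleR_conv_of_real)

end

lemma norm_scaleC: "norm (c *\<^sub>C x) = cmod c * norm (x :: 'a::chilbert_space)"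
proof -
  have "cinner (c *\<^sub>C x) (c *\<^sub>C x) = c * cnj c * cinner x x"
    by (metis cinner_commute cinner_scaleC_left complex_cnj_mult mult.assoc mult.left_commute)
  hence "complex_of_real ((norm (c *\<^sub>C x))\<^sup>2) = complex_of_real ((cmod c * norm x)\<^sup>2)"
    by (simp only: cinner_self complex_norm_square[symmetric] of_real_mult[symmetric] power_mult_distrib)
  hence "(norm (c *\<^sub>C x))\<^sup>2 = (cmod c * norm x)\<^sup>2"
    by (simp only: of_real_eq_iff)
  thus ?thesis
    by (simp add: power2_eq_iff_nonneg)
qed

lemma scaleC_zero [simp]: "c *\<^sub>C (0 :: 'a::chilbert_space) = 0" "0 *\<^sub>C (x :: 'a) = 0"
  using norm_scaleC[of c "0 :: 'a"] norm_scaleC[of 0 x] by simp_all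

lemma cinner_add_right: "cinner x (y + z) = cinner x y + cinner x (z :: 'a::chilbert_space)"
  by (metis cinner_add_left cinner_commute complex_cnj_add)

lemma cinner_scaleC_right: "cinner x (c *\<^sub>C y) = cnj c * cinner x (y :: 'a::chilbert_space)"
  by (metis cinner_commute cinner_scaleC_left complex_cnj_mult)

lemma cmod_cinner_le: "cmod (cinner x y) \<le> (norm x)\<^sup>2 + (norm (y :: 'a::chilbert_space))\<^sup>2"
proof (cases "cinner x y = 0")
  case False
  define u where "u = cnj (sgn (cinner x y))"
  have u: "cmod u = 1"
    using False by (simp add: u_def norm_sgn)
  define z where "z = u *\<^sub>C x"
  have "cinner z y = cnj (sgn (cinner x y)) * cinner x y"
    by (simp add: z_def u_def cinner_scaleC_left)
  also have "\<dots> = complex_of_real (cmod (cinner x y))"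
    using False
    by (simp add: sgn_eq complex_norm_square[symmetric] power2_eq_square mult.commute field_simps)
  finally have zy: "cinner z y = complex_of_real (cmod (cinner x y))" .
  hence yz: "cinner y z = complex_of_real (cmod (cinner x y))"
    by (subst cinner_commute) simp
  define w where "w = (-1) *\<^sub>C y"
  have "complex_of_real ((norm (z + w))\<^sup>2) = cinner z z + cinner z w + cinner w z + cinner w w"
    by (simp only: cinner_self[symmetric] cinner_add_left cinner_add_right add.assoc)
       (simp add: algebra_simps)
  also have "\<dots> = complex_of_real ((norm x)\<^sup>2 + (norm y)\<^sup>2 - 2 * cmod (cinner x y))"
    by (simp add: w_def cinner_scaleC_left cinner_scaleC_right zy yz cinner_self)
       (simp add: z_def norm_scaleC u)
  finally have "(norm (z + w))\<^sup>2 = (norm x)\<^sup>2 + (norm y)\<^sup>2 - 2 * cmod (cinner x y)"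
    by (simp only: of_real_eq_iff)
  moreover have "0 \<le> (norm (z + w))\<^sup>2" "0 \<le> (norm x)\<^sup>2" "0 \<le> (norm y)\<^sup>2"
    by simp_all
  ultimately show ?thesis by linarith
qed simp


section \<open>The Hilbert space of square-summable families\<close>

lemma sq_summable_iff:
  fixes f :: "'w \<Rightarrow> 'e::real_normed_vector"
  shows "(\<lambda>w. (norm (f w))\<^sup>2) summable_on UNIV \<longleftrightarrow>
    (\<exists>b. \<forall>F. finite F \<longrightarrow> L2_set (\<lambda>w. norm (f w)) F \<le> b)" (is "?L \<longleftrightarrow> ?R")
proof
  assume ?L
  thus ?R
    by (intro exI[of _ "sqrt (infsum (\<lambda>w. (norm (f w))\<^sup>2) UNIV)"])
       (auto simp: L2_set_def intro!: finite_sum_le_infsum)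
next
  assume ?R
  then obtain b where b: "\<And>F. finite F \<Longrightarrow> L2_set (\<lambda>w. norm (f w)) F \<le> b" by blast
  have "(\<Sum>w\<in>F. (norm (f w))\<^sup>2) \<le> b\<^sup>2" if "finite F" for F
    using power_mono[OF b[OF that], of 2] by (simp add: L2_set_def sum_nonneg)
  thus ?L
    by (intro nonneg_bdd_above_summable_on) (auto intro!: bdd_aboveI[of _ "b\<^sup>2"])
qed

lemma sq_infsum_le:
  fixes f :: "'w \<Rightarrow> 'e::real_normed_vector"
  assumes "\<And>F. finite F \<Longrightarrow> L2_set (\<lambda>w. norm (f w)) F \<le> b"
  shows "sqrt (infsum (\<lambda>w. (norm (f w))\<^sup>2) UNIV) \<le> b"
proof -
  have b0: "0 \<le> b" using assms[of "{}"] by simp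
  have "(\<Sum>w\<in>F. (norm (f w))\<^sup>2) \<le> b\<^sup>2" if "finite F" for F
    using power_mono[OF assms[OF that], of 2] by (simp add: L2_set_def sum_nonneg)
  moreover have "(\<lambda>w. (norm (f w))\<^sup>2) summable_on UNIV"
    using assms sq_summable_iff by blast
  ultimately have "infsum (\<lambda>w. (norm (f w))\<^sup>2) UNIV \<le> b\<^sup>2"
    by (intro infsum_le_finite_sums) auto
  thus ?thesis using b0 real_le_lsqrt[of b "infsum (\<lambda>w. (norm (f w))\<^sup>2) UNIV"]
    by (simp add: real_sqrt_le_iff' sqrt_le_D)
qed

lemma sq_summable_add:
  fixes f g :: "'w \<Rightarrow> 'e::real_normed_vector"
  assumes "(\<lambda>w. (norm (f w))\<^sup>2) summable_on UNIV" "(\<lambda>w. (norm (g w))\<^sup>2) summable_on UNIV"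
  shows "(\<lambda>w. (norm (f w + g w))\<^sup>2) summable_on UNIV"
proof -
  obtain a b where ab: "\<And>F. finite F \<Longrightarrow> L2_set (\<lambda>w. norm (f w)) F \<le> a"
      "\<And>F. finite F \<Longrightarrow> L2_set (\<lambda>w. norm (g w)) F \<le> b"
    using assms unfolding sq_summable_iff by blast
  have "L2_set (\<lambda>w. norm (f w + g w)) F \<le> a + b" if "finite F" for F
  proof -
    have "L2_set (\<lambda>w. norm (f w + g w)) F \<le> L2_set (\<lambda>w. norm (f w) + norm (g w)) F"
      by (intro L2_set_mono) (auto simp: norm_triangle_ineq)
    also have "\<dots> \<le> L2_set (\<lambda>w. norm (f w)) F + L2_set (\<lambda>w. norm (g w)) F"
      by (rule L2_set_triangle_ineq)
    finally show ?thesis using ab[OF that] by linarith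
  qed
  thus ?thesis unfolding sq_summable_iff by blast
qed

typedef (overloaded) ('w, 'e) l2 = "{f :: 'w \<Rightarrow> 'e::chilbert_space. (\<lambda>w. (norm (f w))\<^sup>2) summable_on UNIV}"
  morphisms coord Abs_l2
  by (rule exI[of _ "\<lambda>_. 0"]) simp

setup_lifting type_definition_l2

lemma coord_sq_summable: "(\<lambda>w. (norm (coord x w))\<^sup>2) summable_on UNIV"
  using coord[of x] by simp

lemma l2_eqI: "(\<And>w. coord x w = coord y w) \<Longrightarrow> x = y"
  by (simp add: coord_inject[symmetric] fun_eq_iff)

lemma cinner_abs_summable:
  "(\<lambda>w. cinner (coord x w) (coord y w)) summable_on UNIV"
proof -
  have "(\<lambda>w. (norm (coord x w))\<^sup>2 + (norm (coord y w))\<^sup>2) summable_on UNIV"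
    by (intro summable_on_add coord_sq_summable)
  hence "(\<lambda>w. norm (cinner (coord x w) (coord y w))) summable_on UNIV"
    by (rule summable_on_comparison_test) (auto simp: cmod_cinner_le)
  thus ?thesis by (rule abs_summable_summable)
qed

instantiation l2 :: (type, chilbert_space) real_vector
begin

lift_definition zero_l2 :: "('a, 'b) l2" is "\<lambda>_. 0" by simp
lift_definition plus_l2 :: "('a, 'b) l2 \<Rightarrow> ('a, 'b) l2 \<Rightarrow> ('a, 'b) l2"
  is "\<lambda>f g w. f w + g w" by (rule sq_summable_add)
lift_definition uminus_l2 :: "('a, 'b) l2 \<Rightarrow> ('a, 'b) l2" is "\<lambda>f w. - f w" by simp
lift_definition minus_l2 :: "('a, 'b) l2 \<Rightarrow> ('a, 'b) l2 \<Rightarrow> ('a, 'b) l2"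
  is "\<lambda>f g w. f w - g w"
  using sq_summable_add[of _ "\<lambda>w. - _ w"] by simp
lift_definition scaleR_l2 :: "real \<Rightarrow> ('a, 'b) l2 \<Rightarrow> ('a, 'b) l2" is "\<lambda>r f w. r *\<^sub>R f w"
  by (simp add: power_mult_distrib summable_on_cmult_right)

instance
proof
  fix x y z :: "('a, 'b) l2" and a b :: real
  show "x + y + z = x + (y + z)" by transfer (simp add: add.assoc)
  show "x + y = y + x" by transfer (simp add: add.commute)
  show "0 + x = x" by transfer simp
  show "- x + x = 0" by transfer simp
  show "x - y = x + - y" by transfer simp
  show "a *\<^sub>R (x + y) = a *\<^sub>R x + a *\<^sub>R y" by transfer (simp add: scaleR_add_right)
  show "(a + b) *\<^sub>R x = a *\<^sub>R x + b *\<^sub>R x" by transfer (simp add: scaleR_add_left)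
  show "a *\<^sub>R b *\<^sub>R x = (a * b) *\<^sub>R x" by transfer simp
  show "1 *\<^sub>R x = x" by transfer simp
qed

end

instantiation l2 :: (type, chilbert_space) real_normed_vector
begin

definition norm_l2 :: "('a, 'b) l2 \<Rightarrow> real"
  where "norm_l2 x = sqrt (infsum (\<lambda>w. (norm (coord x w))\<^sup>2) UNIV)"
definition dist_l2 :: "('a, 'b) l2 \<Rightarrow> ('a, 'b) l2 \<Rightarrow> real"
  where "dist_l2 x y = norm (x - y)"
definition sgn_l2 :: "('a, 'b) l2 \<Rightarrow> ('a, 'b) l2" where "sgn_l2 x = x /\<^sub>R norm x"
definition uniformity_l2 :: "(('a, 'b) l2 \<times> ('a, 'b) l2) filter"
  where [code del]: "uniformity_l2 = (INF e\<in>{0 <..}. principal {(x, y). dist x y < e})"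
definition open_l2 :: "('a, 'b) l2 set \<Rightarrow> bool"
  where [code del]: "open_l2 U \<longleftrightarrow> (\<forall>x\<in>U. eventually (\<lambda>(x', y). x' = x \<longrightarrow> y \<in> U) uniformity)"

lemma L2_set_coord_le: "finite F \<Longrightarrow> L2_set (\<lambda>w. norm (coord x w)) F \<le> norm (x :: ('a, 'b) l2)"
  unfolding norm_l2_def L2_set_def
  by (intro real_sqrt_le_mono finite_sum_le_infsum coord_sq_summable) auto

lemma norm_l2_le:
  "(\<And>F. finite F \<Longrightarrow> L2_set (\<lambda>w. norm (coord x w)) F \<le> b) \<Longrightarrow> norm (x :: ('a, 'b) l2) \<le> b"
  unfolding norm_l2_def by (rule sq_infsum_le)

lemma norm_coord_le: "norm (coord x w) \<le> norm (x :: ('a, 'b) l2)"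
  using L2_set_coord_le[of "{w}" x] by simp

instance
proof
  fix x y :: "('a, 'b) l2" and a :: real
  show "dist x y = norm (x - y)" by (fact dist_l2_def)
  show "sgn x = x /\<^sub>R norm x" by (fact sgn_l2_def)
  show "uniformity = (INF e\<in>{0 <..}. principal {(x, y :: ('a, 'b) l2). dist x y < e})"
    by (fact uniformity_l2_def)
  show "open U \<longleftrightarrow> (\<forall>x\<in>U. eventually (\<lambda>(x', y). x' = x \<longrightarrow> y \<in> U) uniformity)"
    for U :: "('a, 'b) l2 set" by (fact open_l2_def)
  show "norm x = 0 \<longleftrightarrow> x = 0"
  proof
    assume "norm x = 0"
    hence "coord x w = 0" for w using norm_coord_le[of x w] by simp
    thus "x = 0" by (intro l2_eqI) (simp add: zero_l2.rep_eq)
  qed (simp add: norm_l2_def zero_l2.rep_eq)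
  show "norm (x + y) \<le> norm x + norm y"
  proof (rule norm_l2_le)
    fix F :: "'a set" assume F: "finite F"
    have "L2_set (\<lambda>w. norm (coord (x + y) w)) F \<le> L2_set (\<lambda>w. norm (coord x w) + norm (coord y w)) F"
      by (intro L2_set_mono) (auto simp: plus_l2.rep_eq norm_triangle_ineq)
    also have "\<dots> \<le> L2_set (\<lambda>w. norm (coord x w)) F + L2_set (\<lambda>w. norm (coord y w)) F"
      by (rule L2_set_triangle_ineq)
    finally show "L2_set (\<lambda>w. norm (coord (x + y) w)) F \<le> norm x + norm y"
      using L2_set_coord_le[OF F, of x] L2_set_coord_le[OF F, of y] by linarith
  qed
  show "norm (a *\<^sub>R x) = \<bar>a\<bar> * norm x"
    by (simp add: norm_l2_def scaleR_l2.rep_eq power_mult_distrib infsum_cmult_right'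
        real_sqrt_mult)
qed

end

instance l2 :: (type, chilbert_space) banach
proof
  fix X :: "nat \<Rightarrow> ('a, 'b) l2" assume X: "Cauchy X"
  have "Cauchy (\<lambda>p. coord (X p) w)" for w
  proof (rule CauchyI)
    fix e :: real assume "0 < e"
    then obtain M where M: "\<And>p q. p \<ge> M \<Longrightarrow> q \<ge> M \<Longrightarrow> norm (X p - X q) < e"
      using CauchyD[OF X] by blast
    have "norm (coord (X p) w - coord (X q) w) < e" if "p \<ge> M" "q \<ge> M" for p q
      using norm_coord_le[of "X p - X q" w] M[OF that] by (simp add: minus_l2.rep_eq)
    thus "\<exists>M. \<forall>m\<ge>M. \<forall>n\<ge>M. norm (coord (X m) w - coord (X n) w) < e" by blast
  qed
  hence "convergent (\<lambda>p. coord (X p) w)" for w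
    by (rule Cauchy_convergent)
  hence "\<forall>w. \<exists>l. (\<lambda>p. coord (X p) w) \<longlonglongrightarrow> l"
    by (simp add: convergent_def)
  then obtain f where f: "\<And>w. (\<lambda>p. coord (X p) w) \<longlonglongrightarrow> f w"
    by metis
  have lim: "L2_set (\<lambda>w. norm (coord (X p) w - f w)) F \<le> e"
    if M: "\<And>p q. p \<ge> M \<Longrightarrow> q \<ge> M \<Longrightarrow> norm (X p - X q) < e" and p: "p \<ge> M" and F: "finite F"
    for M p e F
  proof (rule LIMSEQ_le_const2)
    show "(\<lambda>q. L2_set (\<lambda>w. norm (coord (X p) w - coord (X q) w)) F)
        \<longlonglongrightarrow> L2_set (\<lambda>w. norm (coord (X p) w - f w)) F"
      unfolding L2_set_def by (intro tendsto_intros f)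
    show "\<exists>N. \<forall>q\<ge>N. L2_set (\<lambda>w. norm (coord (X p) w - coord (X q) w)) F \<le> e"
    proof (intro exI[of _ M] allI impI)
      fix q assume "q \<ge> M"
      thus "L2_set (\<lambda>w. norm (coord (X p) w - coord (X q) w)) F \<le> e"
        using L2_set_coord_le[OF F, of "X p - X q"] M[OF p, of q] by (simp add: minus_l2.rep_eq)
    qed
  qed
  obtain M1 where M1: "\<And>p q. p \<ge> M1 \<Longrightarrow> q \<ge> M1 \<Longrightarrow> norm (X p - X q) < 1"
    using CauchyD[OF X, of 1] by auto
  have "(\<lambda>w. (norm (coord (X M1) w - f w))\<^sup>2) summable_on UNIV"
    unfolding sq_summable_iff using lim[OF M1 order_refl] by blast
  from sq_summable_add[OF _ this, of "\<lambda>w. - coord (X M1) w"]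
  have "(\<lambda>w. (norm (f w))\<^sup>2) summable_on UNIV"
    by (simp add: coord_sq_summable)
  hence L: "coord (Abs_l2 f) = f" by (simp add: Abs_l2_inverse)
  have "X \<longlonglongrightarrow> Abs_l2 f"
  proof (rule LIMSEQ_I)
    fix e :: real assume "0 < e"
    then obtain M where M: "\<And>p q. p \<ge> M \<Longrightarrow> q \<ge> M \<Longrightarrow> norm (X p - X q) < e / 2"
      using CauchyD[OF X, of "e / 2"] by auto
    have "norm (X p - Abs_l2 f) \<le> e / 2" if "p \<ge> M" for p
      by (rule norm_l2_le) (use lim[OF M that] in \<open>simp add: minus_l2.rep_eq L\<close>)
    thus "\<exists>M. \<forall>p\<ge>M. norm (X p - Abs_l2 f) < e"
      using \<open>0 < e\<close> by (intro exI[of _ M]) fastforce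
  qed
  thus "convergent X" by (auto simp: convergent_def)
qed

instantiation l2 :: (type, chilbert_space) chilbert_space
begin

lift_definition scaleC_l2 :: "complex \<Rightarrow> ('a, 'b) l2 \<Rightarrow> ('a, 'b) l2" is "\<lambda>c f w. c *\<^sub>C f w"
  by (simp add: norm_scaleC power_mult_distrib summable_on_cmult_right)

definition cinner_l2 :: "('a, 'b) l2 \<Rightarrow> ('a, 'b) l2 \<Rightarrow> complex"
  where "cinner_l2 x y = infsum (\<lambda>w. cinner (coord x w) (coord y w)) UNIV"

instance
proof
  fix x y z :: "('a, 'b) l2" and c d :: complex and r :: real
  show "c *\<^sub>C (x + y) = c *\<^sub>C x + c *\<^sub>C y" by transfer (simp add: scaleC_add_right)
  show "(c + d) *\<^sub>C x = c *\<^sub>C x + d *\<^sub>C x" by transfer (simp add: scaleC_add_left)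
  show "c *\<^sub>C d *\<^sub>C x = (c * d) *\<^sub>C x" by transfer (simp add: scaleC_scaleC)
  show "complex_of_real r *\<^sub>C x = r *\<^sub>R x" by transfer (simp add: scaleC_of_real)
  show "cinner (x + y) z = cinner x z + cinner y z"
    by (simp add: cinner_l2_def plus_l2.rep_eq cinner_add_left infsum_add cinner_abs_summable)
  show "cinner (c *\<^sub>C x) y = c * cinner x y"
    by (simp add: cinner_l2_def scaleC_l2.rep_eq cinner_scaleC_left infsum_cmult_right')
  show "cinner x y = cnj (cinner y x)"
    unfolding cinner_l2_def infsum_cnj[symmetric] by (metis cinner_commute)
  have "cinner x x = complex_of_real (infsum (\<lambda>w. (norm (coord x w))\<^sup>2) UNIV)"
    unfolding cinner_l2_def cinner_self
    by (intro infsumI has_sum_of_real has_sum_infsum coord_sq_summable)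
  thus "cinner x x = complex_of_real ((norm x)\<^sup>2)"
    by (simp add: norm_l2_def infsum_nonneg)
qed

end

section \<open>Bounded operators\<close>

type_synonym 'h op = "'h \<Rightarrow>\<^sub>L 'h"

text \<open>For closed subspaces \<open>V\<close> and \<open>W\<close>, a bounded operator from \<open>V\<close> to \<open>W\<close> is represented by its
  extension by zero on the orthogonal complement of \<open>V\<close>. This preserves sums, compositions, adjoints,
  operator norms, and norm and strong limits; the identity of \<open>V\<close> becomes the orthogonal projection
  onto \<open>V\<close>.\<close>

definition bop :: "'a::chilbert_space set \<Rightarrow> 'b::chilbert_space set \<Rightarrow> ('a \<Rightarrow>\<^sub>L 'b) set" where
  "bop V W = {T :: 'a \<Rightarrow>\<^sub>L 'b. (\<forall>c x. T (c *\<^sub>C x) = c *\<^sub>C T x) \<and> (\<forall>x. T x \<in> W) \<and>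
                 (\<forall>x. (\<forall>v\<in>V. cinner x v = 0) \<longrightarrow> T x = 0)}"

definition adj :: "('a::chilbert_space \<Rightarrow>\<^sub>L 'b::chilbert_space) \<Rightarrow> 'b \<Rightarrow>\<^sub>L 'a" where
  "adj T = (THE T'. \<forall>x y. cinner (T x) y = cinner x (blinfun_apply T' y))"

definition pos_op :: "'h::chilbert_space op \<Rightarrow> bool" where
  "pos_op T \<longleftrightarrow> T \<in> bop UNIV UNIV \<and> (\<forall>x. \<exists>c\<ge>0. cinner (T x) x = complex_of_real c)"

definition sqrt_op :: "'h::chilbert_space op \<Rightarrow> 'h op" where
  "sqrt_op T = (THE Q. pos_op Q \<and> Q o\<^sub>L Q = T)"


section \<open>Tensor products\<close>

text \<open>\<open>('w, 'e) l2\<close> serves as the Hilbert tensor product of \<open>'e\<close> with \<open>('w, complex) l2\<close>, and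
  \<open>('v \<times> 'w, 'e) l2\<close> as that of \<open>('v, 'e) l2\<close> with \<open>('w, complex) l2\<close>. With these realizations the
  triple products \<open>(E \<otimes> F) \<otimes> F'\<close> and \<open>E \<otimes> (F \<otimes> F')\<close> are literally the same space.\<close>

lift_definition vtensor :: "'e::chilbert_space \<Rightarrow> ('w, complex) l2 \<Rightarrow> ('w, 'e) l2"
  is "\<lambda>h f w. f w *\<^sub>C h"
  by (simp add: norm_scaleC power_mult_distrib summable_on_cmult_left)

lift_definition l2_tensor :: "('v, 'e::chilbert_space) l2 \<Rightarrow> ('w, complex) l2 \<Rightarrow> ('v \<times> 'w, 'e) l2"
  is "\<lambda>f g (v, w). g w *\<^sub>C f v"
proof -
  fix f :: "'v \<Rightarrow> 'e" and g :: "'w \<Rightarrow> complex"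
  assume fg: "(\<lambda>v. (norm (f v))\<^sup>2) summable_on UNIV" "(\<lambda>w. (norm (g w))\<^sup>2) summable_on UNIV"
  show "(\<lambda>p. (norm (case p of (v, w) \<Rightarrow> g w *\<^sub>C f v))\<^sup>2) summable_on UNIV"
  proof (rule nonneg_bdd_above_summable_on)
    let ?b = "infsum (\<lambda>v. (norm (f v))\<^sup>2) UNIV * infsum (\<lambda>w. (norm (g w))\<^sup>2) UNIV"
    show "bdd_above (sum (\<lambda>p. (norm (case p of (v, w) \<Rightarrow> g w *\<^sub>C f v))\<^sup>2) ` {F. F \<subseteq> UNIV \<and> finite F})"
    proof (rule bdd_aboveI2[of _ _ ?b], clarsimp)
      fix F :: "('v \<times> 'w) set" assume F: "finite F"
      have "(\<Sum>p\<in>F. (norm (case p of (v, w) \<Rightarrow> g w *\<^sub>C f v))\<^sup>2) \<le>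
          (\<Sum>p\<in>fst ` F \<times> snd ` F. (norm (case p of (v, w) \<Rightarrow> g w *\<^sub>C f v))\<^sup>2)"
        using F by (intro sum_mono2) (auto simp: rev_image_eqI)
      also have "\<dots> = (\<Sum>v\<in>fst ` F. (norm (f v))\<^sup>2) * (\<Sum>w\<in>snd ` F. (norm (g w))\<^sup>2)"
        by (simp add: sum_product sum.cartesian_product norm_scaleC power_mult_distrib case_prod_beta
            mult.commute)
      also have "\<dots> \<le> ?b"
        using F fg by (intro mult_mono finite_sum_le_infsum) (auto intro: sum_nonneg infsum_nonneg)
      finally show "(\<Sum>p\<in>F. (norm (case p of (v, w) \<Rightarrow> g w *\<^sub>C f v))\<^sup>2) \<le> ?b" .
    qed
  qed simp
qed

lemma vtensor_l2_tensor: "vtensor h (l2_tensor x y) = l2_tensor (vtensor h x) y"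
  by (rule l2_eqI) (auto simp: vtensor.rep_eq l2_tensor.rep_eq scaleC_scaleC scaleC_complex_def)

lemma cinner_vtensor: "cinner (vtensor h x) (vtensor l y) = cinner h l * cinner x y"
proof -
  have "cinner (coord (vtensor h x) w) (coord (vtensor l y) w) =
      cinner h l * cinner (coord x w) (coord y w)" for w
    by (simp add: vtensor.rep_eq cinner_scaleC_left cinner_scaleC_right cinner_complex_def)
  thus ?thesis
    by (simp add: cinner_l2_def infsum_cmult_right')
qed

definition op_vtensor :: "'e::chilbert_space op \<Rightarrow> (('v, complex) l2 \<Rightarrow>\<^sub>L ('w, complex) l2) \<Rightarrow>
    ('v, 'e) l2 \<Rightarrow>\<^sub>L ('w, 'e) l2" where
  "op_vtensor A T = (THE C. C \<in> bop UNIV UNIV \<and> (\<forall>h x. blinfun_apply C (vtensor h x) = vtensor (A h) (T x)))"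

definition op_l2_tensor :: "('v, 'e::chilbert_space) l2 op \<Rightarrow> ('w, complex) l2 op \<Rightarrow>
    ('v \<times> 'w, 'e) l2 op" where
  "op_l2_tensor A T = (THE C. C \<in> bop UNIV UNIV \<and>
     (\<forall>x y. blinfun_apply C (l2_tensor x y) = l2_tensor (A x) (T y)))"

text \<open>\<open>mtensor k x\<close> is \<open>x 1 \<otimes> \<dots> \<otimes> x k\<close>; the index tuples are the functions with domain \<open>{1..k}\<close>.\<close>

lift_definition mtensor :: "nat \<Rightarrow> (nat \<Rightarrow> ('w, complex) l2) \<Rightarrow> (nat \<Rightarrow> 'w, complex) l2"
  is "\<lambda>k x \<gamma>. if \<gamma> \<in> extensional {1..k} then \<Prod>i=1..k. x i (\<gamma> i) else 0"
proof -
  fix k and x :: "nat \<Rightarrow> 'w \<Rightarrow> complex"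
  assume x: "\<And>i. (\<lambda>w. (norm (x i w))\<^sup>2) summable_on UNIV"
  have "(\<lambda>\<gamma>. \<Prod>i\<in>{1..k}. (norm (x i (\<gamma> i)))\<^sup>2) summable_on (Pi\<^sub>E {1..k} (\<lambda>_. UNIV))"
  proof (rule nonneg_bdd_above_summable_on)
    let ?b = "\<Prod>i\<in>{1..k}. infsum (\<lambda>w. (norm (x i w))\<^sup>2) UNIV"
    have "(\<Sum>\<gamma>\<in>F. \<Prod>i\<in>{1..k}. (norm (x i (\<gamma> i)))\<^sup>2) \<le> ?b"
      if F: "F \<subseteq> Pi\<^sub>E {1..k} (\<lambda>_. UNIV)" "finite F" for F
    proof -
      have "(\<Sum>\<gamma>\<in>F. \<Prod>i\<in>{1..k}. (norm (x i (\<gamma> i)))\<^sup>2) \<le>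
          (\<Sum>\<gamma>\<in>Pi\<^sub>E {1..k} (\<lambda>i. (\<lambda>\<gamma>. \<gamma> i) ` F). \<Prod>i\<in>{1..k}. (norm (x i (\<gamma> i)))\<^sup>2)"
        using F by (intro sum_mono2) (auto intro!: finite_PiE prod_nonneg simp: PiE_iff)
      also have "\<dots> = (\<Prod>i\<in>{1..k}. \<Sum>w\<in>(\<lambda>\<gamma>. \<gamma> i) ` F. (norm (x i w))\<^sup>2)"
        using F by (subst prod_sum_PiE) auto
      also have "\<dots> \<le> ?b"
        using F x by (intro prod_mono conjI sum_nonneg finite_sum_le_infsum) auto
      finally show ?thesis .
    qed
    thus "bdd_above (sum (\<lambda>\<gamma>. \<Prod>i\<in>{1..k}. (norm (x i (\<gamma> i)))\<^sup>2) `
        {F. F \<subseteq> Pi\<^sub>E {1..k} (\<lambda>_. UNIV) \<and> finite F})"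
      by (intro bdd_aboveI2[of _ _ ?b]) auto
  qed (auto intro: prod_nonneg)
  also have "?this \<longleftrightarrow> (\<lambda>\<gamma>. (norm (if \<gamma> \<in> extensional {1..k} then \<Prod>i=1..k. x i (\<gamma> i) else 0))\<^sup>2)
      summable_on UNIV"
    by (rule summable_on_cong_neutral) (auto simp: PiE_iff prod_norm[symmetric] prod_power_distrib)
  finally show "(\<lambda>\<gamma>. (norm (if \<gamma> \<in> extensional {1..k} then \<Prod>i=1..k. x i (\<gamma> i) else 0))\<^sup>2)
      summable_on UNIV" .
qed


section \<open>Fock spaces and creation operators\<close>

text \<open>Words of the free semigroup on \<open>n\<close> generators are lists over \<open>{1..n}\<close>, the identity being
  \<open>[]\<close>. They index the standard orthonormal basis of the full Fock space over an \<open>n\<close>-dimensional space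
  with a fixed orthonormal basis: the words of length \<open>p\<close> index the basis of the \<open>p\<close>-th tensor power,
  and \<open>ket []\<close> is the vacuum vector.\<close>

definition l2_on :: "'w set \<Rightarrow> ('w, 'e::chilbert_space) l2 set" where
  "l2_on W = {x. \<forall>w. w \<notin> W \<longrightarrow> coord x w = 0}"

lift_definition l2_restrict :: "'w set \<Rightarrow> ('w, 'e::chilbert_space) l2 \<Rightarrow> ('w, 'e) l2"
  is "\<lambda>W f w. if w \<in> W then f w else 0"
  by (rule summable_on_comparison_test) auto

lift_definition id_on :: "'w set \<Rightarrow> ('w, 'e::chilbert_space) l2 op" is l2_restrict
proof (rule bounded_linear_intro[where K = 1])
  fix W and x y :: "('w, 'e) l2" and r :: real
  show "l2_restrict W (x + y) = l2_restrict W x + l2_restrict W y"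
    by (rule l2_eqI) (simp add: l2_restrict.rep_eq plus_l2.rep_eq)
  show "l2_restrict W (r *\<^sub>R x) = r *\<^sub>R l2_restrict W x"
    by (rule l2_eqI) (simp add: l2_restrict.rep_eq scaleR_l2.rep_eq)
  show "norm (l2_restrict W x) \<le> norm x * 1"
  proof (rule norm_l2_le)
    fix F :: "'w set" assume F: "finite F"
    have "L2_set (\<lambda>w. norm (coord (l2_restrict W x) w)) F \<le> L2_set (\<lambda>w. norm (coord x w)) F"
      by (intro L2_set_mono) (auto simp: l2_restrict.rep_eq)
    thus "L2_set (\<lambda>w. norm (coord (l2_restrict W x) w)) F \<le> norm x * 1"
      using L2_set_coord_le[OF F, of x] by simp
  qed
qed

lift_definition ket :: "'w \<Rightarrow> ('w, complex) l2" is "\<lambda>v w. if w = v then 1 else 0"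
  by (rule finite_nonzero_values_imp_summable_on) simp

lemma mtensor_ket: "\<gamma> \<in> extensional {1..k} \<Longrightarrow> mtensor k (\<lambda>i. ket (\<gamma> i)) = ket \<gamma>"
proof (rule l2_eqI)
  fix w
  assume \<gamma>: "\<gamma> \<in> extensional {1..k}"
  have "\<exists>i\<in>{1..k}. w i \<noteq> \<gamma> i" if "w \<in> extensional {1..k}" "w \<noteq> \<gamma>"
    using extensionalityI[OF that(1) \<gamma>] that(2) by blast
  thus "coord (mtensor k (\<lambda>i. ket (\<gamma> i))) w = coord (ket \<gamma>) w"
    using \<gamma> by (auto simp: mtensor.rep_eq ket.rep_eq prod_zero_iff)
qed

definition fock :: "nat \<Rightarrow> (nat list, complex) l2 set" where
  "fock n = l2_on (lists {1..n})"

definition words :: "nat \<Rightarrow> (nat \<Rightarrow> nat) \<Rightarrow> (nat \<Rightarrow> nat list) set" where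
  "words k n = (\<Pi>\<^sub>E i\<in>{1..k}. lists {1..n i})"

text \<open>The tensor product of \<open>fock (n 1), \<dots>, fock (n k)\<close> (for \<open>'e = complex\<close>), respectively its
  tensor product with \<open>'e\<close> on the left.\<close>

definition mfock :: "nat \<Rightarrow> (nat \<Rightarrow> nat) \<Rightarrow> (nat \<Rightarrow> nat list, 'e::chilbert_space) l2 set" where
  "mfock k n = l2_on (words k n)"

type_synonym mfock_op = "(nat \<Rightarrow> nat list, complex) l2 op"

abbreviation id_mfock :: "nat \<Rightarrow> (nat \<Rightarrow> nat) \<Rightarrow> mfock_op" where
  "id_mfock k n \<equiv> id_on (words k n)"

definition left_creation :: "nat \<Rightarrow> nat \<Rightarrow> (nat list, complex) l2 op" where
  "left_creation n j = (THE T. T \<in> bop (fock n) (fock n) \<and>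
     (\<forall>\<alpha>\<in>lists {1..n}. blinfun_apply T (ket \<alpha>) = ket (j # \<alpha>)))"

definition right_creation :: "nat \<Rightarrow> nat \<Rightarrow> (nat list, complex) l2 op" where
  "right_creation n j = (THE T. T \<in> bop (fock n) (fock n) \<and>
     (\<forall>\<alpha>\<in>lists {1..n}. blinfun_apply T (ket \<alpha>) = ket (\<alpha> @ [j])))"

definition ampliation ::
    "nat \<Rightarrow> (nat \<Rightarrow> nat) \<Rightarrow> nat \<Rightarrow> (nat list, complex) l2 op \<Rightarrow> mfock_op" where
  "ampliation k n i T = (THE C. C \<in> bop (mfock k n) (mfock k n) \<and>
     (\<forall>x. (\<forall>l\<in>{1..k}. x l \<in> fock (n l)) \<longrightarrow> blinfun_apply C (mtensor k x) = mtensor k (x(i := T (x i)))))"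

definition S_op :: "nat \<Rightarrow> (nat \<Rightarrow> nat) \<Rightarrow> nat \<Rightarrow> nat \<Rightarrow> mfock_op" where
  "S_op k n i j = ampliation k n i (left_creation (n i) j)"

definition R_op :: "nat \<Rightarrow> (nat \<Rightarrow> nat) \<Rightarrow> nat \<Rightarrow> nat \<Rightarrow> mfock_op" where
  "R_op k n i j = ampliation k n i (right_creation (n i) j)"

text \<open>In the next three definitions \<open>I\<close> is the identity of the space on which the operators act.\<close>

primrec op_word :: "'h::chilbert_space op \<Rightarrow> (nat \<Rightarrow> 'h op) \<Rightarrow> nat list \<Rightarrow> 'h op" where
  "op_word I T [] = I"
| "op_word I T (j # \<alpha>) = T j o\<^sub>L op_word I T \<alpha>"

definition op_mword ::
    "'h::chilbert_space op \<Rightarrow> nat \<Rightarrow> (nat \<Rightarrow> nat \<Rightarrow> 'h op) \<Rightarrow> (nat \<Rightarrow> nat list) \<Rightarrow> 'h op" where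
  "op_mword I k T \<alpha> = foldr (\<lambda>i Q. op_word I (T i) (\<alpha> i) o\<^sub>L Q) [1..<Suc k] I"

definition op_mword_adj ::
    "'h::chilbert_space op \<Rightarrow> nat \<Rightarrow> (nat \<Rightarrow> nat \<Rightarrow> 'h op) \<Rightarrow> (nat \<Rightarrow> nat list) \<Rightarrow> 'h op" where
  "op_mword_adj I k T \<beta> = foldr (\<lambda>i Q. adj (op_word I (T i) (\<beta> i)) o\<^sub>L Q) [1..<Suc k] I"


section \<open>Multi-Toeplitz operators and Fourier series\<close>

definition multi_toeplitz ::
    "nat \<Rightarrow> (nat \<Rightarrow> nat) \<Rightarrow> (nat \<Rightarrow> nat list, 'e::chilbert_space) l2 op \<Rightarrow> bool" where
  "multi_toeplitz k n A \<longleftrightarrow> A \<in> bop (mfock k n) (mfock k n) \<and>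
     (\<forall>i\<in>{1..k}. \<forall>s\<in>{1..n i}. \<forall>t\<in>{1..n i}.
        op_vtensor id_blinfun (adj (R_op k n i s)) o\<^sub>L A o\<^sub>L op_vtensor id_blinfun (R_op k n i t)
          = (if s = t then A else 0))"

text \<open>A multi-degree \<open>(m\<^sub>1, \<dots>, m\<^sub>k)\<close> is a list of \<open>k\<close> integers. The conversion \<open>nat\<close> sends negative
  integers to \<open>0\<close>, so \<open>nat m\<close> and \<open>nat (- m)\<close> are the positive and negative parts of \<open>m\<close>.\<close>

definition fourier_index ::
    "nat \<Rightarrow> (nat \<Rightarrow> nat) \<Rightarrow> int list \<Rightarrow> ((nat \<Rightarrow> nat list) \<times> (nat \<Rightarrow> nat list)) set" where
  "fourier_index k n ms = {(\<alpha>, \<beta>). \<alpha> \<in> words k n \<and> \<beta> \<in> words k n \<and>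
     (\<forall>i\<in>{1..k}. length (\<alpha> i) = nat (- (ms ! (i - 1))) \<and> length (\<beta> i) = nat (ms ! (i - 1)))}"

text \<open>A formal Fourier series is given by its coefficients \<open>C \<alpha> \<beta>\<close>; only those with
  \<open>(\<alpha>, \<beta>)\<close> in some \<open>fourier_index k n ms\<close> are relevant.\<close>

type_synonym 'e coeffs = "(nat \<Rightarrow> nat list) \<Rightarrow> (nat \<Rightarrow> nat list) \<Rightarrow> 'e op"

definition has_fourier_series ::
    "nat \<Rightarrow> (nat \<Rightarrow> nat) \<Rightarrow> (nat \<Rightarrow> nat list, 'e::chilbert_space) l2 op \<Rightarrow> 'e coeffs \<Rightarrow> bool" where
  "has_fourier_series k n A C \<longleftrightarrow>
     (\<forall>ms. length ms = k \<longrightarrow> (\<forall>(\<alpha>, \<beta>)\<in>fourier_index k n ms. \<forall>h l.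
        cinner (C \<alpha> \<beta> h) l =
        cinner
          (A (vtensor h (mtensor k (\<lambda>i. if 0 \<le> ms ! (i - 1) then ket (\<beta> i) else ket []))))
          (vtensor l (mtensor k (\<lambda>i. if 0 \<le> ms ! (i - 1) then ket [] else ket (\<alpha> i))))))"

definition zsums :: "(int \<Rightarrow> 'a::real_normed_vector) \<Rightarrow> 'a \<Rightarrow> bool" where
  "zsums f s \<longleftrightarrow> (\<exists>a b. (\<lambda>p. f (int p)) sums a \<and> (\<lambda>p. f (- int (Suc p))) sums b \<and> s = a + b)"

text \<open>Iterated sum over \<open>k\<close> integers; the head of the list is the outermost summation index.\<close>

primrec iterated_zsums :: "nat \<Rightarrow> (int list \<Rightarrow> 'a::real_normed_vector) \<Rightarrow> 'a \<Rightarrow> bool" where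
  "iterated_zsums 0 f s \<longleftrightarrow> s = f []"
| "iterated_zsums (Suc k) f s \<longleftrightarrow>
     (\<exists>g. (\<forall>m. iterated_zsums k (\<lambda>ms. f (m # ms)) (g m)) \<and> zsums g s)"

definition phi_part :: "nat \<Rightarrow> (nat \<Rightarrow> nat) \<Rightarrow> 'e::chilbert_space coeffs \<Rightarrow> real \<Rightarrow> int list \<Rightarrow>
    (nat \<Rightarrow> nat list, 'e) l2 op" where
  "phi_part k n C r ms = (\<Sum>(\<alpha>, \<beta>)\<in>fourier_index k n ms.
     r ^ (\<Sum>i=1..k. length (\<alpha> i) + length (\<beta> i)) *\<^sub>R
       op_vtensor (C \<alpha> \<beta>)
         (op_mword (id_mfock k n) k (S_op k n) \<alpha> o\<^sub>L op_mword_adj (id_mfock k n) k (S_op k n) \<beta>))"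

definition phi_convergent :: "nat \<Rightarrow> (nat \<Rightarrow> nat) \<Rightarrow> 'e::chilbert_space coeffs \<Rightarrow> real \<Rightarrow> bool" where
  "phi_convergent k n C r \<longleftrightarrow> (\<exists>s. iterated_zsums k (phi_part k n C r) s)"

definition phi :: "nat \<Rightarrow> (nat \<Rightarrow> nat) \<Rightarrow> 'e::chilbert_space coeffs \<Rightarrow> real \<Rightarrow>
    (nat \<Rightarrow> nat list, 'e) l2 op" where
  "phi k n C r = (THE s. iterated_zsums k (phi_part k n C r) s)"


section \<open>The Berezin kernel and the extended Berezin transform\<close>

definition Phi_map :: "(nat \<Rightarrow> nat) \<Rightarrow> (nat \<Rightarrow> nat \<Rightarrow> 'h::chilbert_space op) \<Rightarrow> nat \<Rightarrow> 'h op \<Rightarrow> 'h op" where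
  "Phi_map n X i Y = (\<Sum>j=1..n i. X i j o\<^sub>L Y o\<^sub>L adj (X i j))"

definition Delta_map ::
    "nat \<Rightarrow> (nat \<Rightarrow> nat) \<Rightarrow> (nat \<Rightarrow> nat \<Rightarrow> 'h::chilbert_space op) \<Rightarrow> 'h op \<Rightarrow> 'h op" where
  "Delta_map k n X = foldr (\<lambda>i G. (\<lambda>Y. Y - Phi_map n X i Y) \<circ> G) [1..<Suc k] id"

definition berezin_kernel :: "nat \<Rightarrow> (nat \<Rightarrow> nat) \<Rightarrow> (nat \<Rightarrow> nat \<Rightarrow> mfock_op) \<Rightarrow>
    (nat \<Rightarrow> nat list, complex) l2 \<Rightarrow>\<^sub>L ((nat \<Rightarrow> nat list) \<times> (nat \<Rightarrow> nat list), complex) l2" where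
  "berezin_kernel k n X = Blinfun (\<lambda>h. \<Sum>\<^sub>\<infinity>\<beta>\<in>words k n.
     l2_tensor (mtensor k (\<lambda>i. ket (\<beta> i)))
       (sqrt_op (Delta_map k n X (id_mfock k n)) (op_mword_adj (id_mfock k n) k X \<beta> h)))"

definition berezin_ext :: "nat \<Rightarrow> (nat \<Rightarrow> nat) \<Rightarrow> (nat \<Rightarrow> nat \<Rightarrow> mfock_op) \<Rightarrow>
    (nat \<Rightarrow> nat list, 'e::chilbert_space) l2 op \<Rightarrow> (nat \<Rightarrow> nat list, 'e) l2 op" where
  "berezin_ext k n X u =
     op_vtensor id_blinfun (adj (berezin_kernel k n X)) o\<^sub>L
     op_l2_tensor u (id_mfock k n) o\<^sub>L
     op_vtensor id_blinfun (berezin_kernel k n X)"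

end

theory Submission
  imports Defs
begin

text \<open>A multi-Toeplitz operator is determined by its entries between basis tensors: the entry at a pair of
  word tuples does not change when a common suffix is removed in some component, and it vanishes unless in
  every component one of the two words is a suffix of the other. The Fourier coefficients are the remaining
  reduced entries. Compressing to multi-homogeneous components gives block-diagonal operators, so the
  part of multi-degree \<open>m\<close> of \<open>\<phi>(r\<^bold>S)\<close> has norm at most \<open>r\<close> to the power \<open>\<bar>m\<^sub>1\<bar> + \<dots> + \<bar>m\<^sub>k\<bar>\<close> times the
  norm of \<open>A\<close>, and the series converges absolutely. The Berezin kernel sends \<open>e\<^sub>\<gamma>\<close> to a weighted sum over
  all ways to cut each component of \<open>\<gamma>\<close> in two; a telescoping sum over the common suffixes shows
  that the Berezin transform multiplies each entry by the same power of \<open>r\<close> as \<open>\<phi>(r\<^bold>S)\<close>, while the kernel is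
  contractive. The strong limit follows on basis tensors by dominated convergence and in general by
  density. Conversely, uniformly bounded \<open>\<phi>(r\<^bold>S)\<close> converge on basis tensors as \<open>r\<close> tends to 1, and the strong
  limit has the required entries.\<close>

section \<open>Basis tensors and density\<close>

text \<open>Operators are handled through their entries
  \<open>coord (T (vket h \<gamma>)) \<eta>\<close>, with row \<eta> and column \<gamma>. Entries
  determine an operator, so an identity between operators given by descriptions, infinite sums or
  iterated limits becomes an identity between vectors of the coefficient space. Adjoints, tensor
  products of operators and square roots are given by definite descriptions; each time an explicit
  candidate is exhibited and shown to be the only one. The geometric estimate bounds the sum of the
  series only by \<open>norm A * (2 / (1 - r)) ^ k\<close>, which blows up at 1, so the uniform
  bound must come from elsewhere: once the sum is identified with the Berezin transform,
  contractivity of the kernel bounds it by \<open>norm A\<close>. Conversely, convergence of the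
  iterated series alone fixes the entries of its sum, because at most one multi-degree contributes
  to each entry.\<close>

abbreviation vket :: "'e::chilbert_space \<Rightarrow> 'w \<Rightarrow> ('w, 'e) l2" where
  "vket h w \<equiv> vtensor h (ket w)"

lemma scaleC_one [simp]: "1 *\<^sub>C (x :: 'a::chilbert_space) = x"
  using scaleC_of_real[of 1 x] by simp

lemma coord_vket: "coord (vket h v) w = (if w = v then h else 0)"
  by (simp add: vtensor.rep_eq ket.rep_eq)

lemma coord_simps [simp]:
  "coord (x + y) w = coord x w + coord y w"
  "coord (x - y) w = coord x w - coord y w"
  "coord 0 w = 0"
  "coord (r *\<^sub>R x) w = r *\<^sub>R coord x w"
  "coord (c *\<^sub>C x) w = c *\<^sub>C coord x w"
  by (simp_all add: plus_l2.rep_eq minus_l2.rep_eq zero_l2.rep_eq scaleR_l2.rep_eq scaleC_l2.rep_eq)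

lemma vket_linear:
  "vket (g + h) w = vket g w + vket h w"
  "vket (r *\<^sub>R h) w = r *\<^sub>R vket h w"
  "vket (c *\<^sub>C h) w = c *\<^sub>C vket h w"
  "vket 0 w = 0"
  by (rule l2_eqI, simp add: coord_vket)+

lemma vket_one [simp]: "vket 1 w = ket w"
  by (rule l2_eqI) (simp add: coord_vket ket.rep_eq)

lemma vket_complex: "vket (c::complex) w = c *\<^sub>C ket w"
  by (rule l2_eqI) (simp add: coord_vket ket.rep_eq scaleC_complex_def)

lemma cinner_zero [simp]: "cinner 0 (y :: 'a::chilbert_space) = 0" "cinner (x :: 'a) 0 = 0"
  using cinner_scaleC_left[of 0 0 y] cinner_scaleC_right[of x 0 0] by simp_all

lemma cinner_scaleR_left: "cinner (r *\<^sub>R x) (y :: 'a::chilbert_space) = of_real r * cinner x y"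
  by (simp add: scaleC_of_real[symmetric] cinner_scaleC_left)

lemma cinner_scaleR_right: "cinner x (r *\<^sub>R (y :: 'a::chilbert_space)) = of_real r * cinner x y"
  by (simp add: scaleC_of_real[symmetric] cinner_scaleC_right)

lemma cinner_diff_left: "cinner (x - y) (z :: 'a::chilbert_space) = cinner x z - cinner y z"
  using cinner_add_left[of "x - y" y z] by simp

lemma cinner_eqI:
  assumes "\<And>z. cinner x z = cinner (y :: 'a::chilbert_space) z"
  shows "x = y"
proof -
  have "cinner (x - y) (x - y) = 0"
    using assms by (simp add: cinner_diff_left)
  thus ?thesis by (simp add: cinner_self)
qed

lemma cinner_eqI_right:
  assumes "\<And>z. cinner z x = cinner z (y :: 'a::chilbert_space)"
  shows "x = y"
  by (rule cinner_eqI) (simp only: assms cinner_commute[of x] cinner_commute[of y])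

text \<open>Normalising both vectors in \<open>cmod_cinner_le\<close> gives Cauchy-Schwarz up to a
  factor 2, which is enough to make the inner product continuous.\<close>

lemma cmod_cinner_le_mult: "cmod (cinner x y) \<le> 2 * norm x * norm (y :: 'a::chilbert_space)"
proof (cases "x = 0 \<or> y = 0")
  case False
  have "cmod (cinner (x /\<^sub>R norm x) (y /\<^sub>R norm y)) \<le> 2"
    using cmod_cinner_le[of "x /\<^sub>R norm x" "y /\<^sub>R norm y"] False by simp
  thus ?thesis
    using False by (simp add: cinner_scaleR_left cinner_scaleR_right norm_mult norm_divide divide_simps mult_ac)
qed auto

lemma bounded_linear_cinner_left: "bounded_linear (\<lambda>x. cinner x (y :: 'a::chilbert_space))"
  by (rule bounded_linear_intro[where K = "2 * norm y"])
    (use cmod_cinner_le_mult[of _ y] in \<open>simp_all add: cinner_add_left cinner_scaleR_left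
      scaleR_conv_of_real mult_ac\<close>)

lemma bounded_linear_scaleC: "bounded_linear (\<lambda>x :: 'a::chilbert_space. c *\<^sub>C x)"
  by (rule bounded_linear_intro[where K = "cmod c"])
    (simp_all only: scaleC_add_right norm_scaleC scaleC_scaleC scaleC_of_real[symmetric]
      mult.commute order_refl)

lemma bounded_linear_coord: "bounded_linear (\<lambda>x :: ('w, 'e::chilbert_space) l2. coord x w)"
  by (rule bounded_linear_intro[where K = 1]) (simp_all add: norm_coord_le)

lemma cinner_vket: "cinner x (vket l w) = cinner (coord x w) l"
proof -
  have "cinner x (vket l w) = infsum (\<lambda>v. cinner (coord x v) (coord (vket l w) v)) {w}"
    unfolding cinner_l2_def by (rule infsum_cong_neutral) (auto simp: coord_vket)
  thus ?thesis by (simp add: coord_vket)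
qed

lemma norm_vket: "norm (vket h w) = norm h"
proof -
  have "complex_of_real ((norm (vket h w))\<^sup>2) = complex_of_real ((norm h)\<^sup>2)"
    unfolding cinner_self[symmetric] by (simp add: cinner_vket coord_vket)
  hence "(norm (vket h w))\<^sup>2 = (norm h)\<^sup>2"
    by (simp only: of_real_eq_iff)
  thus ?thesis by (simp add: power2_eq_iff_nonneg)
qed

lemma norm_l2_sq: "(norm x)\<^sup>2 = infsum (\<lambda>w. (norm (coord x w))\<^sup>2) UNIV"
  by (simp add: norm_l2_def infsum_nonneg)

lemma norm_l2_restrict_sq: "(norm (l2_restrict W x))\<^sup>2 = infsum (\<lambda>w. (norm (coord x w))\<^sup>2) W"
  unfolding norm_l2_sq by (rule infsum_cong_neutral) (auto simp: l2_restrict.rep_eq)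

lemma coord_sq_summable_on: "(\<lambda>w. (norm (coord x w))\<^sup>2) summable_on W"
  by (rule summable_on_subset_banach[OF coord_sq_summable]) simp

lemma sum_coord_sq_le: "finite F \<Longrightarrow> (\<Sum>w\<in>F. (norm (coord x w))\<^sup>2) \<le> (norm x)\<^sup>2"
  unfolding norm_l2_sq by (rule finite_sum_le_infsum) (auto simp: coord_sq_summable)

lemma norm_l2_le_sq:
  assumes "0 \<le> b" "\<And>F. finite F \<Longrightarrow> (\<Sum>w\<in>F. (norm (coord x w))\<^sup>2) \<le> b\<^sup>2"
  shows "norm x \<le> b"
  by (rule norm_l2_le) (use assms in \<open>auto simp: L2_set_def intro: real_le_lsqrt sum_nonneg\<close>)

lemma l2_tail:
  fixes x :: "('w, 'e::chilbert_space) l2"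
  assumes "0 < e"
  obtains G where "finite G" "norm (l2_restrict (- G) x) < e"
proof -
  let ?f = "\<lambda>w. (norm (coord x w))\<^sup>2"
  have "(sum ?f \<longlongrightarrow> infsum ?f UNIV) (finite_subsets_at_top UNIV)"
    using has_sum_infsum[OF coord_sq_summable[of x]] by (simp add: has_sum_def)
  from tendstoD[OF this, of "e\<^sup>2"] assms obtain G where G: "finite G" "dist (sum ?f G) (infsum ?f UNIV) < e\<^sup>2"
    unfolding eventually_finite_subsets_at_top by auto
  have "infsum ?f (UNIV - G) = infsum ?f UNIV - infsum ?f G"
    by (rule infsum_Diff) (auto simp: coord_sq_summable_on)
  hence "(norm (l2_restrict (- G) x))\<^sup>2 < e\<^sup>2"
    using G by (simp add: norm_l2_restrict_sq Compl_eq_Diff_UNIV dist_real_def)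
  hence "norm (l2_restrict (- G) x) < e"
    using assms by (simp add: power_less_imp_less_base)
  with G that show ?thesis by blast
qed

lemma coord_sum [simp]: "coord (\<Sum>i\<in>I. f i) w = (\<Sum>i\<in>I. coord (f i) w)"
  by (induction I rule: infinite_finite_induct) simp_all

lemma norm_l2_mono:
  assumes "\<And>w. norm (coord x w) \<le> norm (coord y w)"
  shows "norm x \<le> norm y"
  unfolding norm_l2_def
  by (intro real_sqrt_le_mono infsum_mono coord_sq_summable power_mono assms) auto

text \<open>Finitely many fibres of \<open>p\<close> that cover a finite set \<open>G\<close> leave
  an error dominated coordinatewise by the tail of \<open>z\<close> off \<open>G\<close>. With
  \<open>p\<close> the identity this is the expansion in basis tensors, with \<open>fst\<close> it
  evaluates the sum defining the Berezin kernel.\<close>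

lemma l2_restrict_has_sum:
  "((\<lambda>i. l2_restrict (p -` {i}) z) has_sum (z :: ('w, 'e::chilbert_space) l2)) UNIV"
  unfolding has_sum_def
proof (rule tendstoI)
  fix e :: real assume "0 < e"
  then obtain G where G: "finite G" "norm (l2_restrict (- G) z) < e"
    by (rule l2_tail)
  have "dist (\<Sum>i\<in>Y. l2_restrict (p -` {i}) z) z < e" if Y: "finite Y" "p ` G \<subseteq> Y" for Y
  proof -
    have "norm (z - (\<Sum>i\<in>Y. l2_restrict (p -` {i}) z)) \<le> norm (l2_restrict (- G) z)"
    proof (rule norm_l2_mono)
      fix w
      have "(\<Sum>i\<in>Y. coord (l2_restrict (p -` {i}) z) w) = (\<Sum>i\<in>Y. if i = p w then coord z w else 0)"
        by (intro sum.cong) (auto simp: l2_restrict.rep_eq)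
      thus "norm (coord (z - (\<Sum>i\<in>Y. l2_restrict (p -` {i}) z)) w) \<le> norm (coord (l2_restrict (- G) z) w)"
        using Y by (auto simp: l2_restrict.rep_eq)
    qed
    thus ?thesis using G by (simp add: dist_norm norm_minus_commute)
  qed
  thus "\<forall>\<^sub>F Y in finite_subsets_at_top UNIV. dist (\<Sum>i\<in>Y. l2_restrict (p -` {i}) z) z < e"
    unfolding eventually_finite_subsets_at_top using G(1) by (intro exI[of _ "p ` G"]) auto
qed

text \<open>Density of finite sums of basis tensors as an induction rule: closure under sums and
  norm approximation suffices, since scalars are absorbed in the coefficient
  \<open>h\<close>.\<close>

lemma l2_induct [case_names vket add limit]:
  fixes x :: "('w, 'e::chilbert_space) l2"
  assumes vket: "\<And>h w. P (vket h w)"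
    and add: "\<And>x y. P x \<Longrightarrow> P y \<Longrightarrow> P (x + y)"
    and limit: "\<And>x. (\<And>e. 0 < e \<Longrightarrow> \<exists>y. P y \<and> norm (x - y) < e) \<Longrightarrow> P x"
  shows "P x"
proof (rule limit)
  fix e :: real assume "0 < e"
  have fin: "P (\<Sum>w\<in>Y. vket (coord x w) w)" if "finite Y" for Y
    using that
  proof induction
    case empty
    \<comment> \<open>The empty sum is a basis tensor with coefficient 0 at an arbitrary
      index.\<close>
    show ?case using vket[of 0 undefined] by (simp add: vket_linear)
  qed (simp add: vket add)
  have "l2_restrict {w} x = vket (coord x w) w" for w
    by (rule l2_eqI) (simp add: coord_vket l2_restrict.rep_eq)
  hence "((\<lambda>w. vket (coord x w) w) has_sum x) UNIV"
    using l2_restrict_has_sum[of "\<lambda>w. w" x] by (simp add: vimage_def)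
  from tendstoD[OF this[unfolded has_sum_def] \<open>0 < e\<close>]
  obtain X where "finite X" "dist (\<Sum>w\<in>X. vket (coord x w) w) x < e"
    unfolding eventually_finite_subsets_at_top by auto
  thus "\<exists>y. P y \<and> norm (x - y) < e"
    using fin by (metis dist_norm dist_commute)
qed

lemma l2_ext:
  fixes x :: "('w, 'e::chilbert_space) l2"
  assumes f: "bounded_linear f" and g: "bounded_linear g"
    and eq: "\<And>h w. f (vket h w) = g (vket h w)"
  shows "f x = g x"
proof (induction x rule: l2_induct)
  case (vket h w)
  show ?case by (rule eq)
next
  case (add x y)
  thus ?case by (simp add: linear_simps(1)[OF f] linear_simps(1)[OF g])
next
  case (limit x)
  have d: "bounded_linear (\<lambda>x. f x - g x)"
    by (intro bounded_linear_sub f g)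
  obtain K where K: "0 < K" "\<And>x. norm (f x - g x) \<le> norm x * K"
    using bounded_linear.pos_bounded[OF d] by blast
  have "norm (f x - g x) < e" if "0 < e" for e
  proof -
    from that K obtain y where y: "f y = g y" "norm (x - y) < e / K"
      using limit[of "e / K"] by auto
    have "norm (f x - g x) = norm (f (x - y) - g (x - y))"
      using y by (simp add: linear_simps(2)[OF f] linear_simps(2)[OF g])
    also have "\<dots> \<le> norm (x - y) * K" by (rule K)
    also have "\<dots> < e" using y K by (simp add: field_simps)
    finally show ?thesis .
  qed
  hence "norm (f x - g x) = 0"
    by (metis less_irrefl norm_ge_zero order_le_less)
  thus ?case by simp
qed

lemma l2_blinfun_eqI:
  fixes S T :: "('w, 'e::chilbert_space) l2 \<Rightarrow>\<^sub>L 'b::real_normed_vector"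
  assumes "\<And>h w. S (vket h w) = T (vket h w)"
  shows "S = T"
  by (rule blinfun_eqI, rule l2_ext) (use assms in \<open>auto intro: blinfun.bounded_linear_right\<close>)

lemma l2_blinfun_entry_eqI:
  fixes S T :: "('w, 'e::chilbert_space) l2 \<Rightarrow>\<^sub>L ('v, 'f::chilbert_space) l2"
  assumes "\<And>h w v. coord (S (vket h w)) v = coord (T (vket h w)) v"
  shows "S = T"
  by (intro l2_blinfun_eqI l2_eqI assms)

section \<open>Strong limits tested on basis tensors\<close>

lemma norm_add_diff_le: "norm (a + b - c) \<le> norm a + norm b + norm (c :: 'a::real_normed_vector)"
  using norm_triangle_ineq4[of "a + b" c] norm_triangle_ineq[of a b] by linarith

text \<open>Three-epsilon argument: the eventual bound \<open>M\<close> controls what happens on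
  \<open>x - y\<close>, where \<open>y\<close> is a nearby vector on which convergence is already
  known.\<close>

lemma tendsto_from_vkets:
  fixes A :: "('w, 'e::chilbert_space) l2 \<Rightarrow>\<^sub>L 'b::real_normed_vector"
  assumes M: "\<forall>\<^sub>F r in F. norm (T r) \<le> M"
    and vk: "\<And>h w. ((\<lambda>r. blinfun_apply (T r) (vket h w)) \<longlongrightarrow> A (vket h w)) F"
  shows "((\<lambda>r. blinfun_apply (T r) x) \<longlongrightarrow> A x) F"
proof (induction x rule: l2_induct)
  case (add x y)
  thus ?case by (auto simp: blinfun.add_right intro: tendsto_add)
next
  case (limit x)
  show ?case
  proof (rule tendstoI)
    fix e :: real assume e: "0 < e"
    \<comment> \<open>Positive whatever the sign of \<open>M\<close>, and strictly above both
      \<open>norm A\<close> and every norm bounded by \<open>M\<close>.\<close>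
    define K where "K = \<bar>M\<bar> + norm A + 1"
    have K: "0 < K" unfolding K_def by (smt (verit) norm_ge_zero)
    then obtain y where y: "((\<lambda>r. blinfun_apply (T r) y) \<longlongrightarrow> A y) F" "norm (x - y) < e / 3 / K"
      using limit[of "e / 3 / K"] e by auto
    have small: "norm (blinfun_apply B (x - y)) < e / 3" if "norm B < K" for B :: "('w, 'e) l2 \<Rightarrow>\<^sub>L 'b"
    proof -
      have "norm (blinfun_apply B (x - y)) \<le> norm B * norm (x - y)" by (rule norm_blinfun)
      also have "\<dots> \<le> K * norm (x - y)" using that by (intro mult_right_mono) auto
      also have "\<dots> < e / 3" using y K by (simp add: field_simps)
      finally show ?thesis .
    qed
    have "\<forall>\<^sub>F r in F. dist (T r y) (A y) < e / 3"
      using tendstoD[OF y(1), of "e / 3"] e by simp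
    with M show "\<forall>\<^sub>F r in F. dist (T r x) (A x) < e"
    proof eventually_elim
      case (elim r)
      have "norm (T r) < K" "norm A < K"
        using elim(1) norm_ge_zero[of A] unfolding K_def by linarith+
      hence "norm (T r (x - y)) < e / 3" "norm (A (x - y)) < e / 3"
        using small by blast+
      moreover have "T r x - A x = T r (x - y) + (T r y - A y) - A (x - y)"
        by (simp add: blinfun.diff_right)
      ultimately show ?case
        using elim(2) norm_add_diff_le[of "T r (x - y)" "T r y - A y" "A (x - y)"]
        by (simp add: dist_norm)
    qed
  qed
qed (fact vk)

text \<open>The limit is not known in advance, so the induction over vectors transports the Cauchy
  property; completeness of the target produces the limit, and linearity and the bound
  \<open>M\<close> pass to it.\<close>

lemma limit_op_from_vkets:
  fixes T :: "nat \<Rightarrow> ('w, 'e::chilbert_space) l2 \<Rightarrow>\<^sub>L 'b::banach"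
  assumes M: "\<And>p. norm (T p) \<le> M"
    and vk: "\<And>h w. convergent (\<lambda>p. T p (vket h w))"
  obtains A :: "('w, 'e) l2 \<Rightarrow>\<^sub>L 'b" where "\<And>x. (\<lambda>p. T p x) \<longlonglongrightarrow> A x"
proof -
  have "Cauchy (\<lambda>p. T p x)" for x
  proof (induction x rule: l2_induct)
    case (vket h w)
    show ?case by (rule convergent_Cauchy[OF vk])
  next
    case (add x y)
    thus ?case by (auto simp: blinfun.add_right Cauchy_convergent_iff intro: convergent_add)
  next
    case (limit x)
    show ?case
    proof (rule CauchyI)
      fix e :: real assume e: "0 < e"
      define K where "K = \<bar>M\<bar> + 1"
      have K: "0 < K" unfolding K_def by simp
      then obtain y where y: "Cauchy (\<lambda>p. T p y)" "norm (x - y) < e / 3 / K"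
        using limit[of "e / 3 / K"] e by auto
      have small: "norm (T p (x - y)) < e / 3" for p
      proof -
        have "norm (T p (x - y)) \<le> norm (T p) * norm (x - y)" by (rule norm_blinfun)
        also have "\<dots> \<le> K * norm (x - y)" using M[of p] by (intro mult_right_mono) (auto simp: K_def)
        also have "\<dots> < e / 3" using y K by (simp add: field_simps)
        finally show ?thesis .
      qed
      obtain N where N: "\<And>p q. p \<ge> N \<Longrightarrow> q \<ge> N \<Longrightarrow> norm (T p y - T q y) < e / 3"
        using CauchyD[OF y(1), of "e / 3"] e by auto
      have "norm (T p x - T q x) < e" if "p \<ge> N" "q \<ge> N" for p q
      proof -
        have "T p x - T q x = T p (x - y) + (T p y - T q y) - T q (x - y)"
          by (simp add: blinfun.diff_right)
        thus ?thesis using N[OF that] small[of p] small[of q]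
            norm_add_diff_le[of "T p (x - y)" "T p y - T q y" "T q (x - y)"] by simp
      qed
      thus "\<exists>N. \<forall>p\<ge>N. \<forall>q\<ge>N. norm (T p x - T q x) < e" by blast
    qed
  qed
  hence lim: "(\<lambda>p. T p x) \<longlonglongrightarrow> lim (\<lambda>p. T p x)" for x
    using Cauchy_convergent convergent_LIMSEQ_iff by blast
  have bl: "bounded_linear (\<lambda>x. lim (\<lambda>p. T p x))"
  proof (rule bounded_linear_intro[where K = M])
    fix x y r
    show "lim (\<lambda>p. T p (x + y)) = lim (\<lambda>p. T p x) + lim (\<lambda>p. T p y)"
      by (rule limI) (simp add: blinfun.add_right tendsto_add lim)
    show "lim (\<lambda>p. T p (r *\<^sub>R x)) = r *\<^sub>R lim (\<lambda>p. T p x)"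
      by (rule limI) (simp add: blinfun.scaleR_right tendsto_scaleR lim)
    show "norm (lim (\<lambda>p. T p x)) \<le> norm x * M"
    proof (rule Lim_norm_ubound[OF _ lim])
      have "norm (T p x) \<le> norm x * M" for p
        using norm_blinfun[of "T p" x] M[of p] by (smt (verit) mult.commute mult_right_mono norm_ge_zero)
      thus "\<forall>\<^sub>F p in sequentially. norm (T p x) \<le> norm x * M" by simp
    qed simp
  qed
  from that[of "Blinfun (\<lambda>x. lim (\<lambda>p. T p x))"] lim show ?thesis
    by (simp add: bounded_linear_Blinfun_apply[OF bl])
qed

text \<open>Discrete dominated convergence: on finitely many coordinates the multipliers tend to 1,
  and elsewhere the error is at most twice the tail of \<open>y\<close>, because
  \<open>\<bar>c r w - 1\<bar> \<le> 2\<close>.\<close>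

lemma tendsto_l2_multiplier:
  fixes y :: "('w, 'e::chilbert_space) l2"
  assumes co: "\<forall>\<^sub>F r in F. \<forall>w. \<bar>c r w\<bar> \<le> 1 \<and> coord (u r) w = c r w *\<^sub>R coord y w"
    and lim: "\<And>w. ((\<lambda>r. c r w) \<longlongrightarrow> (1::real)) F"
  shows "(u \<longlongrightarrow> y) F"
proof (rule tendstoI)
  fix e :: real assume e: "0 < e"
  \<comment> \<open>A quarter, since the tail enters with the factor 2 and shares \<open>e\<close>
    with the finite part.\<close>
  hence "0 < e / 4" by simp
  then obtain G where G: "finite G" "norm (l2_restrict (- G) y) < e / 4"
    by (rule l2_tail)
  have "((\<lambda>r. \<Sum>w\<in>G. \<bar>c r w - 1\<bar> * norm (coord y w)) \<longlongrightarrow> (\<Sum>w\<in>G. \<bar>1 - 1\<bar> * norm (coord y w))) F"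
    by (intro tendsto_intros lim)
  hence "\<forall>\<^sub>F r in F. (\<Sum>w\<in>G. \<bar>c r w - 1\<bar> * norm (coord y w)) < e / 2"
    using e by (auto dest: order_tendstoD(2)[where a = "e / 2"])
  with co show "\<forall>\<^sub>F r in F. dist (u r) y < e"
  proof eventually_elim
    case (elim r)
    \<comment> \<open>The error on the coordinates in \<open>G\<close>; the remaining error lives
      off \<open>G\<close>.\<close>
    let ?z = "\<Sum>w\<in>G. vket ((c r w - 1) *\<^sub>R coord y w) w"
    have "norm ?z \<le> (\<Sum>w\<in>G. \<bar>c r w - 1\<bar> * norm (coord y w))"
      by (rule sum_norm_le) (simp add: norm_vket)
    moreover have "norm (u r - y - ?z) \<le> norm (2 *\<^sub>R l2_restrict (- G) y)"
    proof (rule norm_l2_mono)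
      fix w
      have "(\<Sum>v\<in>G. coord (vket ((c r v - 1) *\<^sub>R coord y v) v) w) =
          (\<Sum>v\<in>G. if v = w then (c r w - 1) *\<^sub>R coord y w else 0)"
        by (intro sum.cong) (auto simp: coord_vket)
      hence s: "(\<Sum>v\<in>G. coord (vket ((c r v - 1) *\<^sub>R coord y v) v) w) =
          (if w \<in> G then (c r w - 1) *\<^sub>R coord y w else 0)"
        using G(1) by simp
      have "norm (c r w *\<^sub>R coord y w - coord y w) = \<bar>c r w - 1\<bar> * norm (coord y w)"
        by (simp add: scaleR_left_diff_distrib flip: norm_scaleR)
      also have "\<dots> \<le> 2 * norm (coord y w)"
        using elim(1) by (intro mult_right_mono) (smt (verit), simp)
      finally have "norm (c r w *\<^sub>R coord y w - coord y w) \<le> 2 * norm (coord y w)" .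
      thus "norm (coord (u r - y - ?z) w) \<le> norm (coord (2 *\<^sub>R l2_restrict (- G) y) w)"
        using elim(1) s by (auto simp: l2_restrict.rep_eq scaleR_left_diff_distrib)
    qed
    moreover have "norm (u r - y) \<le> norm ?z + norm (u r - y - ?z)"
      using norm_triangle_ineq[of ?z "u r - y - ?z"] by simp
    ultimately show ?case using elim G(2) by (simp add: dist_norm)
  qed
qed

text \<open>An operator from prescribed coordinates: the bound on finite square sums shows both that
  the coordinates form a vector and that the resulting map has norm at most
  \<open>K\<close>.\<close>

lemma l2_op_ex:
  fixes F :: "('w, 'e::chilbert_space) l2 \<Rightarrow> 'v \<Rightarrow> 'f::chilbert_space"
  assumes add: "\<And>x y v. F (x + y) v = F x v + F y v"
    and scale: "\<And>r x v. F (r *\<^sub>R x) v = r *\<^sub>R F x v"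
    and K: "0 \<le> K" and bound: "\<And>x G. finite G \<Longrightarrow> (\<Sum>v\<in>G. (norm (F x v))\<^sup>2) \<le> (K * norm x)\<^sup>2"
  shows "\<exists>T :: ('w, 'e) l2 \<Rightarrow>\<^sub>L ('v, 'f) l2. (\<forall>x v. coord (blinfun_apply T x) v = F x v) \<and> norm T \<le> K"
proof -
  have "(\<lambda>v. (norm (F x v))\<^sup>2) summable_on UNIV" for x
    by (rule nonneg_bdd_above_summable_on) (auto intro!: bdd_aboveI2 bound)
  hence co: "coord (Abs_l2 (F x)) = F x" for x
    by (simp add: Abs_l2_inverse)
  have nm: "norm (Abs_l2 (F x)) \<le> K * norm x" for x
    by (rule norm_l2_le_sq) (use K bound in \<open>auto simp: co\<close>)
  have bl: "bounded_linear (\<lambda>x. Abs_l2 (F x))"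
    by (rule bounded_linear_intro[where K = K])
      (use nm in \<open>auto intro!: l2_eqI simp: co add scale mult.commute\<close>)
  show ?thesis
    by (rule exI[of _ "Blinfun (\<lambda>x. Abs_l2 (F x))"])
      (auto simp: bounded_linear_Blinfun_apply[OF bl] co intro!: norm_blinfun_bound K nm)
qed

text \<open>Coordinates determine the operator, so existence makes the description meaningful and
  hands its norm bound on.\<close>

lemma the_l2_op:
  fixes F :: "('w, 'e::chilbert_space) l2 \<Rightarrow> 'v \<Rightarrow> 'f::chilbert_space"
  assumes "\<exists>T :: ('w, 'e) l2 \<Rightarrow>\<^sub>L ('v, 'f) l2. (\<forall>x v. coord (blinfun_apply T x) v = F x v) \<and> norm T \<le> K"
  defines "T \<equiv> (THE T :: ('w, 'e) l2 \<Rightarrow>\<^sub>L ('v, 'f) l2. \<forall>x v. coord (blinfun_apply T x) v = F x v)"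
  shows "coord (blinfun_apply T x) v = F x v" "norm T \<le> K"
proof -
  obtain S :: "('w, 'e) l2 \<Rightarrow>\<^sub>L ('v, 'f) l2" where S: "\<forall>x v. coord (blinfun_apply S x) v = F x v" "norm S \<le> K"
    using assms(1) by blast
  have "T = S"
    unfolding T_def by (rule the_equality) (use S(1) in \<open>auto intro!: blinfun_eqI l2_eqI\<close>)
  thus "coord (blinfun_apply T x) v = F x v" "norm T \<le> K" using S by auto
qed

section \<open>Weighted composition operators\<close>

text \<open>The shifts, their adjoints, the diagonal operators and the Berezin kernel are all of the form
  \<open>wpull p c\<close> or of the adjoint form \<open>wpush p c\<close>, for weights \<open>c\<close> that are square summable to at most 1
  on every fibre of \<open>p\<close>.\<close>

definition wmap :: "('v \<Rightarrow> 'w) \<Rightarrow> ('v \<Rightarrow> real) \<Rightarrow> bool" where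
  "wmap p c \<longleftrightarrow> (\<forall>w. finite {v. p v = w \<and> c v \<noteq> 0} \<and> (\<Sum>v | p v = w \<and> c v \<noteq> 0. (c v)\<^sup>2) \<le> 1)"

definition wpull :: "('v \<Rightarrow> 'w) \<Rightarrow> ('v \<Rightarrow> real) \<Rightarrow> ('w, 'e::chilbert_space) l2 \<Rightarrow>\<^sub>L ('v, 'e) l2" where
  "wpull p c = (THE T. \<forall>x v. coord (blinfun_apply T x) v = c v *\<^sub>R coord x (p v))"

definition wpush :: "('v \<Rightarrow> 'w) \<Rightarrow> ('v \<Rightarrow> real) \<Rightarrow> ('v, 'e::chilbert_space) l2 \<Rightarrow>\<^sub>L ('w, 'e) l2" where
  "wpush p c = (THE T. \<forall>x w. coord (blinfun_apply T x) w = (\<Sum>v | p v = w \<and> c v \<noteq> 0. c v *\<^sub>R coord x v))"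

lemma wmap_inj:
  assumes "\<And>u v. c u \<noteq> 0 \<Longrightarrow> c v \<noteq> 0 \<Longrightarrow> p u = p v \<Longrightarrow> u = v" "\<And>v. \<bar>c v\<bar> \<le> 1"
  shows "wmap p c"
  unfolding wmap_def
proof
  fix w
  show "finite {v. p v = w \<and> c v \<noteq> 0} \<and> (\<Sum>v | p v = w \<and> c v \<noteq> 0. (c v)\<^sup>2) \<le> 1"
  proof (cases "\<exists>u. p u = w \<and> c u \<noteq> 0")
    case True
    then obtain u where u: "p u = w" "c u \<noteq> 0" by blast
    hence "{v. p v = w \<and> c v \<noteq> 0} = {u}" using assms(1) by blast
    thus ?thesis using assms(2)[of u] by (simp add: abs_square_le_1)
  next
    case False
    hence "{v. p v = w \<and> c v \<noteq> 0} = {}" by blast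
    thus ?thesis by (simp only: sum.empty finite.emptyI) simp
  qed
qed

text \<open>After grouping by fibres, each coordinate of \<open>x\<close> is counted with the total
  squared weight of its fibre, which is at most 1.\<close>

lemma wpull_ex:
  fixes p :: "'v \<Rightarrow> 'w"
  assumes "wmap p c"
  shows "\<exists>T :: ('w, 'e::chilbert_space) l2 \<Rightarrow>\<^sub>L ('v, 'e) l2.
    (\<forall>x v. coord (blinfun_apply T x) v = c v *\<^sub>R coord x (p v)) \<and> norm T \<le> 1"
proof (rule l2_op_ex)
  fix x :: "('w, 'e) l2" and G :: "'v set" assume G: "finite G"
  have "(\<Sum>v\<in>G. (norm (c v *\<^sub>R coord x (p v)))\<^sup>2) =
      (\<Sum>w\<in>p ` G. \<Sum>v\<in>{v\<in>G. p v = w}. (norm (c v *\<^sub>R coord x (p v)))\<^sup>2)"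
    by (rule sum.image_gen[OF G])
  also have "\<dots> = (\<Sum>w\<in>p ` G. (\<Sum>v\<in>{v\<in>G. p v = w}. (c v)\<^sup>2) * (norm (coord x w))\<^sup>2)"
    by (auto simp: power_mult_distrib sum_distrib_right intro!: sum.cong)
  also have "\<dots> \<le> (\<Sum>w\<in>p ` G. 1 * (norm (coord x w))\<^sup>2)"
  proof (intro sum_mono mult_right_mono)
    fix w
    have "(\<Sum>v\<in>{v\<in>G. p v = w}. (c v)\<^sup>2) = (\<Sum>v\<in>{v\<in>G. p v = w \<and> c v \<noteq> 0}. (c v)\<^sup>2)"
      using G by (intro sum.mono_neutral_right) auto
    also have "\<dots> \<le> (\<Sum>v | p v = w \<and> c v \<noteq> 0. (c v)\<^sup>2)"
      using assms by (intro sum_mono2) (auto simp: wmap_def)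
    also have "\<dots> \<le> 1" using assms by (simp add: wmap_def)
    finally show "(\<Sum>v\<in>{v\<in>G. p v = w}. (c v)\<^sup>2) \<le> 1" .
  qed simp
  also have "\<dots> \<le> (1 * norm x)\<^sup>2"
    using sum_coord_sq_le[of "p ` G" x] G by simp
  finally show "(\<Sum>v\<in>G. (norm (c v *\<^sub>R coord x (p v)))\<^sup>2) \<le> (1 * norm x)\<^sup>2" .
qed (simp_all add: scaleR_add_right)

text \<open>Cauchy-Schwarz on each fibre, where the weights have norm at most 1; distinct fibres use
  disjoint coordinates of \<open>x\<close>.\<close>

lemma wpush_ex:
  fixes p :: "'v \<Rightarrow> 'w"
  assumes "wmap p c"
  shows "\<exists>T :: ('v, 'e::chilbert_space) l2 \<Rightarrow>\<^sub>L ('w, 'e) l2.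
    (\<forall>x w. coord (blinfun_apply T x) w = (\<Sum>v | p v = w \<and> c v \<noteq> 0. c v *\<^sub>R coord x v)) \<and> norm T \<le> 1"
proof (rule l2_op_ex)
  fix x :: "('v, 'e) l2" and G :: "'w set" assume G: "finite G"
  let ?B = "\<lambda>w. {v. p v = w \<and> c v \<noteq> 0}"
  have fin: "finite (?B w)" "(\<Sum>v\<in>?B w. (c v)\<^sup>2) \<le> 1" for w
    using assms unfolding wmap_def by auto
  have "(norm (\<Sum>v\<in>?B w. c v *\<^sub>R coord x v))\<^sup>2 \<le> (\<Sum>v\<in>?B w. (norm (coord x v))\<^sup>2)" for w
  proof -
    have "norm (\<Sum>v\<in>?B w. c v *\<^sub>R coord x v) \<le> (\<Sum>v\<in>?B w. \<bar>c v\<bar> * \<bar>norm (coord x v)\<bar>)"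
      by (rule sum_norm_le) simp
    also have "\<dots> \<le> L2_set c (?B w) * L2_set (\<lambda>v. norm (coord x v)) (?B w)"
      by (rule L2_set_mult_ineq)
    also have "\<dots> \<le> 1 * L2_set (\<lambda>v. norm (coord x v)) (?B w)"
      using fin(2)[of w] by (intro mult_right_mono) (auto simp: L2_set_def sum_nonneg)
    finally have "norm (\<Sum>v\<in>?B w. c v *\<^sub>R coord x v) \<le> L2_set (\<lambda>v. norm (coord x v)) (?B w)"
      by simp
    from power_mono[OF this norm_ge_zero, of 2] show ?thesis
      by (simp add: L2_set_def sum_nonneg)
  qed
  hence "(\<Sum>w\<in>G. (norm (\<Sum>v\<in>?B w. c v *\<^sub>R coord x v))\<^sup>2) \<le> (\<Sum>w\<in>G. \<Sum>v\<in>?B w. (norm (coord x v))\<^sup>2)"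
    by (rule sum_mono)
  also have "\<dots> = (\<Sum>v\<in>(\<Union>w\<in>G. ?B w). (norm (coord x v))\<^sup>2)"
    using fin(1) G by (subst sum.UNION_disjoint) auto
  also have "\<dots> \<le> (1 * norm x)\<^sup>2"
    using sum_coord_sq_le[of "\<Union>w\<in>G. ?B w" x] fin(1) G by simp
  finally show "(\<Sum>w\<in>G. (norm (\<Sum>v\<in>?B w. c v *\<^sub>R coord x v))\<^sup>2) \<le> (1 * norm x)\<^sup>2" .
qed (simp_all add: scaleR_add_right sum.distrib scaleR_sum_right mult.commute)

lemma coord_wpull: "wmap p c \<Longrightarrow> coord (wpull p c x) v = c v *\<^sub>R coord x (p v)"
  unfolding wpull_def by (rule the_l2_op(1)[OF wpull_ex])

lemma norm_wpull: "wmap p c \<Longrightarrow> norm (wpull p c) \<le> 1"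
  unfolding wpull_def by (rule the_l2_op(2)[OF wpull_ex])

lemma coord_wpush: "wmap p c \<Longrightarrow>
    coord (wpush p c x) w = (\<Sum>v | p v = w \<and> c v \<noteq> 0. c v *\<^sub>R coord x v)"
  unfolding wpush_def by (rule the_l2_op(1)[OF wpush_ex])

lemma norm_wpush: "wmap p c \<Longrightarrow> norm (wpush p c) \<le> 1"
  unfolding wpush_def by (rule the_l2_op(2)[OF wpush_ex])

lemma wpush_vket:
  assumes "wmap p c"
  shows "wpush p c (vket h v) = vket (c v *\<^sub>R h) (p v)"
proof (rule l2_eqI)
  fix w
  have "(\<Sum>u | p u = w \<and> c u \<noteq> 0. c u *\<^sub>R coord (vket h v) u) =
      (\<Sum>u | p u = w \<and> c u \<noteq> 0. if u = v then c v *\<^sub>R h else 0)"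
    by (intro sum.cong) (auto simp: coord_vket)
  also have "\<dots> = (if p v = w \<and> c v \<noteq> 0 then c v *\<^sub>R h else 0)"
    using assms by (simp add: wmap_def sum.delta)
  finally show "coord (wpush p c (vket h v)) w = coord (vket (c v *\<^sub>R h) (p v)) w"
    by (auto simp: coord_wpush[OF assms] coord_vket)
qed

lemma wpush_ket: "wmap p c \<Longrightarrow> wpush p c (ket v) = vket (of_real (c v)) (p v)"
  using wpush_vket[of p c "1 :: complex" v] by (simp add: of_real_def)

lemma scaleC_scaleR: "c *\<^sub>C r *\<^sub>R (x :: 'a::chilbert_space) = r *\<^sub>R c *\<^sub>C x"
  by (simp only: scaleC_of_real[symmetric] scaleC_scaleC mult.commute)

lemma scaleR_complex_scaleC: "(r *\<^sub>R z) *\<^sub>C (x :: 'a::chilbert_space) = r *\<^sub>R z *\<^sub>C x"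
  by (simp only: scaleR_conv_of_real scaleC_of_real[symmetric] scaleC_scaleC)

lemma scaleC_sum_right: "c *\<^sub>C (\<Sum>i\<in>I. f i) = (\<Sum>i\<in>I. c *\<^sub>C (f i :: 'a::chilbert_space))"
  by (induction I rule: infinite_finite_induct) (simp_all add: scaleC_add_right)

lemma scaleC_sum_left: "(\<Sum>i\<in>I. f i) *\<^sub>C (x :: 'a::chilbert_space) = (\<Sum>i\<in>I. f i *\<^sub>C x)"
  by (induction I rule: infinite_finite_induct) (simp_all add: scaleC_add_left)

section \<open>Complex linearity and adjoints\<close>

text \<open>Elements of \<open>\<Rightarrow>\<^sub>L\<close> are only real linear, so complex
  linearity is carried as membership in \<open>bop UNIV UNIV\<close>. A vector orthogonal to
  everything is 0, so the orthogonality clause becomes \<open>T 0 = 0\<close>.\<close>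

lemma in_bop_UNIV: "T \<in> bop UNIV UNIV \<longleftrightarrow> (\<forall>c x. blinfun_apply T (c *\<^sub>C x) = c *\<^sub>C T x)"
proof -
  have "T x = 0" if "\<forall>v. cinner x v = 0" for x
    using cinner_eqI[of x 0] that by (simp add: blinfun.zero_right)
  thus ?thesis by (simp add: bop_def)
qed

lemma bop_UNIV_scaleC: "T \<in> bop UNIV UNIV \<Longrightarrow> blinfun_apply T (c *\<^sub>C x) = c *\<^sub>C T x"
  by (simp add: in_bop_UNIV)

lemma bop_UNIV_compose:
  "S \<in> bop UNIV UNIV \<Longrightarrow> T \<in> bop UNIV UNIV \<Longrightarrow> S o\<^sub>L T \<in> bop UNIV UNIV"
  by (simp add: in_bop_UNIV)

lemma bop_UNIV_from_vkets:
  fixes T :: "('w, 'e::chilbert_space) l2 \<Rightarrow>\<^sub>L 'b::chilbert_space"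
  assumes "\<And>c h w. T (vket (c *\<^sub>C h) w) = c *\<^sub>C T (vket h w)"
  shows "T \<in> bop UNIV UNIV"
  unfolding in_bop_UNIV
proof (intro allI)
  fix c x
  show "T (c *\<^sub>C x) = c *\<^sub>C T x"
    by (rule l2_ext[where f = "\<lambda>x. T (c *\<^sub>C x)" and g = "\<lambda>x. c *\<^sub>C T x"])
      (auto intro: bounded_linear_compose[OF _ bounded_linear_scaleC]
        bounded_linear_compose[OF bounded_linear_scaleC] blinfun.bounded_linear_right
        simp: assms vket_linear(3)[symmetric])
qed

lemma wpull_bop: "wmap p c \<Longrightarrow> wpull p c \<in> bop UNIV UNIV"
  by (auto simp: in_bop_UNIV coord_wpull scaleC_scaleR intro!: l2_eqI)

lemma wpush_bop: "wmap p c \<Longrightarrow> wpush p c \<in> bop UNIV UNIV"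
  by (auto simp: in_bop_UNIV coord_wpush scaleC_scaleR scaleC_sum_right intro!: l2_eqI)

text \<open>Vanishing on the orthogonal complement can be tested on basis tensors: a vector
  orthogonal to \<open>l2_on V\<close> is fixed by the projection onto the coordinates off
  \<open>V\<close>, and \<open>T\<close> composed with that projection kills every basis
  tensor.\<close>

lemma in_bop_l2_on:
  fixes T :: "('v, 'e::chilbert_space) l2 \<Rightarrow>\<^sub>L ('w, 'f::chilbert_space) l2"
  shows "T \<in> bop (l2_on V) (l2_on W) \<longleftrightarrow> T \<in> bop UNIV UNIV \<and>
    (\<forall>x w. w \<notin> W \<longrightarrow> coord (blinfun_apply T x) w = 0) \<and> (\<forall>h v. v \<notin> V \<longrightarrow> T (vket h v) = 0)" (is "?L \<longleftrightarrow> ?R")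
proof
  assume L: ?L
  have "T (vket h v) = 0" if "v \<notin> V" for h v
  proof -
    have "cinner (vket h v) y = 0" if "y \<in> l2_on V" for y
      using that \<open>v \<notin> V\<close> cinner_vket[of y h v] cinner_commute[of y "vket h v"]
      by (simp add: l2_on_def)
    thus ?thesis using L by (simp add: bop_def)
  qed
  thus ?R using L unfolding in_bop_UNIV by (auto simp: bop_def l2_on_def)
next
  assume R: ?R
  have "T x = 0" if x: "\<forall>y\<in>l2_on V. cinner x y = 0" for x
  proof -
    have x0: "coord x v = 0" if "v \<in> V" for v
    proof -
      have "vket (coord x v) v \<in> l2_on V"
        using that by (auto simp: l2_on_def coord_vket)
      hence "cinner (coord x v) (coord x v) = 0"
        using x by (simp flip: cinner_vket)
      thus ?thesis by (simp add: cinner_self)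
    qed
    hence "id_on (- V) x = x"
      by (intro l2_eqI) (simp add: id_on.rep_eq l2_restrict.rep_eq)
    moreover have "T o\<^sub>L id_on (- V) = 0"
    proof (rule l2_blinfun_eqI)
      fix h :: 'e and v
      have "id_on (- V) (vket h v) = (if v \<in> V then 0 else vket h v)"
        by (rule l2_eqI) (simp add: id_on.rep_eq l2_restrict.rep_eq coord_vket)
      thus "blinfun_apply (T o\<^sub>L id_on (- V)) (vket h v) = blinfun_apply 0 (vket h v)"
        using R by (simp add: blinfun.zero_right)
    qed
    ultimately show ?thesis
      by (metis blinfun_apply_blinfun_compose blinfun.zero_left)
  qed
  thus ?L using R unfolding in_bop_UNIV by (auto simp: bop_def l2_on_def)
qed

text \<open>Two candidates agree against every vector, so an adjoint is found by exhibiting any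
  operator that satisfies the defining identity.\<close>

lemma adj_eqI:
  assumes "\<And>x y. cinner (blinfun_apply T x) y = cinner x (blinfun_apply T' y)"
  shows "adj T = T'"
  unfolding adj_def
proof (rule the_equality)
  fix S assume S: "\<forall>x y. cinner (blinfun_apply T x) y = cinner x (blinfun_apply S y)"
  show "S = T'"
    by (rule blinfun_eqI, rule cinner_eqI_right) (simp only: S[rule_format, symmetric] assms[symmetric])
qed (simp add: assms)

lemma cinner_vket_left: "cinner (vket h v) y = cinner h (coord y v)"
  using cinner_vket[of y h v] cinner_commute[of "vket h v" y] cinner_commute[of h "coord y v"] by simp

text \<open>Both sides are bounded linear in \<open>x\<close>, so it is enough to test basis
  tensors, which \<open>wpush\<close> sends to basis tensors.\<close>

lemma cinner_wpush:
  assumes "wmap p c"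
  shows "cinner (wpush p c x) y = cinner x (wpull p c y)"
  by (rule l2_ext[where f = "\<lambda>x. cinner (wpush p c x) y" and g = "\<lambda>x. cinner x (wpull p c y)"])
    (auto intro: bounded_linear_compose[OF bounded_linear_cinner_left] bounded_linear_cinner_left
        blinfun.bounded_linear_right
      simp: assms wpush_vket cinner_vket_left coord_wpull cinner_scaleR_left cinner_scaleR_right)

lemma adj_wpush: "wmap p c \<Longrightarrow> adj (wpush p c) = wpull p c"
  by (rule adj_eqI) (rule cinner_wpush)

lemma adj_wpull: "wmap p c \<Longrightarrow> adj (wpull p c) = wpush p c"
  by (rule adj_eqI) (metis cinner_wpush cinner_commute)

lemma wmap_ind: "wmap (\<lambda>w. w) (\<lambda>w. of_bool (w \<in> W))"
  by (rule wmap_inj) auto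

lemma id_on_wpull: "id_on W = wpull (\<lambda>w. w) (\<lambda>w. of_bool (w \<in> W))"
  by (rule blinfun_eqI, rule l2_eqI) (simp add: coord_wpull wmap_ind id_on.rep_eq l2_restrict.rep_eq)

lemma coord_id_on: "coord (id_on W x) w = (if w \<in> W then coord x w else 0)"
  by (simp add: id_on.rep_eq l2_restrict.rep_eq)

lemma id_on_vket: "id_on W (vket h w) = (if w \<in> W then vket h w else 0)"
  by (rule l2_eqI) (simp add: coord_id_on coord_vket)

lemma id_on_wpush: "id_on W = wpush (\<lambda>w. w) (\<lambda>w. of_bool (w \<in> W))"
  by (rule l2_blinfun_eqI) (simp add: wpush_vket wmap_ind id_on_vket vket_linear)

section \<open>Tensor products of operators; \<open>vmap A\<close> is A \<otimes> I\<close>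

definition vmap :: "'e::chilbert_space op \<Rightarrow> ('w, 'e) l2 op" where
  "vmap A = (THE T. \<forall>x w. coord (blinfun_apply T x) w = A (coord x w))"

lemma vmap_ex: "\<exists>T :: ('w, 'e::chilbert_space) l2 op. (\<forall>x w. coord (blinfun_apply T x) w = blinfun_apply A (coord x w)) \<and> norm T \<le> norm A"
proof (rule l2_op_ex)
  fix x :: "('w, 'e) l2" and G :: "'w set" assume G: "finite G"
  have "(\<Sum>v\<in>G. (norm (A (coord x v)))\<^sup>2) \<le> (\<Sum>v\<in>G. (norm A)\<^sup>2 * (norm (coord x v))\<^sup>2)"
    by (intro sum_mono) (metis norm_blinfun norm_ge_zero power_mono power_mult_distrib)
  also have "\<dots> \<le> (norm A)\<^sup>2 * (norm x)\<^sup>2"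
    unfolding sum_distrib_left[symmetric] by (intro mult_left_mono sum_coord_sq_le G) simp
  finally show "(\<Sum>v\<in>G. (norm (A (coord x v)))\<^sup>2) \<le> (norm A * norm x)\<^sup>2"
    by (simp add: power_mult_distrib)
qed (simp_all add: blinfun.add_right blinfun.scaleR_right)

lemma coord_vmap: "coord (vmap A x) w = A (coord x w)"
  unfolding vmap_def by (rule the_l2_op(1)[OF vmap_ex])

text \<open>Says that \<open>T'\<close> is I \<otimes> T. It is a relation because a weighted
  composition operator is given by the same formula over every coefficient space, so its ampliation
  is the same term at another type.\<close>

definition id_tensor :: "(('v, complex) l2 \<Rightarrow>\<^sub>L ('w, complex) l2) \<Rightarrow> (('v, 'e::chilbert_space) l2 \<Rightarrow>\<^sub>L ('w, 'e) l2) \<Rightarrow> bool" where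
  "id_tensor T T' \<longleftrightarrow> T' \<in> bop UNIV UNIV \<and> (\<forall>h x. blinfun_apply T' (vtensor h x) = vtensor h (blinfun_apply T x))"

text \<open>Uniqueness holds because the elementary tensors include the basis tensors.\<close>

lemma op_vtensor_id_tensor:
  assumes A: "A \<in> bop UNIV UNIV" and T: "id_tensor T T'"
  shows "op_vtensor A T = vmap A o\<^sub>L T'"
  unfolding op_vtensor_def
proof (rule the_equality)
  show P: "vmap A o\<^sub>L T' \<in> bop UNIV UNIV \<and> (\<forall>h x. blinfun_apply (vmap A o\<^sub>L T') (vtensor h x) = vtensor (A h) (T x))"
    using T A
    by (auto simp: id_tensor_def in_bop_UNIV coord_vmap vtensor.rep_eq intro!: l2_eqI)
  fix C assume "C \<in> bop UNIV UNIV \<and> (\<forall>h x. blinfun_apply C (vtensor h x) = vtensor (A h) (T x))"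
  thus "C = vmap A o\<^sub>L T'"
    using P by (intro l2_blinfun_eqI) (simp del: blinfun_apply_blinfun_compose)
qed

lemma op_vtensor_id: "id_tensor T T' \<Longrightarrow> op_vtensor id_blinfun T = T'"
  by (subst op_vtensor_id_tensor[of _ T T'])
    (auto simp: in_bop_UNIV coord_vmap intro!: blinfun_eqI l2_eqI)

lemma id_tensor_compose: "id_tensor S S' \<Longrightarrow> id_tensor T T' \<Longrightarrow> id_tensor (S o\<^sub>L T) (S' o\<^sub>L T')"
  by (simp add: id_tensor_def bop_UNIV_compose)

lemma id_tensor_wpull: "wmap p c \<Longrightarrow> id_tensor (wpull p c) (wpull p c)"
  by (auto simp: id_tensor_def wpull_bop coord_wpull vtensor.rep_eq scaleR_complex_scaleC intro!: l2_eqI)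

lemma id_tensor_wpush: "wmap p c \<Longrightarrow> id_tensor (wpush p c) (wpush p c)"
  by (auto simp: id_tensor_def wpush_bop coord_wpush vtensor.rep_eq scaleR_complex_scaleC scaleC_sum_left
      intro!: l2_eqI)

section \<open>Orthogonal blocks and slices\<close>

lemma sum_norm_restrict_le:
  assumes "finite F" "disjoint_family_on D F"
  shows "(\<Sum>i\<in>F. (norm (l2_restrict (D i) x))\<^sup>2) \<le> (norm x)\<^sup>2"
proof -
  have "(\<Sum>i\<in>F. (norm (l2_restrict (D i) x))\<^sup>2) = (norm (l2_restrict (\<Union>i\<in>F. D i) x))\<^sup>2"
    using assms
  proof (induction F)
    case empty
    have "l2_restrict {} x = 0" by (rule l2_eqI) (simp add: l2_restrict.rep_eq)
    thus ?case by simp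
  next
    case (insert i F)
    have "D i \<inter> (\<Union>i\<in>F. D i) = {}"
      using insert.hyps insert.prems by (auto simp: disjoint_family_on_def)
    moreover have "disjoint_family_on D F"
      using insert.prems by (rule disjoint_family_on_mono[rotated]) auto
    ultimately show ?case
      using insert by (simp add: norm_l2_restrict_sq infsum_Un_disjoint coord_sq_summable_on)
  qed
  also have "norm (l2_restrict (\<Union>i\<in>F. D i) x) \<le> norm x"
    by (rule norm_l2_mono) (simp add: l2_restrict.rep_eq)
  hence "(norm (l2_restrict (\<Union>i\<in>F. D i) x))\<^sup>2 \<le> (norm x)\<^sup>2"
    by (intro power_mono) auto
  finally show ?thesis .
qed

text \<open>Contraction of the second tensor factor against the basis vector
  \<open>ket w\<close>.\<close>

definition slice :: "'w \<Rightarrow> ('v \<times> 'w, 'e::chilbert_space) l2 \<Rightarrow>\<^sub>L ('v, 'e) l2" where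
  "slice w = wpull (\<lambda>v. (v, w)) (\<lambda>_. 1)"

lemma wmap_slice: "wmap (\<lambda>v. (v, w)) (\<lambda>_. 1)"
  by (rule wmap_inj) auto

lemma coord_slice: "coord (slice w x) v = coord x (v, w)"
  by (simp add: slice_def coord_wpull wmap_slice)

lemma sum_norm_slice_le:
  fixes x :: "('v \<times> 'w, 'e::chilbert_space) l2"
  assumes "finite F"
  shows "(\<Sum>w\<in>F. (norm (slice w x))\<^sup>2) \<le> (norm x)\<^sup>2"
proof -
  have "norm (slice w x) \<le> norm (l2_restrict (snd -` {w}) x)" for w
  proof -
    have "slice w x = slice w (l2_restrict (snd -` {w}) x)"
      by (rule l2_eqI) (simp add: coord_slice l2_restrict.rep_eq)
    also have "norm \<dots> \<le> norm (slice w :: ('v \<times> 'w, 'e) l2 \<Rightarrow>\<^sub>L ('v, 'e) l2) * norm (l2_restrict (snd -` {w}) x)"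
      by (rule norm_blinfun)
    also have "\<dots> \<le> 1 * norm (l2_restrict (snd -` {w}) x)"
      unfolding slice_def by (intro mult_right_mono norm_wpull wmap_slice) auto
    finally show ?thesis by simp
  qed
  hence "(\<Sum>w\<in>F. (norm (slice w x))\<^sup>2) \<le> (\<Sum>w\<in>F. (norm (l2_restrict (snd -` {w}) x))\<^sup>2)"
    by (intro sum_mono power_mono) auto
  also have "\<dots> \<le> (norm x)\<^sup>2"
    by (rule sum_norm_restrict_le) (auto simp: assms disjoint_family_on_def)
  finally show ?thesis .
qed

text \<open>This is A \<otimes> P, with P the coordinate projection onto \<open>W\<close>; it never
  mixes different second indices.\<close>

definition slicewise :: "'w set \<Rightarrow> ('v, 'e::chilbert_space) l2 op \<Rightarrow> ('v \<times> 'w, 'e) l2 op" where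
  "slicewise W A = (THE T. \<forall>x vw. coord (blinfun_apply T x) vw =
    (if snd vw \<in> W then coord (A (slice (snd vw) x)) (fst vw) else 0))"

lemma slicewise_ex:
  fixes A :: "('v, 'e::chilbert_space) l2 op" and W :: "'w set"
  shows "\<exists>T :: ('v \<times> 'w, 'e) l2 op. (\<forall>x vw. coord (blinfun_apply T x) vw =
    (if snd vw \<in> W then coord (A (slice (snd vw) x)) (fst vw) else 0)) \<and> norm T \<le> norm A"
proof (rule l2_op_ex)
  fix x :: "('v \<times> 'w, 'e) l2" and G :: "('v \<times> 'w) set" assume G: "finite G"
  have "(\<Sum>vw\<in>G. (norm (if snd vw \<in> W then coord (A (slice (snd vw) x)) (fst vw) else 0))\<^sup>2)
      \<le> (\<Sum>vw\<in>G. (norm (coord (A (slice (snd vw) x)) (fst vw)))\<^sup>2)"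
    by (intro sum_mono) auto
  \<comment> \<open>Enlarging \<open>G\<close> to a rectangle separates the sum into slices.\<close>
  also have "\<dots> \<le> (\<Sum>vw\<in>fst ` G \<times> snd ` G. (norm (coord (A (slice (snd vw) x)) (fst vw)))\<^sup>2)"
    using G by (intro sum_mono2) (auto simp: rev_image_eqI)
  also have "\<dots> = (\<Sum>w\<in>snd ` G. \<Sum>v\<in>fst ` G. (norm (coord (A (slice w x)) v))\<^sup>2)"
    by (subst sum.swap) (simp add: sum.cartesian_product case_prod_beta)
  also have "\<dots> \<le> (\<Sum>w\<in>snd ` G. (norm (A (slice w x)))\<^sup>2)"
    using G by (intro sum_mono sum_coord_sq_le) auto
  also have "\<dots> \<le> (\<Sum>w\<in>snd ` G. (norm A)\<^sup>2 * (norm (slice w x))\<^sup>2)"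
    by (intro sum_mono) (metis norm_blinfun norm_ge_zero power_mono power_mult_distrib)
  also have "\<dots> \<le> (norm A)\<^sup>2 * (norm x)\<^sup>2"
    unfolding sum_distrib_left[symmetric] using G by (intro mult_left_mono sum_norm_slice_le) auto
  finally show "(\<Sum>vw\<in>G. (norm (if snd vw \<in> W then coord (A (slice (snd vw) x)) (fst vw) else 0))\<^sup>2)
      \<le> (norm A * norm x)\<^sup>2"
    by (simp add: power_mult_distrib)
qed (simp_all add: blinfun.add_right blinfun.scaleR_right)

lemma coord_slicewise: "coord (slicewise W A x) (v, w) = (if w \<in> W then coord (A (slice w x)) v else 0)"
  using the_l2_op(1)[OF slicewise_ex[of W A], of x "(v, w)"] unfolding slicewise_def by simp

lemma norm_slicewise: "norm (slicewise W A) \<le> norm A"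
  using the_l2_op(2)[OF slicewise_ex[of W A]] unfolding slicewise_def by simp

lemma coord_l2_tensor: "coord (l2_tensor x y) (v, w) = coord y w *\<^sub>C coord x v"
  by (simp add: l2_tensor.rep_eq)

lemma op_l2_tensor_id_on:
  fixes A :: "('v, 'e::chilbert_space) l2 op" and W :: "'w set"
  assumes A: "A \<in> bop UNIV UNIV"
  shows "op_l2_tensor A (id_on W) = slicewise W A"
  unfolding op_l2_tensor_def
proof (rule the_equality)
  have sl: "slice w (l2_tensor x y) = coord y w *\<^sub>C x" for w :: 'w and x :: "('v, 'e) l2" and y
    by (rule l2_eqI) (simp add: coord_slice coord_l2_tensor)
  have sc: "slice w (c *\<^sub>C x) = c *\<^sub>C slice w x" for w :: 'w and c and x :: "('v \<times> 'w, 'e) l2"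
    by (rule l2_eqI) (simp add: coord_slice)
  show P: "slicewise W A \<in> bop UNIV UNIV \<and>
      (\<forall>x y. blinfun_apply (slicewise W A) (l2_tensor x y) = l2_tensor (A x) (id_on W y))"
    using A
    by (auto simp: in_bop_UNIV coord_slicewise sl sc coord_l2_tensor coord_id_on intro!: l2_eqI)
  fix C assume C: "C \<in> bop UNIV UNIV \<and>
      (\<forall>x y. blinfun_apply C (l2_tensor x y) = l2_tensor (A x) (id_on W y))"
  show "C = slicewise W A"
  proof (rule l2_blinfun_eqI)
    fix h :: 'e and vw :: "'v \<times> 'w"
    have "vket h vw = l2_tensor (vket h (fst vw)) (ket (snd vw))"
      by (rule l2_eqI) (auto simp: coord_vket coord_l2_tensor ket.rep_eq)
    thus "C (vket h vw) = slicewise W A (vket h vw)"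
      using C P by simp
  qed
qed

lemma complex_l2_blinfun_eqI:
  fixes S T :: "('w, complex) l2 \<Rightarrow>\<^sub>L 'b::chilbert_space"
  assumes "S \<in> bop UNIV UNIV" "T \<in> bop UNIV UNIV" "\<And>w. S (ket w) = T (ket w)"
  shows "S = T"
  by (rule l2_blinfun_eqI) (simp add: vket_complex assms bop_UNIV_scaleC)

lemma bop_l2_on_ket:
  fixes T :: "('v, complex) l2 \<Rightarrow>\<^sub>L ('w, complex) l2"
  assumes "T \<in> bop (l2_on V) (l2_on W)"
  shows "T \<in> bop UNIV UNIV" "v \<notin> V \<Longrightarrow> T (ket v) = 0"
  using assms in_bop_l2_on[of T V W] vket_one by metis+

section \<open>Creation operators as weighted composition operators\<close>

lemma coord_wpush_inj:
  assumes "wmap p c" "\<And>u v. c u \<noteq> 0 \<Longrightarrow> c v \<noteq> 0 \<Longrightarrow> p u = p v \<Longrightarrow> u = v" "c u \<noteq> 0"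
  shows "coord (wpush p c x) (p u) = c u *\<^sub>R coord x u"
proof -
  have "{v. p v = p u \<and> c v \<noteq> 0} = {u}" using assms(2,3) by blast
  thus ?thesis using assms(1) by (simp add: coord_wpush)
qed

lemma coord_wpush_eq_0:
  assumes "wmap p c" "\<And>u. c u \<noteq> 0 \<Longrightarrow> p u \<noteq> w"
  shows "coord (wpush p c x) w = 0"
proof -
  have "{v. p v = w \<and> c v \<noteq> 0} = {}" using assms(2) by blast
  thus ?thesis using assms(1) by (simp only: coord_wpush sum.empty)
qed

text \<open>For \<open>p\<close> injective on \<open>W\<close>, the partial isometry that moves the
  basis vector at w in \<open>W\<close> to \<open>p w\<close> and kills all others. Creation
  operators, their ampliations and their words all have this form.\<close>

definition shift_on :: "('w \<Rightarrow> 'w) \<Rightarrow> 'w set \<Rightarrow> ('w, 'e::chilbert_space) l2 op" where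
  "shift_on p W = wpush p (\<lambda>w. of_bool (w \<in> W))"

lemma wmap_shift_on: "inj_on p W \<Longrightarrow> wmap p (\<lambda>w. of_bool (w \<in> W))"
  by (rule wmap_inj) (auto dest: inj_onD)

lemma shift_on_vket: "inj_on p W \<Longrightarrow> shift_on p W (vket h w) = (if w \<in> W then vket h (p w) else 0)"
  by (simp add: shift_on_def wpush_vket wmap_shift_on vket_linear)

lemma shift_on_ket: "inj_on p W \<Longrightarrow> shift_on p W (ket w) = (if w \<in> W then ket (p w) else 0)"
  using shift_on_vket[of p W "1 :: complex" w] by simp

lemma coord_shift_on:
  assumes "inj_on p W"
  shows "u \<in> W \<Longrightarrow> coord (shift_on p W x) (p u) = coord x u"
    and "w \<notin> p ` W \<Longrightarrow> coord (shift_on p W x) w = 0"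
  using coord_wpush_inj[OF wmap_shift_on[OF assms], of u x]
    coord_wpush_eq_0[OF wmap_shift_on[OF assms], of w x] assms
  by (auto simp: shift_on_def dest: inj_onD)

lemma shift_on_bop:
  assumes "inj_on p W" "p ` W \<subseteq> W"
  shows "shift_on p W \<in> bop (l2_on W) (l2_on W)"
  unfolding in_bop_l2_on
  using assms wpush_bop[OF wmap_shift_on[OF assms(1)]]
  by (auto simp: shift_on_vket shift_on_def[symmetric] intro!: coord_shift_on(2))

lemma the_shift_on:
  assumes "inj_on p W" "p ` W \<subseteq> W"
  shows "(THE T. T \<in> bop (l2_on W) (l2_on W) \<and> (\<forall>w\<in>W. blinfun_apply T (ket w) = ket (p w)))
    = shift_on p W"
proof (rule the_equality)
  fix T assume T: "T \<in> bop (l2_on W) (l2_on W) \<and> (\<forall>w\<in>W. blinfun_apply T (ket w) = ket (p w))"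
  show "T = shift_on p W"
    by (rule complex_l2_blinfun_eqI)
      (use T assms shift_on_bop[OF assms] bop_l2_on_ket in \<open>auto simp: shift_on_ket\<close>)
qed (use assms in \<open>auto simp: shift_on_bop shift_on_ket\<close>)

lemma left_creation_eq:
  "j \<in> {1..n} \<Longrightarrow> left_creation n j = shift_on ((#) j) (lists {1..n})"
  unfolding left_creation_def fock_def by (rule the_shift_on) auto

lemma right_creation_eq:
  "j \<in> {1..n} \<Longrightarrow> right_creation n j = shift_on (\<lambda>\<alpha>. \<alpha> @ [j]) (lists {1..n})"
  unfolding right_creation_def fock_def by (rule the_shift_on) (auto simp: inj_on_def)

section \<open>Word tuples and ampliations\<close>

lemma words_extensional: "\<gamma> \<in> words k n \<Longrightarrow> \<gamma> \<in> extensional {1..k}"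
  by (simp add: words_def PiE_def)

lemma words_mem: "\<gamma> \<in> words k n \<Longrightarrow> i \<in> {1..k} \<Longrightarrow> \<gamma> i \<in> lists {1..n i}"
  unfolding words_def by (rule PiE_mem)

lemma words_upd: "\<gamma> \<in> words k n \<Longrightarrow> i \<in> {1..k} \<Longrightarrow> u \<in> lists {1..n i} \<Longrightarrow> \<gamma>(i := u) \<in> words k n"
  by (auto simp: words_def PiE_iff extensional_def)

lemma words_eqI:
  "\<gamma> \<in> words k n \<Longrightarrow> \<eta> \<in> words k n \<Longrightarrow> (\<And>i. i \<in> {1..k} \<Longrightarrow> \<gamma> i = \<eta> i) \<Longrightarrow> \<gamma> = \<eta>"
  unfolding words_def by (rule PiE_ext)

context
  fixes k :: nat and n :: "nat \<Rightarrow> nat" and i :: nat and p :: "nat list \<Rightarrow> nat list"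
  assumes i: "i \<in> {1..k}" and inj: "inj_on p (lists {1..n i})"
    and sub: "p ` lists {1..n i} \<subseteq> lists {1..n i}"
begin

lemma inj_ampl: "inj_on (\<lambda>\<gamma>. \<gamma>(i := p (\<gamma> i))) (words k n)"
proof (rule inj_onI)
  fix \<gamma> \<eta> assume w: "\<gamma> \<in> words k n" "\<eta> \<in> words k n" and eq: "\<gamma>(i := p (\<gamma> i)) = \<eta>(i := p (\<eta> i))"
  have e: "(\<gamma>(i := p (\<gamma> i))) l = (\<eta>(i := p (\<eta> i))) l" for l using eq by simp
  from e[of i] have "\<gamma> i = \<eta> i"
    using inj_onD[OF inj _ words_mem[OF w(1) i] words_mem[OF w(2) i]] by simp
  show "\<gamma> = \<eta>"
  proof
    fix l show "\<gamma> l = \<eta> l" using e[of l] \<open>\<gamma> i = \<eta> i\<close> by (cases "l = i") auto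
  qed
qed

lemma sub_ampl: "(\<lambda>\<gamma>. \<gamma>(i := p (\<gamma> i))) ` words k n \<subseteq> words k n"
  using sub words_mem[OF _ i] by (blast intro: words_upd i)

text \<open>A coordinate of an elementary tensor is a product over the components, and the shift
  alters only the factor at \<open>i\<close>; the work lies in showing that both sides vanish off
  the image of the shift.\<close>

lemma shift_on_mtensor:
  assumes x: "\<forall>l\<in>{1..k}. x l \<in> fock (n l)"
  shows "shift_on (\<lambda>\<gamma>. \<gamma>(i := p (\<gamma> i))) (words k n) (mtensor k x)
    = mtensor k (x(i := shift_on p (lists {1..n i}) (x i)))"
proof (rule l2_eqI)
  fix \<eta>
  let ?y = "x(i := shift_on p (lists {1..n i}) (x i))"
  show "coord (shift_on (\<lambda>\<gamma>. \<gamma>(i := p (\<gamma> i))) (words k n) (mtensor k x)) \<eta> = coord (mtensor k ?y) \<eta>"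
  proof (cases "\<eta> \<in> (\<lambda>\<gamma>. \<gamma>(i := p (\<gamma> i))) ` words k n")
    case True
    then obtain \<gamma> where \<gamma>: "\<gamma> \<in> words k n" and \<eta>: "\<eta> = \<gamma>(i := p (\<gamma> i))" by blast
    have ext: "\<gamma> \<in> extensional {1..k}" "\<eta> \<in> extensional {1..k}"
      using \<gamma> sub_ampl \<eta> by (blast intro: words_extensional)+
    have "coord (?y l) (\<eta> l) = coord (x l) (\<gamma> l)" for l
      using coord_shift_on(1)[OF inj words_mem[OF \<gamma> i]] by (cases "l = i") (simp_all add: \<eta>)
    thus ?thesis
      using coord_shift_on(1)[OF inj_ampl \<gamma>, of "mtensor k x"] ext
      by (simp add: \<eta>[symmetric] mtensor.rep_eq del: One_nat_def)
  next
    case False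
    \<comment> \<open>If every factor were nonzero, the words at the other components would lie over
      the right alphabets and \<open>\<eta> i\<close> in the image of \<open>p\<close>, so
      \<open>\<eta>\<close> would have a preimage.\<close>
    have "(\<Prod>l=1..k. coord (?y l) (\<eta> l)) = 0" if ext: "\<eta> \<in> extensional {1..k}"
    proof (rule ccontr)
      assume "(\<Prod>l=1..k. coord (?y l) (\<eta> l)) \<noteq> 0"
      hence nz: "coord (?y l) (\<eta> l) \<noteq> 0" if "l \<in> {1..k}" for l
        using that by (auto simp: prod_zero_iff)
      have "\<eta> i \<in> p ` lists {1..n i}"
        using nz[OF i] coord_shift_on(2)[OF inj] by auto
      then obtain u where u: "u \<in> lists {1..n i}" "\<eta> i = p u" by blast
      have "\<eta> l \<in> lists {1..n l}" if "l \<in> {1..k}" "l \<noteq> i" for l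
      proof -
        have "coord (x l) (\<eta> l) \<noteq> 0" using nz[OF that(1)] that(2) by simp
        moreover have "x l \<in> l2_on (lists {1..n l})" using x that(1) by (simp only: fock_def)
        ultimately show ?thesis unfolding l2_on_def by blast
      qed
      hence "\<eta>(i := u) \<in> words k n"
        using u ext i by (auto simp: words_def PiE_iff extensional_def)
      moreover have "\<eta> = (\<eta>(i := u))(i := p ((\<eta>(i := u)) i))"
        using u by auto
      ultimately show False using False by blast
    qed
    thus ?thesis
      using coord_shift_on(2)[OF inj_ampl False, of "mtensor k x"]
      by (simp only: mtensor.rep_eq split: if_split) simp
  qed
qed

text \<open>Elementary tensors of kets are kets of word tuples, so the prescribed action fixes the
  operator on \<open>mfock k n\<close>, and membership in \<open>bop\<close> fixes it on the
  complement.\<close>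

lemma ampliation_shift_on:
  "ampliation k n i (shift_on p (lists {1..n i})) = shift_on (\<lambda>\<gamma>. \<gamma>(i := p (\<gamma> i))) (words k n)"
  unfolding ampliation_def mfock_def
proof (rule the_equality)
  let ?S = "shift_on (\<lambda>\<gamma>. \<gamma>(i := p (\<gamma> i))) (words k n) :: mfock_op"
  let ?P = "\<lambda>T. T \<in> bop (l2_on (words k n)) (l2_on (words k n)) \<and>
     (\<forall>x. (\<forall>l\<in>{1..k}. x l \<in> fock (n l)) \<longrightarrow>
       blinfun_apply T (mtensor k x) = mtensor k (x(i := shift_on p (lists {1..n i}) (x i))))"
  show S: "?P ?S"
    using shift_on_mtensor shift_on_bop[OF inj_ampl sub_ampl] by blast
  fix T assume T: "?P T"
  have "T (ket \<gamma>) = ?S (ket \<gamma>)" for \<gamma>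
  proof (cases "\<gamma> \<in> words k n")
    case True
    have "ket (\<gamma> l) \<in> fock (n l)" if "l \<in> {1..k}" for l
      using words_mem[OF True that] by (auto simp: fock_def l2_on_def ket.rep_eq)
    hence "T (mtensor k (\<lambda>l. ket (\<gamma> l))) = ?S (mtensor k (\<lambda>l. ket (\<gamma> l)))"
      using S T by simp
    thus ?thesis by (simp only: mtensor_ket[OF words_extensional[OF True]])
  next
    case False
    thus ?thesis
      by (simp only: bop_l2_on_ket(2)[OF conjunct1[OF T] False] bop_l2_on_ket(2)[OF conjunct1[OF S] False])
  qed
  thus "T = ?S"
    by (rule complex_l2_blinfun_eqI[OF bop_l2_on_ket(1)[OF conjunct1[OF T]] bop_l2_on_ket(1)[OF conjunct1[OF S]]])
qed

end

lemma S_op_eq: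
  assumes "i \<in> {1..k}" "j \<in> {1..n i}"
  shows "S_op k n i j = shift_on (\<lambda>\<gamma>. \<gamma>(i := j # \<gamma> i)) (words k n)"
  unfolding S_op_def left_creation_eq[OF assms(2)]
  by (rule ampliation_shift_on) (use assms in auto)

lemma R_op_eq:
  assumes "i \<in> {1..k}" "j \<in> {1..n i}"
  shows "R_op k n i j = shift_on (\<lambda>\<gamma>. \<gamma>(i := \<gamma> i @ [j])) (words k n)"
  unfolding R_op_def right_creation_eq[OF assms(2)]
  by (rule ampliation_shift_on) (use assms in \<open>auto simp: inj_on_def\<close>)

section \<open>Products of creation operators\<close>

lemma words_prepend:
  "\<gamma> \<in> words k n \<Longrightarrow> i \<in> {1..k} \<Longrightarrow> u \<in> lists {1..n i} \<Longrightarrow> \<gamma>(i := u @ \<gamma> i) \<in> words k n"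
  by (rule words_upd) (auto dest: words_mem)

lemma words_append:
  "\<gamma> \<in> words k n \<Longrightarrow> i \<in> {1..k} \<Longrightarrow> u \<in> lists {1..n i} \<Longrightarrow> \<gamma>(i := \<gamma> i @ u) \<in> words k n"
  by (rule words_upd) (auto dest: words_mem)

lemma inj_upd_prepend: "inj (\<lambda>\<gamma>. \<gamma>(i := u @ \<gamma> i))"
proof (rule injI)
  fix \<gamma> \<eta> :: "'a \<Rightarrow> 'b list" assume eq: "\<gamma>(i := u @ \<gamma> i) = \<eta>(i := u @ \<eta> i)"
  show "\<gamma> = \<eta>"
  proof
    fix l show "\<gamma> l = \<eta> l" using fun_cong[OF eq, of l] by (cases "l = i") auto
  qed
qed

lemma inj_upd_append: "inj (\<lambda>\<gamma>. \<gamma>(i := \<gamma> i @ u))"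
proof (rule injI)
  fix \<gamma> \<eta> :: "'a \<Rightarrow> 'b list" assume eq: "\<gamma>(i := \<gamma> i @ u) = \<eta>(i := \<eta> i @ u)"
  show "\<gamma> = \<eta>"
  proof
    fix l show "\<gamma> l = \<eta> l" using fun_cong[OF eq, of l] by (cases "l = i") auto
  qed
qed

lemma wmap_scaled_inj:
  assumes "inj p" "0 \<le> r" "r \<le> 1"
  shows "wmap p (\<lambda>w. r ^ m * of_bool (w \<in> W))"
  using assms by (intro wmap_inj) (auto dest: injD simp: power_le_one)

text \<open>The radius \<open>r\<close> is kept as a parameter: \<open>r = 1\<close> serves the
  Fourier series, general \<open>r\<close> the Berezin kernel.\<close>

lemma op_word_eq:
  assumes i: "i \<in> {1..k}" and r: "0 \<le> r" "r \<le> 1" and u: "u \<in> lists {1..n i}"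
  shows "op_word (id_mfock k n) (\<lambda>j. r *\<^sub>R S_op k n i j) u
    = wpush (\<lambda>\<gamma>. \<gamma>(i := u @ \<gamma> i)) (\<lambda>\<gamma>. r ^ length u * of_bool (\<gamma> \<in> words k n))"
  using u
proof (induction u rule: list.induct)
  case Nil
  show ?case by (simp add: id_on_wpush)
next
  case (Cons j u)
  hence ju: "j \<in> {1..n i}" "u \<in> lists {1..n i}" by auto
  have inj: "inj_on (\<lambda>\<gamma>. \<gamma>(i := j # \<gamma> i)) (words k n)"
    using inj_on_subset[OF inj_upd_prepend[of i "[j]"]] by simp
  show ?case
  proof (rule l2_blinfun_eqI)
    fix h :: complex and \<gamma>
    note w = wmap_scaled_inj[OF inj_upd_prepend r]
    show "op_word (id_mfock k n) (\<lambda>j. r *\<^sub>R S_op k n i j) (j # u) (vket h \<gamma>) =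
      wpush (\<lambda>\<gamma>. \<gamma>(i := (j # u) @ \<gamma> i)) (\<lambda>\<gamma>. r ^ length (j # u) * of_bool (\<gamma> \<in> words k n)) (vket h \<gamma>)"
      unfolding op_word.simps Cons.IH[OF ju(2)] S_op_eq[where n = n, OF i ju(1)] wpush_vket[OF w]
        blinfun_apply_blinfun_compose
      using words_prepend[where n = n, OF _ i ju(2), of \<gamma>]
      by (auto simp: blinfun.scaleR_left blinfun.scaleR_right shift_on_vket[OF inj] vket_linear
          blinfun.zero_right)
  qed
qed

text \<open>Componentwise concatenation. Off \<open>{1..k}\<close> the value of
  \<open>\<sigma>\<close> is kept, which makes \<open>cat k \<alpha>\<close> injective on all
  functions and not just on word tuples.\<close>

definition cat :: "nat \<Rightarrow> (nat \<Rightarrow> nat list) \<Rightarrow> (nat \<Rightarrow> nat list) \<Rightarrow> nat \<Rightarrow> nat list" where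
  "cat k \<alpha> \<sigma> = (\<lambda>l. if l \<in> {1..k} then \<alpha> l @ \<sigma> l else \<sigma> l)"

lemma cat_words: "\<alpha> \<in> words k n \<Longrightarrow> \<sigma> \<in> words k n \<Longrightarrow> cat k \<alpha> \<sigma> \<in> words k n"
  by (auto simp: words_def cat_def PiE_iff extensional_def)

lemma inj_cat: "inj (cat k \<alpha>)"
proof (rule injI, rule ext)
  fix \<sigma> \<tau> l assume "cat k \<alpha> \<sigma> = cat k \<alpha> \<tau>"
  from fun_cong[OF this, of l] show "\<sigma> l = \<tau> l" by (auto simp: cat_def split: if_splits)
qed

text \<open>Each adjoint reads a coordinate at a word with a prefix added, so peeling off the
  outermost factor changes \<open>\<sigma>\<close> at one index; distinctness ensures that this
  index is not touched again.\<close>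

lemma foldr_op_word_adj:
  assumes "distinct is" "set is \<subseteq> {1..k}" "0 \<le> r" "r \<le> 1" "\<beta> \<in> words k n" "\<sigma> \<in> words k n"
  shows "coord (foldr (\<lambda>i Q. adj (op_word (id_mfock k n) (\<lambda>j. r *\<^sub>R S_op k n i j) (\<beta> i)) o\<^sub>L Q) is
      (id_mfock k n) x) \<sigma> = (\<Prod>i\<in>set is. r ^ length (\<beta> i)) *\<^sub>R
      coord x (\<lambda>l. if l \<in> set is then \<beta> l @ \<sigma> l else \<sigma> l)"
  using assms
proof (induction "is" arbitrary: \<sigma>)
  case Nil
  thus ?case by (simp add: coord_id_on)
next
  case (Cons i "is")
  hence i: "i \<in> {1..k}" by simp
  have b: "\<beta> i \<in> lists {1..n i}" by (rule words_mem[OF _ i]) (fact Cons.prems)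
  have "(\<lambda>l. if l \<in> set is then \<beta> l @ (\<sigma>(i := \<beta> i @ \<sigma> i)) l else (\<sigma>(i := \<beta> i @ \<sigma> i)) l) =
     (\<lambda>l. if l \<in> set (i # is) then \<beta> l @ \<sigma> l else \<sigma> l)"
    using Cons.prems(1) by auto
  with Cons show ?case
    using words_prepend[OF \<open>\<sigma> \<in> words k n\<close> i b]
    by (simp add: op_word_eq[where n = n, OF i _ _ b] adj_wpush coord_wpull wmap_scaled_inj inj_upd_prepend)
qed

lemma foldr_op_word_adj_outside:
  assumes "set is \<subseteq> {1..k}" "0 \<le> r" "r \<le> 1" "\<beta> \<in> words k n" "\<sigma> \<notin> words k n"
  shows "coord (foldr (\<lambda>i Q. adj (op_word (id_mfock k n) (\<lambda>j. r *\<^sub>R S_op k n i j) (\<beta> i)) o\<^sub>L Q) is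
      (id_mfock k n) x) \<sigma> = 0"
proof (cases "is")
  case Nil
  thus ?thesis using assms by (simp add: coord_id_on)
next
  case (Cons i js)
  hence i: "i \<in> {1..k}" using assms by simp
  have b: "\<beta> i \<in> lists {1..n i}" by (rule words_mem[OF assms(4) i])
  show ?thesis
    using assms Cons
    by (simp add: op_word_eq[where n = n, OF i _ _ b] adj_wpush coord_wpull wmap_scaled_inj inj_upd_prepend)
qed

lemma op_mword_adj_eq:
  assumes "0 \<le> r" "r \<le> 1" "\<beta> \<in> words k n"
  shows "op_mword_adj (id_mfock k n) k (\<lambda>i j. r *\<^sub>R S_op k n i j) \<beta> =
    wpull (cat k \<beta>) (\<lambda>\<sigma>. r ^ (\<Sum>i=1..k. length (\<beta> i)) * of_bool (\<sigma> \<in> words k n))"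
proof (rule blinfun_eqI, rule l2_eqI)
  fix x \<sigma>
  have s: "set [1..<Suc k] = {1..k}" by auto
  note w = wmap_scaled_inj[OF inj_cat assms(1,2)]
  show "coord (op_mword_adj (id_mfock k n) k (\<lambda>i j. r *\<^sub>R S_op k n i j) \<beta> x) \<sigma> =
    coord (wpull (cat k \<beta>) (\<lambda>\<sigma>. r ^ (\<Sum>i=1..k. length (\<beta> i)) * of_bool (\<sigma> \<in> words k n)) x) \<sigma>"
    using foldr_op_word_adj[of "[1..<Suc k]" k r \<beta> n \<sigma> x]
      foldr_op_word_adj_outside[of "[1..<Suc k]" k r \<beta> n \<sigma> x] assms
    unfolding op_mword_adj_def s
    by (cases "\<sigma> \<in> words k n")
      (simp_all add: coord_wpull[OF w] del: upt_Suc One_nat_def, simp add: power_sum cat_def)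
qed

text \<open>The second conjunct keeps the induction going: the next factor preserves a ket only if
  its index is still a word tuple.\<close>

lemma foldr_op_word:
  assumes "distinct is" "set is \<subseteq> {1..k}" "\<alpha> \<in> words k n"
  shows "foldr (\<lambda>i Q. op_word (id_mfock k n) (S_op k n i) (\<alpha> i) o\<^sub>L Q) is (id_mfock k n) (ket \<gamma>) =
    (if \<gamma> \<in> words k n then ket (\<lambda>l. if l \<in> set is then \<alpha> l @ \<gamma> l else \<gamma> l) else 0) \<and>
    (\<gamma> \<in> words k n \<longrightarrow> (\<lambda>l. if l \<in> set is then \<alpha> l @ \<gamma> l else \<gamma> l) \<in> words k n)"
  using assms
proof (induction "is")
  case Nil
  thus ?case using id_on_vket[of "words k n" "1 :: complex" \<gamma>] by simp
next
  case (Cons i "is")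
  hence i: "i \<in> {1..k}" by simp
  have b: "\<alpha> i \<in> lists {1..n i}" by (rule words_mem[OF _ i]) (fact Cons.prems)
  let ?g = "\<lambda>l. if l \<in> set is then \<alpha> l @ \<gamma> l else \<gamma> l"
  have g: "?g(i := \<alpha> i @ ?g i) = (\<lambda>l. if l \<in> set (i # is) then \<alpha> l @ \<gamma> l else \<gamma> l)"
    using Cons.prems(1) by auto
  have "wpush (\<lambda>\<gamma>. \<gamma>(i := \<alpha> i @ \<gamma> i)) (\<lambda>\<gamma>. of_bool (\<gamma> \<in> words k n)) (ket ?g) = ket (?g(i := \<alpha> i @ ?g i))"
    if "?g \<in> words k n"
    using that wmap_scaled_inj[OF inj_upd_prepend, of 1 i "\<alpha> i" 0 "words k n"] by (simp add: wpush_ket)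
  thus ?case
    using Cons words_prepend[where n = n, OF _ i b, of ?g] op_word_eq[where n = n, OF i _ _ b, of 1] unfolding g
    by (auto simp: blinfun.zero_right)
qed

lemma op_mword_eq:
  assumes "\<alpha> \<in> words k n"
  shows "op_mword (id_mfock k n) k (S_op k n) \<alpha> = shift_on (cat k \<alpha>) (words k n)"
proof -
  have s: "set [1..<Suc k] = {1..k}" by auto
  have inj: "inj_on (cat k \<alpha>) (words k n)" by (rule inj_on_subset[OF inj_cat]) simp
  have "foldr (\<lambda>i Q. op_word (id_mfock k n) (S_op k n i) (\<alpha> i) o\<^sub>L Q) is (id_mfock k n) \<in> bop UNIV UNIV"
    if "set is \<subseteq> {1..k}" for "is"
    using that
  proof (induction "is")
    case Nil
    show ?case by (simp add: id_on_wpull wpull_bop wmap_ind)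
  next
    case (Cons i "is")
    hence i: "i \<in> {1..k}" by simp
    have b: "\<alpha> i \<in> lists {1..n i}" by (rule words_mem[OF assms i])
    show ?case
      using Cons op_word_eq[where n = n, OF i _ _ b, of 1]
        wmap_scaled_inj[OF inj_upd_prepend, of 1 i "\<alpha> i" 0 "words k n"]
      by (auto intro!: bop_UNIV_compose wpush_bop)
  qed
  from this[of "[1..<Suc k]"] show ?thesis
    unfolding op_mword_def
    using foldr_op_word[of "[1..<Suc k]" k \<alpha> n] assms wpush_bop[OF wmap_shift_on[OF inj]]
    by (intro complex_l2_blinfun_eqI)
      (simp_all add: shift_on_ket[OF inj] s shift_on_def[symmetric] del: upt_Suc One_nat_def set_upt,
        simp add: cat_def)
qed

section \<open>Matrix entries of the Fourier series\<close>

text \<open>For comparable words this is \<open>x\<close> without the longest common suffix;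
  truncated subtraction makes it empty when \<open>x\<close> is not the longer word.\<close>

definition strip_common :: "'a list \<Rightarrow> 'a list \<Rightarrow> 'a list" where
  "strip_common x y = take (length x - length y) x"

text \<open>One word is a suffix of the other. At least one of the two differences is 0, so the
  condition is symmetric and needs no case distinction.\<close>

definition comparable :: "'a list \<Rightarrow> 'a list \<Rightarrow> bool" where
  "comparable x y \<longleftrightarrow> drop (length x - length y) x = drop (length y - length x) y"

lemma common_suffix_iff:
  "(\<exists>s. x = a @ s \<and> y = b @ s) \<and> (a = [] \<or> b = []) \<longleftrightarrow> comparable x y \<and> a = strip_common x y \<and> b = strip_common y x"
proof
  assume "comparable x y \<and> a = strip_common x y \<and> b = strip_common y x"
  hence c: "comparable x y" and ab: "a = strip_common x y" "b = strip_common y x" by auto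
  have "x = a @ drop (length x - length y) x" "y = b @ drop (length x - length y) x"
    using c by (simp add: ab strip_common_def, simp add: ab strip_common_def comparable_def)
  moreover have "a = [] \<or> b = []" by (auto simp: ab strip_common_def)
  ultimately show "(\<exists>s. x = a @ s \<and> y = b @ s) \<and> (a = [] \<or> b = [])" by blast
qed (auto simp: strip_common_def comparable_def)

text \<open>Remove the longest common prefix of the reversed words: what remains is nonempty on both
  sides and begins with different letters.\<close>

lemma not_comparableE:
  assumes "\<not> comparable x y"
  obtains a b s t u where "x = a @ s # u" "y = b @ t # u" "s \<noteq> t"
proof -
  obtain ps xs ys where p: "rev x = ps @ xs" "rev y = ps @ ys" "xs = [] \<or> ys = [] \<or> hd xs \<noteq> hd ys"
    using longest_common_prefix by blast
  have xy: "x = rev xs @ rev ps" "y = rev ys @ rev ps"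
    using p(1,2) by (metis rev_append rev_rev_ident)+
  show ?thesis
  proof (cases "xs = [] \<or> ys = []")
    case True
    hence "comparable x y" using common_suffix_iff[of x "rev xs" y "rev ys"] xy by auto
    thus ?thesis using assms by simp
  next
    case False
    then obtain s xs' t ys' where "xs = s # xs'" "ys = t # ys'" by (meson list.exhaust)
    thus ?thesis using that[of "rev xs'" s "rev ps" "rev ys'" t] xy p(3) by simp
  qed
qed

definition reduced :: "nat \<Rightarrow> (nat \<Rightarrow> nat list) \<Rightarrow> (nat \<Rightarrow> nat list) \<Rightarrow> nat \<Rightarrow> nat list" where
  "reduced k \<eta> \<gamma> = (\<lambda>i\<in>{1..k}. strip_common (\<eta> i) (\<gamma> i))"

definition comparable_words :: "nat \<Rightarrow> (nat \<Rightarrow> nat list) \<Rightarrow> (nat \<Rightarrow> nat list) \<Rightarrow> bool" where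
  "comparable_words k \<eta> \<gamma> \<longleftrightarrow> (\<forall>i\<in>{1..k}. comparable (\<eta> i) (\<gamma> i))"

text \<open>Column length minus row length, so that positive degrees belong to the annihilating
  words \<beta> of the series.\<close>

definition degrees :: "nat \<Rightarrow> int list \<Rightarrow> (nat \<Rightarrow> nat list) \<Rightarrow> (nat \<Rightarrow> nat list) \<Rightarrow> bool" where
  "degrees k ms \<eta> \<gamma> \<longleftrightarrow> (\<forall>i\<in>{1..k}. ms ! (i - 1) = int (length (\<gamma> i)) - int (length (\<eta> i)))"

definition total_degree :: "nat \<Rightarrow> (nat \<Rightarrow> nat list) \<Rightarrow> (nat \<Rightarrow> nat list) \<Rightarrow> nat" where
  "total_degree k \<eta> \<gamma> = (\<Sum>i=1..k. length (reduced k \<eta> \<gamma> i) + length (reduced k \<gamma> \<eta> i))"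

text \<open>The entry that a multi-Toeplitz operator with coefficients \<open>C\<close> must have at
  row \<open>\<eta>\<close> and column \<open>\<gamma>\<close>.\<close>

definition fourier_entry :: "nat \<Rightarrow> 'e::chilbert_space coeffs \<Rightarrow> (nat \<Rightarrow> nat list) \<Rightarrow> (nat \<Rightarrow> nat list) \<Rightarrow> 'e \<Rightarrow> 'e" where
  "fourier_entry k C \<eta> \<gamma> h = (if comparable_words k \<eta> \<gamma> then C (reduced k \<eta> \<gamma>) (reduced k \<gamma> \<eta>) h else 0)"

lemma reduced_words: "\<eta> \<in> words k n \<Longrightarrow> reduced k \<eta> \<gamma> \<in> words k n"
  by (auto simp: words_def reduced_def strip_common_def PiE_iff dest: in_set_takeD)

lemma reduced_index:
  assumes "\<eta> \<in> words k n" "\<gamma> \<in> words k n" "degrees k ms \<eta> \<gamma>"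
  shows "(reduced k \<eta> \<gamma>, reduced k \<gamma> \<eta>) \<in> fourier_index k n ms"
proof -
  have "length (reduced k \<eta> \<gamma> i) = nat (- (ms ! (i - 1))) \<and> length (reduced k \<gamma> \<eta> i) = nat (ms ! (i - 1))"
    if "i \<in> {1..k}" for i
    using assms(3) that by (auto simp: reduced_def degrees_def strip_common_def)
  thus ?thesis using assms(1,2) by (auto simp: fourier_index_def reduced_words)
qed

text \<open>In each component one of \<open>\<alpha> i\<close>, \<open>\<beta> i\<close> is empty,
  so writing the pair of words as prefixes of a common suffix is possible in at most one way. This
  is why at most one term of the series contributes to an entry.\<close>

lemma fourier_index_match:
  assumes w: "\<eta> \<in> words k n" "\<gamma> \<in> words k n" and ab: "(\<alpha>, \<beta>) \<in> fourier_index k n ms"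
  shows "(\<exists>\<sigma>\<in>words k n. cat k \<alpha> \<sigma> = \<eta> \<and> cat k \<beta> \<sigma> = \<gamma>) \<longleftrightarrow>
    comparable_words k \<eta> \<gamma> \<and> degrees k ms \<eta> \<gamma> \<and> \<alpha> = reduced k \<eta> \<gamma> \<and> \<beta> = reduced k \<gamma> \<eta>" (is "?L \<longleftrightarrow> ?R")
proof
  assume ?L
  then obtain \<sigma> where \<sigma>: "\<sigma> \<in> words k n" "cat k \<alpha> \<sigma> = \<eta>" "cat k \<beta> \<sigma> = \<gamma>" by blast
  have len: "length (\<alpha> i) = nat (- (ms ! (i - 1)))" "length (\<beta> i) = nat (ms ! (i - 1))"
    if "i \<in> {1..k}" for i using ab that by (auto simp: fourier_index_def)
  have eq: "\<eta> i = \<alpha> i @ \<sigma> i" "\<gamma> i = \<beta> i @ \<sigma> i" if "i \<in> {1..k}" for i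
    using that unfolding \<sigma>(2,3)[symmetric] cat_def by auto
  \<comment> \<open>The positive and the negative part of an integer are never both nonzero.\<close>
  have "\<alpha> i = [] \<or> \<beta> i = []" if "i \<in> {1..k}" for i
    using len[OF that] by (cases "0 \<le> ms ! (i - 1)") auto
  hence c: "comparable (\<eta> i) (\<gamma> i) \<and> \<alpha> i = strip_common (\<eta> i) (\<gamma> i) \<and> \<beta> i = strip_common (\<gamma> i) (\<eta> i)"
    if "i \<in> {1..k}" for i
    using eq[OF that] that common_suffix_iff by blast
  have "degrees k ms \<eta> \<gamma>"
    unfolding degrees_def using len eq by auto
  moreover have abw: "\<alpha> \<in> words k n" "\<beta> \<in> words k n" using ab by (auto simp: fourier_index_def)
  moreover have "\<alpha> = reduced k \<eta> \<gamma>"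
    by (rule words_eqI[OF abw(1) reduced_words[OF w(1)]]) (use c in \<open>simp add: reduced_def\<close>)
  moreover have "\<beta> = reduced k \<gamma> \<eta>"
    by (rule words_eqI[OF abw(2) reduced_words[OF w(2)]]) (use c in \<open>simp add: reduced_def\<close>)
  ultimately show ?R using c by (simp add: comparable_words_def)
next
  assume R: ?R
  \<comment> \<open>The common suffix in each component.\<close>
  define \<sigma> where "\<sigma> = (\<lambda>i\<in>{1..k}. drop (length (\<eta> i) - length (\<gamma> i)) (\<eta> i))"
  have s: "\<sigma> \<in> words k n"
    using w by (auto simp: \<sigma>_def words_def PiE_iff dest: in_set_dropD)
  have "cat k \<alpha> \<sigma> = \<eta>"
    by (rule words_eqI[OF cat_words w(1)])
      (use R s ab in \<open>auto simp: fourier_index_def cat_def reduced_def strip_common_def \<sigma>_def\<close>)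
  moreover have "cat k \<beta> \<sigma> = \<gamma>"
    by (rule words_eqI[OF cat_words w(2)])
      (use R s ab in \<open>auto simp: fourier_index_def cat_def reduced_def strip_common_def \<sigma>_def comparable_words_def comparable_def\<close>)
  ultimately show ?L using s by blast
qed

lemma finite_fourier_index: "finite (fourier_index k n ms)"
proof (rule finite_subset)
  let ?W = "\<lambda>L. \<Pi>\<^sub>E i\<in>{1..k}. {u. set u \<subseteq> {1..n i} \<and> length u = L i}"
  show "fourier_index k n ms \<subseteq> ?W (\<lambda>i. nat (- (ms ! (i - 1)))) \<times> ?W (\<lambda>i. nat (ms ! (i - 1)))"
  proof
    fix p assume "p \<in> fourier_index k n ms"
    then obtain \<alpha> \<beta> where p: "p = (\<alpha>, \<beta>)" "\<alpha> \<in> words k n" "\<beta> \<in> words k n"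
      and len: "\<forall>i\<in>{1..k}. length (\<alpha> i) = nat (- (ms ! (i - 1))) \<and> length (\<beta> i) = nat (ms ! (i - 1))"
      by (auto simp: fourier_index_def)
    have "\<gamma> \<in> ?W (\<lambda>i. length (\<gamma> i))" if "\<gamma> \<in> words k n" for \<gamma>
      using that unfolding words_def PiE_iff lists_eq_set by simp
    with p have "\<alpha> \<in> ?W (\<lambda>i. length (\<alpha> i))" "\<beta> \<in> ?W (\<lambda>i. length (\<beta> i))" by blast+
    moreover have "?W (\<lambda>i. length (\<alpha> i)) = ?W (\<lambda>i. nat (- (ms ! (i - 1))))"
      "?W (\<lambda>i. length (\<beta> i)) = ?W (\<lambda>i. nat (ms ! (i - 1)))"
      using len by (intro PiE_cong; simp)+
    ultimately show "p \<in> ?W (\<lambda>i. nat (- (ms ! (i - 1)))) \<times> ?W (\<lambda>i. nat (ms ! (i - 1)))"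
      by (simp only: p mem_Sigma_iff)
  qed
  show "finite (?W (\<lambda>i. nat (- (ms ! (i - 1)))) \<times> ?W (\<lambda>i. nat (ms ! (i - 1))))"
    by (intro finite_cartesian_product finite_PiE finite_lists_length_eq) auto
qed

lemma inj_on_cat: "inj_on (cat k \<alpha>) W"
  by (rule inj_on_subset[OF inj_cat]) simp

lemma wmap_cat: "wmap (cat k \<alpha>) (\<lambda>\<sigma>. of_bool (\<sigma> \<in> W))"
  by (rule wmap_shift_on[OF inj_on_cat])

text \<open>The word product is the partial isometry that replaces the prefix \<beta> of an index by
  \<alpha>; its entries are 0 or 1 and are multiplied by the coefficient.\<close>

lemma coord_fourier_term:
  assumes ab: "\<alpha> \<in> words k n" "\<beta> \<in> words k n" and C: "C \<in> bop UNIV UNIV"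
  shows "coord (op_vtensor C (op_mword (id_mfock k n) k (S_op k n) \<alpha> o\<^sub>L
      op_mword_adj (id_mfock k n) k (S_op k n) \<beta>) (vket h \<gamma>)) \<eta> =
    (if \<exists>\<sigma>\<in>words k n. cat k \<alpha> \<sigma> = \<eta> \<and> cat k \<beta> \<sigma> = \<gamma> then C h else 0)"
proof -
  let ?b = "\<lambda>\<sigma>. of_bool (\<sigma> \<in> words k n) :: real"
  have adj: "op_mword_adj (id_mfock k n) k (S_op k n) \<beta> = wpull (cat k \<beta>) ?b"
    using op_mword_adj_eq[of 1 \<beta> k n] ab by simp
  have "op_vtensor C (op_mword (id_mfock k n) k (S_op k n) \<alpha> o\<^sub>L
      op_mword_adj (id_mfock k n) k (S_op k n) \<beta>) = vmap C o\<^sub>L (wpush (cat k \<alpha>) ?b o\<^sub>L wpull (cat k \<beta>) ?b)"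
    unfolding adj op_mword_eq[OF ab(1)] shift_on_def
    by (intro op_vtensor_id_tensor C id_tensor_compose id_tensor_wpush id_tensor_wpull wmap_cat)
  hence *: "coord (op_vtensor C (op_mword (id_mfock k n) k (S_op k n) \<alpha> o\<^sub>L
      op_mword_adj (id_mfock k n) k (S_op k n) \<beta>) (vket h \<gamma>)) \<eta> =
      C (coord (wpush (cat k \<alpha>) ?b (wpull (cat k \<beta>) ?b (vket h \<gamma>))) \<eta>)"
    by (simp add: coord_vmap)
  show ?thesis
  proof (cases "\<eta> \<in> cat k \<alpha> ` words k n")
    case True
    then obtain \<sigma> where \<sigma>: "\<sigma> \<in> words k n" "\<eta> = cat k \<alpha> \<sigma>" by blast
    have "coord (wpush (cat k \<alpha>) ?b (wpull (cat k \<beta>) ?b (vket h \<gamma>))) \<eta> =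
        (if cat k \<beta> \<sigma> = \<gamma> then h else 0)"
      unfolding shift_on_def[symmetric] \<sigma>(2) coord_shift_on(1)[OF inj_on_cat \<sigma>(1)]
      using \<sigma>(1) by (simp add: coord_wpull[OF wmap_cat] coord_vket)
    moreover have "(\<exists>\<sigma>'\<in>words k n. cat k \<alpha> \<sigma>' = \<eta> \<and> cat k \<beta> \<sigma>' = \<gamma>) \<longleftrightarrow> cat k \<beta> \<sigma> = \<gamma>"
      using \<sigma> injD[OF inj_cat] by metis
    ultimately show ?thesis unfolding * by (simp add: blinfun.zero_right)
  next
    case False
    have "coord (wpush (cat k \<alpha>) ?b (wpull (cat k \<beta>) ?b (vket h \<gamma>))) \<eta> = 0"
      unfolding shift_on_def[symmetric] by (rule coord_shift_on(2)[OF inj_on_cat False])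
    thus ?thesis unfolding * using False by (auto simp: blinfun.zero_right)
  qed
qed

lemma phi_part_entry:
  assumes C: "\<And>\<alpha> \<beta>. (\<alpha>, \<beta>) \<in> fourier_index k n ms \<Longrightarrow> C \<alpha> \<beta> \<in> bop UNIV UNIV"
  shows "coord (phi_part k n C r ms (vket h \<gamma>)) \<eta> =
    (if \<eta> \<in> words k n \<and> \<gamma> \<in> words k n \<and> degrees k ms \<eta> \<gamma> then r ^ total_degree k \<eta> \<gamma> *\<^sub>R fourier_entry k C \<eta> \<gamma> h else 0)"
proof -
  let ?t = "\<lambda>(\<alpha>, \<beta>). r ^ (\<Sum>i=1..k. length (\<alpha> i) + length (\<beta> i)) *\<^sub>R
    (if \<exists>\<sigma>\<in>words k n. cat k \<alpha> \<sigma> = \<eta> \<and> cat k \<beta> \<sigma> = \<gamma> then C \<alpha> \<beta> h else 0)"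
  have sum: "coord (phi_part k n C r ms (vket h \<gamma>)) \<eta> = (\<Sum>p\<in>fourier_index k n ms. ?t p)"
    unfolding phi_part_def blinfun.sum_left coord_sum
  proof (intro sum.cong refl)
    fix p assume p: "p \<in> fourier_index k n ms"
    obtain \<alpha> \<beta> where ab: "p = (\<alpha>, \<beta>)" by (cases p)
    have "\<alpha> \<in> words k n" "\<beta> \<in> words k n" using p ab by (auto simp: fourier_index_def)
    note t = coord_fourier_term[OF this C[OF p[unfolded ab]]]
    show "coord (blinfun_apply (case p of (\<alpha>, \<beta>) \<Rightarrow> r ^ (\<Sum>i=1..k. length (\<alpha> i) + length (\<beta> i)) *\<^sub>R
        op_vtensor (C \<alpha> \<beta>) (op_mword (id_mfock k n) k (S_op k n) \<alpha> o\<^sub>L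
          op_mword_adj (id_mfock k n) k (S_op k n) \<beta>)) (vket h \<gamma>)) \<eta> = ?t p"
      unfolding ab prod.case blinfun.scaleR_left coord_simps t ..
  qed
  show ?thesis
  proof (cases "\<eta> \<in> words k n \<and> \<gamma> \<in> words k n \<and> degrees k ms \<eta> \<gamma>")
    case True
    let ?q = "(reduced k \<eta> \<gamma>, reduced k \<gamma> \<eta>)"
    have "(\<Sum>p\<in>fourier_index k n ms. ?t p) = (\<Sum>p\<in>fourier_index k n ms.
        if p = ?q then r ^ total_degree k \<eta> \<gamma> *\<^sub>R fourier_entry k C \<eta> \<gamma> h else 0)"
    proof (intro sum.cong refl)
      fix p assume "p \<in> fourier_index k n ms"
      thus "?t p = (if p = ?q then r ^ total_degree k \<eta> \<gamma> *\<^sub>R fourier_entry k C \<eta> \<gamma> h else 0)"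
        using fourier_index_match[of \<eta> k n \<gamma> "fst p" "snd p" ms] True
        by (cases p) (auto simp: total_degree_def fourier_entry_def simp del: One_nat_def)
    qed
    also have "\<dots> = r ^ total_degree k \<eta> \<gamma> *\<^sub>R fourier_entry k C \<eta> \<gamma> h"
      using reduced_index[of \<eta> k n \<gamma> ms] True by (simp add: finite_fourier_index)
    finally show ?thesis using True sum by simp
  next
    case False
    have "?t p = 0" if p: "p \<in> fourier_index k n ms" for p
    proof -
      have "\<not> (\<exists>\<sigma>\<in>words k n. cat k (fst p) \<sigma> = \<eta> \<and> cat k (snd p) \<sigma> = \<gamma>)"
      proof
        assume ex: "\<exists>\<sigma>\<in>words k n. cat k (fst p) \<sigma> = \<eta> \<and> cat k (snd p) \<sigma> = \<gamma>"
        hence "\<eta> \<in> words k n" "\<gamma> \<in> words k n"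
          using p by (auto simp: fourier_index_def intro: cat_words)
        thus False using False ex fourier_index_match[of \<eta> k n \<gamma> "fst p" "snd p" ms] p by auto
      qed
      thus ?thesis by (auto simp: case_prod_beta)
    qed
    hence "(\<Sum>p\<in>fourier_index k n ms. ?t p) = 0" by (intro sum.neutral) blast
    thus ?thesis using sum False by (simp only: if_False)
  qed
qed

section \<open>Iterated sums\<close>

lemma zsums_unique: "zsums f s \<Longrightarrow> zsums f t \<Longrightarrow> s = t"
  unfolding zsums_def by (metis sums_unique2)

lemma zsums_bounded_linear: "bounded_linear L \<Longrightarrow> zsums f s \<Longrightarrow> zsums (\<lambda>m. L (f m)) (L s)"
  unfolding zsums_def by (metis bounded_linear.sums linear_simps(1))

lemma zsums_single: "(\<And>m. m \<noteq> m0 \<Longrightarrow> f m = 0) \<Longrightarrow> zsums f (f m0)"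
proof (cases "0 \<le> m0")
  case True
  assume z: "\<And>m. m \<noteq> m0 \<Longrightarrow> f m = 0"
  have "(\<lambda>p. f (int p)) sums (\<Sum>p\<in>{nat m0}. f (int p))"
    using True by (intro sums_finite) (auto intro: z)
  moreover have "(\<lambda>p. f (- int (Suc p))) sums (\<Sum>p\<in>{}. f (- int (Suc p)))"
    using True by (intro sums_finite) (auto intro: z)
  ultimately show ?thesis
    unfolding zsums_def using True by (intro exI[of _ "f m0"] exI[of _ 0]) auto
next
  case False
  assume z: "\<And>m. m \<noteq> m0 \<Longrightarrow> f m = 0"
  \<comment> \<open>The negative half starts at -1, so \<open>m0\<close> sits at position
    \<open>- m0 - 1\<close>.\<close>
  have "(\<lambda>p. f (- int (Suc p))) sums (\<Sum>p\<in>{nat (- m0 - 1)}. f (- int (Suc p)))"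
    using False by (intro sums_finite) (auto intro!: z)
  moreover have "- int (Suc (nat (- m0 - 1))) = m0" using False by simp
  moreover have "(\<lambda>p. f (int p)) sums (\<Sum>p\<in>{}. f (int p))"
    using False by (intro sums_finite) (auto intro: z)
  ultimately show ?thesis
    unfolding zsums_def by (intro exI[of _ 0] exI[of _ "f m0"]) auto
qed

text \<open>Each half is dominated by a geometric series; on the negative half the extra factor
  \<open>\<rho>\<close> is dropped, which gives the symmetric constant 2.\<close>

lemma zsums_bound:
  fixes f :: "int \<Rightarrow> 'a::banach"
  assumes \<rho>: "0 \<le> \<rho>" "\<rho> < 1" and f: "\<And>m. norm (f m) \<le> c * \<rho> ^ nat \<bar>m\<bar>"
  shows "\<exists>s. zsums f s \<and> norm s \<le> c * (2 / (1 - \<rho>))"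
proof -
  have c: "0 \<le> c" using order_trans[OF norm_ge_zero f[of 0]] by simp
  have sm: "summable (\<lambda>p. c * \<rho> ^ p)" "suminf (\<lambda>p. c * \<rho> ^ p) = c * (1 / (1 - \<rho>))"
    using \<rho> by (auto simp: suminf_mult suminf_geometric)
  have f1: "norm (f (int p)) \<le> c * \<rho> ^ p" for p using f[of "int p"] by simp
  have f2: "norm (f (- int (Suc p))) \<le> c * \<rho> ^ p" for p
  proof -
    have "norm (f (- int (Suc p))) \<le> c * \<rho> ^ Suc p"
      using f[of "- int (Suc p)"] by (simp add: nat_add_distrib del: of_nat_Suc)
    also have "\<dots> \<le> c * \<rho> ^ p" using \<rho> c by (intro mult_left_mono power_decreasing) auto
    finally show ?thesis .
  qed
  let ?a = "\<Sum>p. f (int p)" and ?b = "\<Sum>p. f (- int (Suc p))"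
  have "zsums f (?a + ?b)"
    unfolding zsums_def
    by (rule exI[of _ ?a], rule exI[of _ ?b])
      (intro conjI refl summable_sums summable_comparison_test'[OF sm(1)] f1 f2)
  moreover have "norm ?a \<le> c * (1 / (1 - \<rho>))" "norm ?b \<le> c * (1 / (1 - \<rho>))"
    using norm_suminf_le[OF f1 sm(1)] norm_suminf_le[OF f2 sm(1)] sm(2) by simp_all
  hence "norm (?a + ?b) \<le> c * (1 / (1 - \<rho>)) + c * (1 / (1 - \<rho>))"
    using norm_triangle_ineq[of ?a ?b] by linarith
  hence "norm (?a + ?b) \<le> c * (2 / (1 - \<rho>))" by (simp add: mult.commute)
  ultimately show ?thesis by blast
qed

lemma iterated_zsums_unique: "iterated_zsums k f s \<Longrightarrow> iterated_zsums k f t \<Longrightarrow> s = t"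
proof (induction k arbitrary: f s t)
  case (Suc k)
  then obtain g h where "\<And>m. iterated_zsums k (\<lambda>ms. f (m # ms)) (g m)" "zsums g s"
    "\<And>m. iterated_zsums k (\<lambda>ms. f (m # ms)) (h m)" "zsums h t" by auto
  moreover from this have "g = h" using Suc.IH by blast
  ultimately show ?case using zsums_unique by blast
qed simp

lemma iterated_zsums_SucI:
  "(\<And>m. iterated_zsums k (\<lambda>ms. f (m # ms)) (g m)) \<Longrightarrow> zsums g s \<Longrightarrow> iterated_zsums (Suc k) f s"
  by auto

text \<open>Applied to the bounded functional that reads one entry, this turns operator series into
  series of vectors.\<close>

lemma iterated_zsums_bounded_linear:
  assumes L: "bounded_linear L"
  shows "iterated_zsums k f s \<Longrightarrow> iterated_zsums k (\<lambda>ms. L (f ms)) (L s)"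
proof (induction k arbitrary: f s)
  case (Suc k)
  then obtain g where g: "\<And>m. iterated_zsums k (\<lambda>ms. f (m # ms)) (g m)" "zsums g s" by auto
  show ?case
    by (rule iterated_zsums_SucI[OF Suc.IH[OF g(1)] zsums_bounded_linear[OF L g(2)]])
qed simp

lemma iterated_zsums_zero: "(\<And>ms. length ms = k \<Longrightarrow> f ms = 0) \<Longrightarrow> iterated_zsums k f 0"
proof (induction k arbitrary: f)
  case (Suc k)
  have "zsums (\<lambda>m. 0 :: 'a) 0" using zsums_single[of 0 "\<lambda>m. 0 :: 'a"] by simp
  show ?case
    by (rule iterated_zsums_SucI[OF Suc.IH \<open>zsums (\<lambda>m. 0) 0\<close>]) (simp add: Suc.prems)
qed simp

lemma iterated_zsums_single:
  assumes "length ms0 = k" "\<And>ms. length ms = k \<Longrightarrow> ms \<noteq> ms0 \<Longrightarrow> f ms = 0"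
  shows "iterated_zsums k f (f ms0)"
  using assms
proof (induction k arbitrary: f ms0)
  case (Suc k)
  then obtain m0 ms1 where m: "ms0 = m0 # ms1" "length ms1 = k" by (metis length_Suc_conv)
  let ?g = "\<lambda>m. if m = m0 then f ms0 else 0"
  have "iterated_zsums k (\<lambda>ms. f (m # ms)) (?g m)" for m
  proof (cases "m = m0")
    case True
    thus ?thesis using Suc.IH[of ms1 "\<lambda>ms. f (m0 # ms)"] Suc.prems m by auto
  next
    case False
    thus ?thesis using Suc.prems m by (auto intro!: iterated_zsums_zero)
  qed
  moreover have "zsums ?g (f ms0)" using zsums_single[of m0 ?g] by simp
  ultimately show ?case by (rule iterated_zsums_SucI)
qed auto

lemma iterated_zsums_bound:
  fixes f :: "int list \<Rightarrow> 'a::banach"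
  assumes \<rho>: "0 \<le> \<rho>" "\<rho> < 1"
  shows "(\<And>ms. length ms = k \<Longrightarrow> norm (f ms) \<le> c * \<rho> ^ (\<Sum>m\<leftarrow>ms. nat \<bar>m\<bar>)) \<Longrightarrow>
    \<exists>s. iterated_zsums k f s \<and> norm s \<le> c * (2 / (1 - \<rho>)) ^ k"
proof (induction k arbitrary: f c)
  case 0
  thus ?case using 0[of "[]"] by simp
next
  case (Suc k)
  \<comment> \<open>The outer index contributes a factor that is absorbed into the constant of the
    inner sum, hence the induction over all \<open>c\<close>.\<close>
  have "\<exists>s. iterated_zsums k (\<lambda>ms. f (m # ms)) s \<and> norm s \<le> (c * \<rho> ^ nat \<bar>m\<bar>) * (2 / (1 - \<rho>)) ^ k" for m
    using Suc.prems[of "m # _"] by (intro Suc.IH) (simp add: power_add mult.assoc)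
  then obtain g where g: "\<And>m. iterated_zsums k (\<lambda>ms. f (m # ms)) (g m)"
    "\<And>m. norm (g m) \<le> (c * (2 / (1 - \<rho>)) ^ k) * \<rho> ^ nat \<bar>m\<bar>"
    by (metis (no_types) mult.assoc mult.commute)
  from zsums_bound[OF \<rho> g(2)] obtain s where
    s: "zsums g s" "norm s \<le> c * (2 / (1 - \<rho>)) ^ k * (2 / (1 - \<rho>))" by blast
  show ?case
    by (rule exI[of _ s], rule conjI[OF iterated_zsums_SucI[OF g(1) s(1)]])
      (use s(2) in \<open>simp only: power_Suc2 mult.assoc\<close>)
qed

lemma nth_map_upt_from_1: "i \<in> {1..k} \<Longrightarrow> map f [1..<Suc k] ! (i - 1) = f i"
  by (cases i) (simp_all del: upt_Suc)

text \<open>Only the multi-degree read off from the word lengths contributes to a given entry, so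
  iterated convergence in norm is enough to evaluate it; the converse direction relies on
  this.\<close>

lemma iterated_zsums_phi_entry:
  assumes C: "\<And>\<alpha> \<beta> ms. length ms = k \<Longrightarrow> (\<alpha>, \<beta>) \<in> fourier_index k n ms \<Longrightarrow> C \<alpha> \<beta> \<in> bop UNIV UNIV"
    and s: "iterated_zsums k (phi_part k n C r) s"
  shows "coord (s (vket h \<gamma>)) \<eta> =
    (if \<eta> \<in> words k n \<and> \<gamma> \<in> words k n then r ^ total_degree k \<eta> \<gamma> *\<^sub>R fourier_entry k C \<eta> \<gamma> h else 0)"
proof -
  let ?L = "\<lambda>T :: (nat \<Rightarrow> nat list, 'a) l2 op. coord (blinfun_apply T (vket h \<gamma>)) \<eta>"
  let ?ms = "map (\<lambda>i. int (length (\<gamma> i)) - int (length (\<eta> i))) [1..<Suc k]"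
  have "bounded_linear ?L"
    by (rule bounded_linear_compose[OF bounded_linear_coord blinfun.bounded_linear_left])
  from iterated_zsums_bounded_linear[OF this s]
  have 1: "iterated_zsums k (\<lambda>ms. ?L (phi_part k n C r ms)) (?L s)" .
  have nth: "?ms ! (i - 1) = int (length (\<gamma> i)) - int (length (\<eta> i))" if "i \<in> {1..k}" for i
    using that by (rule nth_map_upt_from_1)
  have deg: "degrees k ?ms \<eta> \<gamma>" using nth by (simp only: degrees_def) blast
  have "ms = ?ms" if "degrees k ms \<eta> \<gamma>" "length ms = k" for ms
  proof (rule nth_equalityI)
    fix j assume "j < length ms"
    thus "ms ! j = ?ms ! j"
      using that(1)[unfolded degrees_def, rule_format, of "Suc j"] nth[of "Suc j"] that(2) by simp
  qed (use that in \<open>simp del: upt_Suc\<close>)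
  hence "iterated_zsums k (\<lambda>ms. ?L (phi_part k n C r ms)) (?L (phi_part k n C r ?ms))"
    by (intro iterated_zsums_single) (auto simp: phi_part_entry C simp del: upt_Suc)
  from iterated_zsums_unique[OF 1 this] phi_part_entry[OF C[of ?ms], where r = r and h = h and \<gamma> = \<gamma> and \<eta> = \<eta>] deg show ?thesis
    by (simp del: upt_Suc One_nat_def)
qed

section \<open>Multi-Toeplitz operators\<close>

lemma inj_on_upd_append: "inj_on (\<lambda>\<gamma>. \<gamma>(i := \<gamma> i @ u)) W"
  by (rule inj_on_subset[OF inj_upd_append]) simp

text \<open>The right shift on the right appends \<open>t\<close> to the column, and the adjoint on
  the left reads the row with \<open>s\<close> appended.\<close>

lemma multi_toeplitz_entry_iff:
  fixes A :: "(nat \<Rightarrow> nat list, 'e::chilbert_space) l2 op"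
  assumes A: "A \<in> bop (mfock k n) (mfock k n)"
  shows "multi_toeplitz k n A \<longleftrightarrow>
    (\<forall>i\<in>{1..k}. \<forall>s\<in>{1..n i}. \<forall>t\<in>{1..n i}. \<forall>\<eta>\<in>words k n. \<forall>\<gamma>\<in>words k n. \<forall>h.
      coord (A (vket h (\<gamma>(i := \<gamma> i @ [t])))) (\<eta>(i := \<eta> i @ [s])) =
      (if s = t then coord (A (vket h \<gamma>)) \<eta> else 0))"
proof -
  have "op_vtensor id_blinfun (adj (R_op k n i s)) o\<^sub>L A o\<^sub>L op_vtensor id_blinfun (R_op k n i t)
        = (if s = t then A else 0) \<longleftrightarrow>
      (\<forall>\<eta>\<in>words k n. \<forall>\<gamma>\<in>words k n. \<forall>h.
        coord (A (vket h (\<gamma>(i := \<gamma> i @ [t])))) (\<eta>(i := \<eta> i @ [s])) =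
        (if s = t then coord (A (vket h \<gamma>)) \<eta> else 0))"
    if i: "i \<in> {1..k}" "s \<in> {1..n i}" "t \<in> {1..n i}" for i s t
  proof -
    let ?b = "\<lambda>\<sigma>. of_bool (\<sigma> \<in> words k n) :: real"
    let ?T = "op_vtensor id_blinfun (adj (R_op k n i s)) o\<^sub>L A o\<^sub>L op_vtensor id_blinfun (R_op k n i t)"
    let ?r = "\<lambda>u \<gamma>. \<gamma>(i := \<gamma> i @ u)"
    have w: "wmap (?r u) ?b" for u by (rule wmap_shift_on[OF inj_on_upd_append])
    have Rs: "op_vtensor id_blinfun (adj (R_op k n i s)) = (wpull (?r [s]) ?b :: (nat \<Rightarrow> nat list, 'e) l2 op)"
      unfolding R_op_eq[where n = n, OF i(1,2)] shift_on_def adj_wpush[OF w] by (rule op_vtensor_id[OF id_tensor_wpull[OF w]])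
    have Rt: "op_vtensor id_blinfun (R_op k n i t) = (shift_on (?r [t]) (words k n) :: (nat \<Rightarrow> nat list, 'e) l2 op)"
      unfolding R_op_eq[where n = n, OF i(1,3)] shift_on_def by (rule op_vtensor_id[OF id_tensor_wpush[OF w]])
    have T: "coord (?T (vket h \<gamma>)) \<eta> = (if \<eta> \<in> words k n \<and> \<gamma> \<in> words k n
        then coord (A (vket h (?r [t] \<gamma>))) (?r [s] \<eta>) else 0)" for h \<gamma> \<eta>
      unfolding Rs Rt
      by (simp add: coord_wpull[OF w] shift_on_vket[OF inj_on_upd_append] blinfun.zero_right)
    have A0: "coord (A (vket h \<gamma>)) \<eta> = 0" if "\<not> (\<eta> \<in> words k n \<and> \<gamma> \<in> words k n)" for h \<gamma> \<eta>
      using A that unfolding mfock_def in_bop_l2_on by auto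
    show ?thesis
    proof
      assume "?T = (if s = t then A else 0)"
      hence H: "coord (?T (vket h \<gamma>)) \<eta> = coord ((if s = t then A else 0) (vket h \<gamma>)) \<eta>" for h \<gamma> \<eta>
        by simp
      thus "\<forall>\<eta>\<in>words k n. \<forall>\<gamma>\<in>words k n. \<forall>h.
          coord (A (vket h (?r [t] \<gamma>))) (?r [s] \<eta>) = (if s = t then coord (A (vket h \<gamma>)) \<eta> else 0)"
      proof (intro ballI allI)
        fix \<eta> \<gamma> h assume "\<eta> \<in> words k n" "\<gamma> \<in> words k n"
        thus "coord (A (vket h (?r [t] \<gamma>))) (?r [s] \<eta>) = (if s = t then coord (A (vket h \<gamma>)) \<eta> else 0)"
          using H[of h \<gamma> \<eta>, unfolded T] by (cases "s = t") auto
      qed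
    next
      assume H: "\<forall>\<eta>\<in>words k n. \<forall>\<gamma>\<in>words k n. \<forall>h.
          coord (A (vket h (?r [t] \<gamma>))) (?r [s] \<eta>) = (if s = t then coord (A (vket h \<gamma>)) \<eta> else 0)"
      show "?T = (if s = t then A else 0)"
        by (rule l2_blinfun_entry_eqI, subst T) (use H A0 in auto)
    qed
  qed
  thus ?thesis using A unfolding multi_toeplitz_def by blast
qed

context
  fixes k :: nat and n :: "nat \<Rightarrow> nat" and A :: "(nat \<Rightarrow> nat list, 'e::chilbert_space) l2 op"
  assumes mt: "multi_toeplitz k n A"
begin

lemma toeplitz_bop: "A \<in> bop (mfock k n) (mfock k n)"
  using mt by (simp add: multi_toeplitz_def)

lemma toeplitz_outside: "\<not> (\<eta> \<in> words k n \<and> \<gamma> \<in> words k n) \<Longrightarrow> coord (A (vket h \<gamma>)) \<eta> = 0"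
  using toeplitz_bop unfolding mfock_def in_bop_l2_on by auto

lemma toeplitz_step:
  assumes "i \<in> {1..k}" "s \<in> {1..n i}" "t \<in> {1..n i}" "\<eta> \<in> words k n" "\<gamma> \<in> words k n"
  shows "coord (A (vket h (\<gamma>(i := \<gamma> i @ [t])))) (\<eta>(i := \<eta> i @ [s])) =
      (if s = t then coord (A (vket h \<gamma>)) \<eta> else 0)"
  using mt multi_toeplitz_entry_iff[OF toeplitz_bop] assms by blast

lemma toeplitz_append:
  assumes i: "i \<in> {1..k}" and w: "\<eta> \<in> words k n" "\<gamma> \<in> words k n"
  shows "u \<in> lists {1..n i} \<Longrightarrow>
    coord (A (vket h (\<gamma>(i := \<gamma> i @ u)))) (\<eta>(i := \<eta> i @ u)) = coord (A (vket h \<gamma>)) \<eta>"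
proof (induction u rule: rev_induct)
  case (snoc s u)
  hence su: "s \<in> {1..n i}" "u \<in> lists {1..n i}" by auto
  from toeplitz_step[OF i su(1) su(1) words_append[where n = n, OF w(1) i su(2)] words_append[where n = n, OF w(2) i su(2)], of h]
  show ?case using snoc.IH[OF su(2)] by (simp add: fun_upd_def cong: if_cong)
qed simp

lemma toeplitz_cat:
  assumes a: "\<alpha> \<in> words k n" "\<beta> \<in> words k n" "\<sigma> \<in> words k n"
  shows "coord (A (vket h (cat k \<beta> \<sigma>))) (cat k \<alpha> \<sigma>) = coord (A (vket h \<beta>)) \<alpha>"
proof -
  \<comment> \<open>Appends \<open>\<sigma>\<close> in the components up to \<open>m\<close> only,
    so that the components can be treated one at a time.\<close>
  define c where "c = (\<lambda>m (\<alpha> :: nat \<Rightarrow> nat list) l. if l \<in> {1..m} then \<alpha> l @ \<sigma> l else \<alpha> l)"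
  have c_Suc: "c (Suc m) \<alpha> = (c m \<alpha>)(Suc m := c m \<alpha> (Suc m) @ \<sigma> (Suc m))" for m \<alpha>
    by (auto simp: c_def)
  have "m \<le> k \<Longrightarrow> c m \<alpha> \<in> words k n \<and> c m \<beta> \<in> words k n \<and>
      coord (A (vket h (c m \<beta>))) (c m \<alpha>) = coord (A (vket h \<beta>)) \<alpha>" for m
  proof (induction m)
    case 0
    have "c 0 \<alpha> = \<alpha>" for \<alpha> unfolding c_def by (rule ext) simp
    thus ?case using a by simp
  next
    case (Suc m)
    have i: "Suc m \<in> {1..k}" using Suc.prems by simp
    note s = words_mem[OF a(3) i]
    from Suc have w: "c m \<alpha> \<in> words k n" "c m \<beta> \<in> words k n"
      and eq: "coord (A (vket h (c m \<beta>))) (c m \<alpha>) = coord (A (vket h \<beta>)) \<alpha>" by auto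
    show ?case
      unfolding c_Suc
      by (intro conjI words_append w i s) (simp only: toeplitz_append[OF i w s] eq)
  qed
  moreover have "c k \<alpha> = cat k \<alpha> \<sigma>" if "\<alpha> \<in> words k n" for \<alpha>
    using words_extensional[OF that] words_extensional[OF a(3)] by (auto simp: c_def cat_def extensional_def)
  ultimately show ?thesis using a by (metis order_refl)
qed

text \<open>In a component where neither word is a suffix of the other, remove the longest common
  suffix; the words now end in different letters, and the Toeplitz relation for distinct letters
  gives 0.\<close>

lemma toeplitz_incomparable:
  assumes w: "\<eta> \<in> words k n" "\<gamma> \<in> words k n" and nc: "\<not> comparable_words k \<eta> \<gamma>"
  shows "coord (A (vket h \<gamma>)) \<eta> = 0"
proof -
  obtain i where i: "i \<in> {1..k}" "\<not> comparable (\<eta> i) (\<gamma> i)"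
    using nc by (auto simp: comparable_words_def)
  from i(2) obtain a b s t u where e: "\<eta> i = a @ s # u" "\<gamma> i = b @ t # u" "s \<noteq> t"
    by (rule not_comparableE)
  have l: "a \<in> lists {1..n i}" "b \<in> lists {1..n i}" "u \<in> lists {1..n i}" "s \<in> {1..n i}" "t \<in> {1..n i}"
    using words_mem[OF w(1) i(1)] words_mem[OF w(2) i(1)] by (auto simp: e)
  have ab: "\<eta>(i := a) \<in> words k n" "\<gamma>(i := b) \<in> words k n"
    using words_upd w i(1) l by blast+
  have ab1: "\<eta>(i := a @ [s]) \<in> words k n" "\<gamma>(i := b @ [t]) \<in> words k n"
    using words_append[OF ab(1) i(1), of "[s]"] words_append[OF ab(2) i(1), of "[t]"] l by auto
  have "\<eta> = (\<eta>(i := a @ [s]))(i := (\<eta>(i := a @ [s])) i @ u)" "\<gamma> = (\<gamma>(i := b @ [t]))(i := (\<gamma>(i := b @ [t])) i @ u)"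
    using e by (auto simp: fun_eq_iff)
  hence "coord (A (vket h \<gamma>)) \<eta> = coord (A (vket h (\<gamma>(i := b @ [t])))) (\<eta>(i := a @ [s]))"
    using toeplitz_append[OF i(1) ab1 l(3), of h] by metis
  also have "\<dots> = 0"
    using toeplitz_step[OF i(1) l(4,5) ab, of h] e(3) by simp
  finally show ?thesis .
qed

lemma toeplitz_cong:
  assumes w: "\<eta> \<in> words k n" "\<gamma> \<in> words k n" and c: "comparable_words k \<eta> \<gamma>"
  shows "coord (A (vket h \<gamma>)) \<eta> = coord (A (vket h (reduced k \<gamma> \<eta>))) (reduced k \<eta> \<gamma>)"
proof -
  let ?ms = "map (\<lambda>i. int (length (\<gamma> i)) - int (length (\<eta> i))) [1..<Suc k]"
  have d: "degrees k ?ms \<eta> \<gamma>" unfolding degrees_def using nth_map_upt_from_1 by blast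
  obtain \<sigma> where "\<sigma> \<in> words k n" "cat k (reduced k \<eta> \<gamma>) \<sigma> = \<eta>" "cat k (reduced k \<gamma> \<eta>) \<sigma> = \<gamma>"
    using fourier_index_match[OF w reduced_index[OF w d]] d c by blast
  thus ?thesis using toeplitz_cat[OF reduced_words[OF w(1)] reduced_words[OF w(2)]] by metis
qed

end

section \<open>Fourier coefficients as reduced entries, and homogeneous parts\<close>

lemma has_fourier_series_iff:
  "has_fourier_series k n A C \<longleftrightarrow> (\<forall>ms \<alpha> \<beta> h. length ms = k \<longrightarrow> (\<alpha>, \<beta>) \<in> fourier_index k n ms \<longrightarrow>
    C \<alpha> \<beta> h = coord (A (vket h \<beta>)) \<alpha>)"
proof -
  have mcong: "mtensor k x = mtensor k y" if "\<And>i. i \<in> {1..k} \<Longrightarrow> x i = y i" for x y :: "nat \<Rightarrow> (nat list, complex) l2"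
    by (rule l2_eqI) (use that in \<open>auto simp: mtensor.rep_eq intro!: prod.cong\<close>)
  \<comment> \<open>In a nonnegative degree \<open>\<alpha> i\<close> is empty, in a negative one
    \<open>\<beta> i\<close> is, so both case distinctions just select the components of
    \<open>\<beta>\<close> and \<open>\<alpha>\<close>.\<close>
  have "mtensor k (\<lambda>i. if 0 \<le> ms ! (i - 1) then ket (\<beta> i) else ket []) = ket \<beta> \<and>
      mtensor k (\<lambda>i. if 0 \<le> ms ! (i - 1) then ket [] else ket (\<alpha> i)) = ket \<alpha>"
    if "(\<alpha>, \<beta>) \<in> fourier_index k n ms" for \<alpha> \<beta> ms
  proof -
    have w: "\<alpha> \<in> words k n" "\<beta> \<in> words k n" using that by (auto simp: fourier_index_def)
    have l: "length (\<alpha> i) = nat (- (ms ! (i - 1)))" "length (\<beta> i) = nat (ms ! (i - 1))"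
      if "i \<in> {1..k}" for i using that \<open>(\<alpha>, \<beta>) \<in> _\<close> by (auto simp: fourier_index_def)
    have "mtensor k (\<lambda>i. if 0 \<le> ms ! (i - 1) then ket (\<beta> i) else ket []) = mtensor k (\<lambda>i. ket (\<beta> i))"
      by (rule mcong) (use l(2) in \<open>fastforce simp del: One_nat_def\<close>)
    moreover have "mtensor k (\<lambda>i. if 0 \<le> ms ! (i - 1) then ket [] else ket (\<alpha> i)) = mtensor k (\<lambda>i. ket (\<alpha> i))"
      by (rule mcong) (use l(1) in \<open>fastforce simp del: One_nat_def\<close>)
    ultimately show ?thesis
      by (simp only: mtensor_ket[OF words_extensional[OF w(1)]] mtensor_ket[OF words_extensional[OF w(2)]])
  qed
  hence "has_fourier_series k n A C \<longleftrightarrow> (\<forall>ms. length ms = k \<longrightarrow> (\<forall>(\<alpha>, \<beta>)\<in>fourier_index k n ms.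
      \<forall>h l. cinner (C \<alpha> \<beta> h) l = cinner (coord (A (vket h \<beta>)) \<alpha>) l))"
    unfolding has_fourier_series_def
    by (intro all_cong1 imp_cong refl ball_cong) (auto simp: cinner_vket simp del: One_nat_def)
  also have "\<dots> \<longleftrightarrow> (\<forall>ms \<alpha> \<beta> h. length ms = k \<longrightarrow> (\<alpha>, \<beta>) \<in> fourier_index k n ms \<longrightarrow>
      C \<alpha> \<beta> h = coord (A (vket h \<beta>)) \<alpha>)"
  proof -
    have "(\<forall>l. cinner x l = cinner y l) \<longleftrightarrow> x = y" for x y :: 'a
      using cinner_eqI by blast
    thus ?thesis by (simp add: Ball_def split_paired_All)
  qed
  finally show ?thesis .
qed

lemma fourier_degrees:
  "degrees k (map (\<lambda>i. int (length (\<gamma> i)) - int (length (\<eta> i))) [1..<Suc k]) \<eta> \<gamma>"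
  "length (map (\<lambda>i. int (length (\<gamma> i)) - int (length (\<eta> i))) [1..<Suc k]) = k"
  unfolding degrees_def using nth_map_upt_from_1 by (blast, simp)

lemma toeplitz_fourier_entry:
  assumes mt: "multi_toeplitz k n A" and fs: "has_fourier_series k n A C"
    and w: "\<eta> \<in> words k n" "\<gamma> \<in> words k n"
  shows "coord (A (vket h \<gamma>)) \<eta> = fourier_entry k C \<eta> \<gamma> h"
  using toeplitz_incomparable[OF mt w, of h] toeplitz_cong[OF mt w, of h]
    fs[unfolded has_fourier_series_iff] reduced_index[OF w fourier_degrees(1)] fourier_degrees(2)[of \<gamma> \<eta> k]
  unfolding fourier_entry_def by metis

text \<open>In a fixed multi-degree the lengths of the row determine those of the column. Grouping
  rows by lengths therefore splits \<open>T\<close> into compressions of \<open>q A\<close> with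
  disjoint sets of columns, and the squared norms add up.\<close>

lemma homogeneous_part_norm:
  fixes A T :: "(nat \<Rightarrow> nat list, 'e::chilbert_space) l2 op"
  assumes q: "0 \<le> q"
    and T: "\<And>h \<gamma> \<eta>. coord (T (vket h \<gamma>)) \<eta> =
      (if \<eta> \<in> W \<and> \<gamma> \<in> W \<and> degrees k ms \<eta> \<gamma> then q *\<^sub>R coord (A (vket h \<gamma>)) \<eta> else 0)"
  shows "norm T \<le> q * norm A"
proof (rule norm_blinfun_bound)
  fix x :: "(nat \<Rightarrow> nat list, 'e) l2"
  \<comment> \<open>\<open>L \<eta>\<close> is the length profile of a row and \<open>E d\<close>
    the set of columns that rows of profile \<open>d\<close> can see. Restricting the profile to
    \<open>{1..k}\<close> makes it determined by its values there.\<close>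
  define L where "L = (\<lambda>\<eta> :: nat \<Rightarrow> nat list. (\<lambda>i\<in>{1..k}. length (\<eta> i)))"
  define E where "E = (\<lambda>d. {\<gamma>\<in>W. \<forall>i\<in>{1..k}. ms ! (i - 1) = int (length (\<gamma> i)) - int (d i)})"
  \<comment> \<open>Row \<open>\<eta>\<close> of \<open>T\<close> agrees with that of
    \<open>q A\<close> after projecting \<open>x\<close> to the visible columns.\<close>
  have T0: "coord (T x) \<eta> = (if \<eta> \<in> W then q *\<^sub>R coord (A (id_on (E (L \<eta>)) x)) \<eta> else 0)" for \<eta> x
  proof (rule l2_ext[where f = "\<lambda>x. coord (T x) \<eta>" and
        g = "\<lambda>x. if \<eta> \<in> W then q *\<^sub>R coord (A (id_on (E (L \<eta>)) x)) \<eta> else 0"])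
    show "bounded_linear (\<lambda>x. coord (T x) \<eta>)"
      by (rule bounded_linear_compose[OF bounded_linear_coord blinfun.bounded_linear_right])
    have "bounded_linear (\<lambda>x. coord (A (id_on (E (L \<eta>)) x)) \<eta>)"
      by (intro bounded_linear_compose[OF bounded_linear_coord]
        bounded_linear_compose[OF blinfun.bounded_linear_right] blinfun.bounded_linear_right)
    thus "bounded_linear (\<lambda>x. if \<eta> \<in> W then q *\<^sub>R coord (A (id_on (E (L \<eta>)) x)) \<eta> else 0)"
      using bounded_linear_compose[OF bounded_linear_scaleR_right] by (cases "\<eta> \<in> W") auto
    fix h \<gamma>
    have "\<gamma> \<in> E (L \<eta>) \<longleftrightarrow> \<gamma> \<in> W \<and> degrees k ms \<eta> \<gamma>"
      by (auto simp: E_def L_def degrees_def)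
    thus "coord (T (vket h \<gamma>)) \<eta> = (if \<eta> \<in> W then q *\<^sub>R coord (A (id_on (E (L \<eta>)) (vket h \<gamma>))) \<eta> else 0)"
      by (simp add: T id_on_vket blinfun.zero_right)
  qed
  show "norm (T x) \<le> q * norm A * norm x"
  proof (rule norm_l2_le_sq)
    fix F :: "(nat \<Rightarrow> nat list) set" assume F: "finite F"
    have "(\<Sum>\<eta>\<in>F. (norm (coord (T x) \<eta>))\<^sup>2) \<le> (\<Sum>\<eta>\<in>F. (q * norm (coord (A (id_on (E (L \<eta>)) x)) \<eta>))\<^sup>2)"
      using q by (intro sum_mono) (simp add: T0)
    also have "\<dots> = (\<Sum>d\<in>L ` F. \<Sum>\<eta>\<in>{\<eta>\<in>F. L \<eta> = d}. (q * norm (coord (A (id_on (E (L \<eta>)) x)) \<eta>))\<^sup>2)"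
      by (rule sum.image_gen[OF F])
    also have "\<dots> = (\<Sum>d\<in>L ` F. q\<^sup>2 * (\<Sum>\<eta>\<in>{\<eta>\<in>F. L \<eta> = d}. (norm (coord (A (id_on (E d) x)) \<eta>))\<^sup>2))"
      by (simp add: sum_distrib_left power_mult_distrib)
    also have "\<dots> \<le> (\<Sum>d\<in>L ` F. q\<^sup>2 * ((norm A)\<^sup>2 * (norm (id_on (E d) x))\<^sup>2))"
    proof (intro sum_mono mult_left_mono)
      fix d
      have "(\<Sum>\<eta>\<in>{\<eta>\<in>F. L \<eta> = d}. (norm (coord (A (id_on (E d) x)) \<eta>))\<^sup>2) \<le> (norm (A (id_on (E d) x)))\<^sup>2"
        using F by (intro sum_coord_sq_le) auto
      also have "\<dots> \<le> (norm A * norm (id_on (E d) x))\<^sup>2"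
        by (intro power_mono norm_blinfun) auto
      finally show "(\<Sum>\<eta>\<in>{\<eta>\<in>F. L \<eta> = d}. (norm (coord (A (id_on (E d) x)) \<eta>))\<^sup>2)
          \<le> (norm A)\<^sup>2 * (norm (id_on (E d) x))\<^sup>2"
        by (simp add: power_mult_distrib)
    qed simp
    also have "\<dots> = q\<^sup>2 * (norm A)\<^sup>2 * (\<Sum>d\<in>L ` F. (norm (l2_restrict (E d) x))\<^sup>2)"
      by (simp add: sum_distrib_left mult.assoc id_on.rep_eq)
    also have "\<dots> \<le> q\<^sup>2 * (norm A)\<^sup>2 * (norm x)\<^sup>2"
    proof (intro mult_left_mono sum_norm_restrict_le)
      show "disjoint_family_on E (L ` F)"
        unfolding disjoint_family_on_def
      proof (intro ballI impI)
        fix d d' assume d: "d \<in> L ` F" "d' \<in> L ` F" "d \<noteq> d'"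
        have "d = d'" if "\<gamma> \<in> E d" "\<gamma> \<in> E d'" for \<gamma>
        proof (rule extensionalityI)
          show "d \<in> extensional {1..k}" "d' \<in> extensional {1..k}" using d by (auto simp: L_def)
          fix i assume "i \<in> {1..k}"
          with that have "int (length (\<gamma> i)) - int (d i) = int (length (\<gamma> i)) - int (d' i)"
            unfolding E_def by force
          thus "d i = d' i" by simp
        qed
        thus "E d \<inter> E d' = {}" using d(3) by blast
      qed
    qed (use F in auto)
    finally show "(\<Sum>\<eta>\<in>F. (norm (coord (T x) \<eta>))\<^sup>2) \<le> (q * norm A * norm x)\<^sup>2"
      by (simp add: power_mult_distrib mult.assoc)
  qed (use q in simp)
qed (use q in simp)

text \<open>In each component one stripped word is empty and the other has the absolute value of the
  degree as its length.\<close>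

lemma total_degree_eq:
  assumes "degrees k ms \<eta> \<gamma>" "length ms = k"
  shows "total_degree k \<eta> \<gamma> = (\<Sum>m\<leftarrow>ms. nat \<bar>m\<bar>)"
proof -
  have "total_degree k \<eta> \<gamma> = (\<Sum>i=1..k. nat \<bar>ms ! (i - 1)\<bar>)"
    unfolding total_degree_def
    using assms(1) by (intro sum.cong refl) (auto simp: reduced_def strip_common_def degrees_def)
  also have "\<dots> = (\<Sum>j=0..<k. nat \<bar>ms ! j\<bar>)"
    by (rule sum.reindex_bij_witness[of _ Suc "\<lambda>i. i - 1"]) auto
  also have "\<dots> = (\<Sum>m\<leftarrow>ms. nat \<bar>m\<bar>)"
    using assms(2) by (simp add: sum_list_sum_nth)
  finally show ?thesis .
qed

lemma norm_phi_part_le: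
  assumes mt: "multi_toeplitz k n A" and fs: "has_fourier_series k n A C"
    and C: "\<And>\<alpha> \<beta>. (\<alpha>, \<beta>) \<in> fourier_index k n ms \<Longrightarrow> C \<alpha> \<beta> \<in> bop UNIV UNIV"
    and ms: "length ms = k" and r: "0 \<le> r"
  shows "norm (phi_part k n C r ms) \<le> norm A * r ^ (\<Sum>m\<leftarrow>ms. nat \<bar>m\<bar>)"
  unfolding mult.commute[of "norm A"]
  by (rule homogeneous_part_norm[where W = "words k n"])
    (auto simp: r phi_part_entry[OF C] total_degree_eq[OF _ ms] toeplitz_fourier_entry[OF mt fs])

section \<open>The Berezin kernel\<close>

definition diag :: "('w \<Rightarrow> real) \<Rightarrow> ('w, complex) l2 op" where
  "diag d = wpull (\<lambda>w. w) d"

lemma wmap_diag: "(\<And>w. 0 \<le> d w \<and> d w \<le> 1) \<Longrightarrow> wmap (\<lambda>w. w) d"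
  by (rule wmap_inj) (auto simp: abs_le_iff intro: order_trans[of _ 0])

lemma coord_diag: "(\<And>w. 0 \<le> d w \<and> d w \<le> 1) \<Longrightarrow> coord (diag d x) w = d w *\<^sub>R coord x w"
  unfolding diag_def by (rule coord_wpull[OF wmap_diag])

lemma diag_ket:
  assumes "\<And>w. 0 \<le> d w \<and> d w \<le> 1"
  shows "diag d (ket w) = d w *\<^sub>R ket w"
  by (rule l2_eqI) (simp add: coord_diag[OF assms] ket.rep_eq)

text \<open>The operator is the square of the diagonal operator with entries
  \<open>sqrt (d w)\<close>, which is self-adjoint because it is both a pull and a push.\<close>

lemma pos_diag:
  assumes d: "\<And>w. 0 \<le> d w \<and> d w \<le> 1"
  shows "pos_op (diag d)"
proof -
  let ?e = "\<lambda>w. sqrt (d w)"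
  have e: "0 \<le> ?e w \<and> ?e w \<le> 1" for w using d by simp
  have push: "diag ?e = wpush (\<lambda>w. w) ?e"
    by (rule l2_blinfun_entry_eqI)
      (simp add: coord_diag[OF e] wpush_vket[OF wmap_diag[OF e]] coord_vket)
  have "cinner (diag d x) x = complex_of_real ((norm (diag ?e x))\<^sup>2)" for x
  proof -
    have "diag d x = diag ?e (diag ?e x)"
      using d by (intro l2_eqI) (simp add: coord_diag[OF d] coord_diag[OF e])
    also have "cinner \<dots> x = cinner (diag ?e x) (diag ?e x)"
      unfolding push cinner_wpush[OF wmap_diag[OF e]] unfolding push[symmetric] by (simp add: diag_def)
    finally show ?thesis by (simp add: cinner_self)
  qed
  moreover have "diag d \<in> bop UNIV UNIV"
    unfolding diag_def by (rule wpull_bop[OF wmap_diag[OF d]])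
  ultimately show ?thesis
    unfolding pos_op_def by (metis zero_le_power2)
qed

text \<open>Uniqueness of the positive square root on an eigenvector. For \<open>d > 0\<close> the
  defect \<open>y\<close> of the claim satisfies \<open>Q y = - (d *\<^sub>R y)\<close>, which
  positivity allows only for \<open>y = 0\<close>.\<close>

lemma pos_sqrt_ket:
  fixes Q :: "'h::chilbert_space op"
  assumes Q: "pos_op Q" and e: "Q (Q e) = d\<^sup>2 *\<^sub>R e" and d: "0 \<le> d"
  shows "Q e = d *\<^sub>R e"
proof (cases "d = 0")
  case False
  define y where "y = Q e - d *\<^sub>R e"
  have "Q y = - (d *\<^sub>R y)"
    by (simp add: y_def blinfun.diff_right blinfun.scaleR_right e power2_eq_square scaleR_diff_right)
  hence "cinner (Q y) y = complex_of_real (- d * (norm y)\<^sup>2)"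
    using cinner_scaleR_left[of "- d" y y] by (simp add: cinner_self)
  moreover obtain c where "c \<ge> 0" "cinner (Q y) y = complex_of_real c"
    using Q by (auto simp: pos_op_def)
  ultimately have "- d * (norm y)\<^sup>2 \<ge> 0" by (metis of_real_eq_iff)
  hence "y = 0" using d False by (simp add: mult_le_0_iff)
  thus ?thesis by (simp add: y_def)
next
  case True
  \<comment> \<open>Since \<open>Q\<close> maps \<open>e + t Q e\<close> to \<open>Q e\<close>, positivity fails for large negative \<open>t\<close> unless \<open>Q e = 0\<close>.\<close>
  have "Q e = 0"
  proof (rule ccontr)
    assume nz: "Q e \<noteq> 0"
    obtain c where c: "cinner (Q e) e = complex_of_real c" using Q by (auto simp: pos_op_def)
    define t where "t = - (c + 1) / (norm (Q e))\<^sup>2"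
    have "Q (e + t *\<^sub>R Q e) = Q e"
      by (simp add: blinfun.add_right blinfun.scaleR_right e True)
    moreover have "cinner (Q e) (e + t *\<^sub>R Q e) = complex_of_real (c + t * (norm (Q e))\<^sup>2)"
      by (simp add: cinner_add_right cinner_scaleR_right c cinner_self)
    moreover have "c + t * (norm (Q e))\<^sup>2 = -1" using nz by (simp add: t_def)
    moreover obtain c' where "c' \<ge> 0" "cinner (Q (e + t *\<^sub>R Q e)) (e + t *\<^sub>R Q e) = complex_of_real c'"
      using Q by (auto simp: pos_op_def)
    ultimately have "complex_of_real c' = complex_of_real (-1)" by simp
    thus False using \<open>c' \<ge> 0\<close> unfolding of_real_eq_iff by simp
  qed
  thus ?thesis using True by simp
qed

text \<open>Every ket is an eigenvector of the square, so a positive root is forced on all kets and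
  hence everywhere.\<close>

lemma sqrt_op_diag:
  assumes d: "\<And>w. 0 \<le> d w \<and> d w \<le> 1"
  shows "sqrt_op (diag (\<lambda>w. (d w)\<^sup>2)) = diag d"
proof -
  have d2: "0 \<le> (d w)\<^sup>2 \<and> (d w)\<^sup>2 \<le> 1" for w using d[of w] by (simp add: power_le_one)
  show ?thesis
    unfolding sqrt_op_def
  proof (rule the_equality)
    have "diag d o\<^sub>L diag d = diag (\<lambda>w. (d w)\<^sup>2)"
      by (rule blinfun_eqI, rule l2_eqI) (simp add: coord_diag[OF d] coord_diag[OF d2], simp add: power2_eq_square)
    thus "pos_op (diag d) \<and> diag d o\<^sub>L diag d = diag (\<lambda>w. (d w)\<^sup>2)"
      using pos_diag[of d, OF d] by blast
    fix Q assume Q: "pos_op Q \<and> Q o\<^sub>L Q = diag (\<lambda>w. (d w)\<^sup>2)"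
    have "Q (Q x) = diag (\<lambda>w. (d w)\<^sup>2) x" for x
      using Q by (metis blinfun_apply_blinfun_compose)
    hence "Q (ket w) = diag d (ket w)" for w
      using pos_sqrt_ket[of Q "ket w" "d w"] Q d[of w] by (simp add: diag_ket[OF d] diag_ket[OF d2])
    thus "Q = diag d"
      using Q pos_diag[of d, OF d] by (intro complex_l2_blinfun_eqI) (auto simp: pos_op_def)
  qed
qed

section \<open>Defect operator of the scaled shifts\<close>

lemma scaled_S_op:
  assumes i: "i \<in> {1..k}" and j: "j \<in> {1..n i}" and r: "0 \<le> r" "r \<le> 1"
  shows "r *\<^sub>R S_op k n i j = wpush (\<lambda>\<gamma>. \<gamma>(i := [j] @ \<gamma> i)) (\<lambda>\<gamma>. r ^ 1 * of_bool (\<gamma> \<in> words k n))"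
proof (rule l2_blinfun_eqI)
  fix h \<gamma>
  have inj: "inj_on (\<lambda>\<gamma>. \<gamma>(i := j # \<gamma> i)) (words k n)"
    using inj_on_subset[OF inj_upd_prepend[of i "[j]"]] by simp
  show "blinfun_apply (r *\<^sub>R S_op k n i j) (vket h \<gamma>) =
      wpush (\<lambda>\<gamma>. \<gamma>(i := [j] @ \<gamma> i)) (\<lambda>\<gamma>. r ^ 1 * of_bool (\<gamma> \<in> words k n)) (vket h \<gamma>)"
    unfolding wpush_vket[OF wmap_scaled_inj[OF inj_upd_prepend r]] S_op_eq[where n = n, OF i j]
    by (simp add: blinfun.scaleR_left shift_on_vket[OF inj] vket_linear)
qed

text \<open>Each summand strips the letter \<open>j\<close> from the front of component
  \<open>i\<close>, applies \<open>d\<close>, and puts the letter back. Only the actual first letter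
  survives in the sum, so diagonal operators are mapped to diagonal operators.\<close>

lemma Phi_map_diag:
  assumes i: "i \<in> {1..k}" and r: "0 \<le> r" "r \<le> 1" and d: "\<And>w. 0 \<le> d w \<and> d w \<le> 1"
  shows "coord (Phi_map n (\<lambda>i j. r *\<^sub>R S_op k n i j) i (diag d) x) \<eta> =
    (if \<eta> \<in> words k n \<and> \<eta> i \<noteq> [] then (r\<^sup>2 * d (\<eta>(i := tl (\<eta> i)))) *\<^sub>R coord x \<eta> else 0)"
proof -
  let ?X = "\<lambda>j. r *\<^sub>R S_op k n i j"
  have t: "coord ((?X j o\<^sub>L diag d o\<^sub>L adj (?X j)) x) \<eta> =
      (if j = hd (\<eta> i) then if \<eta> \<in> words k n \<and> \<eta> i \<noteq> [] then (r\<^sup>2 * d (\<eta>(i := tl (\<eta> i)))) *\<^sub>R coord x \<eta> else 0 else 0)"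
    if j: "j \<in> {1..n i}" for j
  proof -
    let ?p = "\<lambda>\<gamma> :: nat \<Rightarrow> nat list. \<gamma>(i := [j] @ \<gamma> i)" and ?c = "\<lambda>\<gamma>. r ^ 1 * of_bool (\<gamma> \<in> words k n)"
    note w = wmap_scaled_inj[OF inj_upd_prepend r]
    have eq: "?X j = wpush ?p ?c" "adj (?X j) = wpull ?p ?c"
      unfolding scaled_S_op[where n = n, OF i j r] by (rule refl, rule adj_wpush[OF w])
    let ?y = "diag d (wpull ?p ?c x)"
    have y: "coord ?y \<gamma> = (d \<gamma> * ?c \<gamma>) *\<^sub>R coord x (?p \<gamma>)" for \<gamma>
      unfolding coord_diag[OF d] coord_wpull[OF w] by simp
    have main: "coord ((?X j o\<^sub>L diag d o\<^sub>L adj (?X j)) x) \<eta> = coord (wpush ?p ?c ?y) \<eta>"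
      unfolding eq(2) unfolding eq(1) by simp
    show ?thesis
    \<comment> \<open>\<open>r = 0\<close> is separated because then the support of the weight
      \<open>?c\<close> is empty.\<close>
    proof (cases "\<eta> \<in> words k n \<and> \<eta> i \<noteq> [] \<and> j = hd (\<eta> i) \<and> r \<noteq> 0")
      case True
      define \<gamma> where "\<gamma> = \<eta>(i := tl (\<eta> i))"
      have \<gamma>: "\<gamma> \<in> words k n" "?p \<gamma> = \<eta>"
        using True words_mem[OF _ i, of \<eta> n] by (auto simp: \<gamma>_def intro!: words_upd i dest: list.set_sel(2))
      have "coord (wpush ?p ?c ?y) (?p \<gamma>) = ?c \<gamma> *\<^sub>R coord ?y \<gamma>"
        by (rule coord_wpush_inj[OF w injD[OF inj_upd_prepend[where i = i and u = "[j]"]]]) (use True \<gamma>(1) in auto)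
      hence "coord (wpush ?p ?c ?y) \<eta> = ?c \<gamma> *\<^sub>R (d \<gamma> * ?c \<gamma>) *\<^sub>R coord x \<eta>"
        unfolding y \<gamma>(2) .
      thus ?thesis
        unfolding main using True \<gamma>(1) by (simp add: power2_eq_square mult_ac flip: \<gamma>_def)
    next
      case False
      have "coord (wpush ?p ?c ?y) \<eta> = 0" if "r \<noteq> 0"
      proof (rule coord_wpush_eq_0[OF w])
        fix \<gamma> assume "?c \<gamma> \<noteq> 0"
        hence "?p \<gamma> \<in> words k n" using words_prepend[where n = n, OF _ i, of \<gamma> "[j]"] j by (auto split: if_splits)
        thus "?p \<gamma> \<noteq> \<eta>" using False that by auto
      qed
      moreover have "coord (wpush ?p ?c ?y) \<eta> = 0" if "r = 0"
        by (rule coord_wpush_eq_0[OF w]) (use that in simp)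
      ultimately have "coord (wpush ?p ?c ?y) \<eta> = 0" by blast
      thus ?thesis unfolding main using False by (simp only:) auto
    qed
  qed
  have "coord (Phi_map n (\<lambda>i j. r *\<^sub>R S_op k n i j) i (diag d) x) \<eta> =
      (\<Sum>j=1..n i. if j = hd (\<eta> i) then if \<eta> \<in> words k n \<and> \<eta> i \<noteq> [] then (r\<^sup>2 * d (\<eta>(i := tl (\<eta> i)))) *\<^sub>R coord x \<eta> else 0 else 0)"
    unfolding Phi_map_def blinfun.sum_left coord_sum by (intro sum.cong refl t)
  also have "\<dots> = (if \<eta> \<in> words k n \<and> \<eta> i \<noteq> [] then (r\<^sup>2 * d (\<eta>(i := tl (\<eta> i)))) *\<^sub>R coord x \<eta> else 0)"
  proof (cases "\<eta> \<in> words k n \<and> \<eta> i \<noteq> []")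
    case True
    hence "hd (\<eta> i) \<in> {1..n i}" using words_mem[OF _ i, of \<eta> n] by (cases "\<eta> i") auto
    thus ?thesis using True by (simp add: sum.delta)
  qed auto
  finally show ?thesis .
qed

text \<open>With \<open>q\<close> equal to 1 - r^2 these are the diagonal entries of the defect
  operator, with the square root of that number those of its square root; \<open>I\<close> collects
  the components already treated.\<close>

definition delta_weight :: "nat \<Rightarrow> (nat \<Rightarrow> nat) \<Rightarrow> real \<Rightarrow> nat set \<Rightarrow> (nat \<Rightarrow> nat list) \<Rightarrow> real" where
  "delta_weight k n q I \<gamma> = of_bool (\<gamma> \<in> words k n) * (\<Prod>i\<in>I. if \<gamma> i = [] then 1 else q)"

lemma delta_weight_bounds: "0 \<le> q \<Longrightarrow> q \<le> 1 \<Longrightarrow> 0 \<le> delta_weight k n q I \<gamma> \<and> delta_weight k n q I \<gamma> \<le> 1"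
  unfolding delta_weight_def by (auto intro!: mult_le_one prod_nonneg prod_le_1)

text \<open>The weight for the earlier components does not depend on component \<open>i\<close>, so
  subtracting \<open>Phi_map\<close> multiplies it by 1 - r^2 where that word is nonempty and leaves
  it alone elsewhere.\<close>

lemma foldr_Delta:
  assumes r: "0 \<le> r" "r \<le> 1" and "distinct is" "set is \<subseteq> {1..k}"
  shows "foldr (\<lambda>i G. (\<lambda>Y. Y - Phi_map n (\<lambda>i j. r *\<^sub>R S_op k n i j) i Y) \<circ> G) is id (id_mfock k n) =
    diag (delta_weight k n (1 - r\<^sup>2) (set is))"
  using assms(3,4)
proof (induction "is")
  case Nil
  have "delta_weight k n (1 - r\<^sup>2) {} = (\<lambda>w. of_bool (w \<in> words k n))"
    by (rule ext) (simp add: delta_weight_def)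
  thus ?case by (simp add: diag_def id_on_wpull)
next
  case (Cons i "is")
  hence i: "i \<in> {1..k}" "i \<notin> set is" by auto
  have q: "0 \<le> 1 - r\<^sup>2" "1 - r\<^sup>2 \<le> 1" using r by (auto simp: power_le_one)
  note b = delta_weight_bounds[OF q]
  let ?d = "delta_weight k n (1 - r\<^sup>2)"
  have "diag (?d (set is)) - Phi_map n (\<lambda>i j. r *\<^sub>R S_op k n i j) i (diag (?d (set is))) = diag (?d (set (i # is)))"
  proof (rule blinfun_eqI, rule l2_eqI)
    fix x \<eta>
    have "?d (set is) (\<eta>(i := tl (\<eta> i))) = ?d (set is) \<eta>" if "\<eta> \<in> words k n"
    proof -
      have "\<eta>(i := tl (\<eta> i)) \<in> words k n"
      proof (rule words_upd[OF that i(1)])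
        show "tl (\<eta> i) \<in> lists {1..n i}" using words_mem[OF that i(1)] by (cases "\<eta> i") auto
      qed
      moreover have "(\<Prod>l\<in>set is. if (\<eta>(i := tl (\<eta> i))) l = [] then 1 else 1 - r\<^sup>2) =
          (\<Prod>l\<in>set is. if \<eta> l = [] then 1 else 1 - r\<^sup>2)"
        using i(2) by (intro prod.cong) auto
      ultimately show ?thesis using that by (simp add: delta_weight_def)
    qed
    moreover have "?d (set (i # is)) \<eta> = (if \<eta> i = [] then 1 else 1 - r\<^sup>2) * ?d (set is) \<eta>"
      using i(2) by (simp add: delta_weight_def)
    moreover have "?d (set is) \<eta> = 0" if "\<eta> \<notin> words k n" using that by (simp add: delta_weight_def)
    ultimately show "coord (blinfun_apply (diag (?d (set is)) - Phi_map n (\<lambda>i j. r *\<^sub>R S_op k n i j) i (diag (?d (set is)))) x) \<eta> =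
        coord (diag (?d (set (i # is))) x) \<eta>"
      by (auto simp: blinfun.diff_left Phi_map_diag[OF i(1) r b] coord_diag[OF b] algebra_simps)
  qed
  thus ?case using Cons by simp
qed

lemma sqrt_Delta:
  assumes r: "0 \<le> r" "r \<le> 1"
  shows "sqrt_op (Delta_map k n (\<lambda>i j. r *\<^sub>R S_op k n i j) (id_mfock k n)) =
    diag (delta_weight k n (sqrt (1 - r\<^sup>2)) {1..k})"
proof -
  have q: "0 \<le> sqrt (1 - r\<^sup>2)" "sqrt (1 - r\<^sup>2) \<le> 1" using r by (auto simp: power_le_one)
  have s: "set [1..<Suc k] = {1..k}" by auto
  have sq: "(\<lambda>\<gamma>. (delta_weight k n (sqrt (1 - r\<^sup>2)) {1..k} \<gamma>)\<^sup>2) = delta_weight k n (1 - r\<^sup>2) {1..k}"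
    using r by (auto simp: delta_weight_def power_mult_distrib prod_power_distrib fun_eq_iff power_le_one
        intro!: prod.cong)
  have "Delta_map k n (\<lambda>i j. r *\<^sub>R S_op k n i j) (id_mfock k n) = diag (delta_weight k n (1 - r\<^sup>2) {1..k})"
    using foldr_Delta[OF r, of "[1..<Suc k]" k n] s unfolding Delta_map_def by (simp del: upt_Suc One_nat_def set_upt)
  thus ?thesis
    using sqrt_op_diag[of "delta_weight k n (sqrt (1 - r\<^sup>2)) {1..k}", OF delta_weight_bounds[OF q]] sq by simp
qed


lemma sum_splits:
  fixes f :: "nat \<Rightarrow> nat list \<Rightarrow> nat list \<Rightarrow> real"
  assumes \<gamma>: "\<gamma> \<in> words k n"
  defines "P \<equiv> {p. fst p \<in> words k n \<and> snd p \<in> words k n \<and> cat k (fst p) (snd p) = \<gamma>}"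
  shows "finite P" "(\<Sum>p\<in>P. \<Prod>i=1..k. f i (fst p i) (snd p i)) = (\<Prod>i=1..k. \<Sum>j\<le>length (\<gamma> i).
      f i (take (length (\<gamma> i) - j) (\<gamma> i)) (drop (length (\<gamma> i) - j) (\<gamma> i)))"
proof -
  \<comment> \<open>A splitting is recorded by the lengths of its second parts; these vary
    independently over the components, so the sum of products becomes a product of sums.\<close>
  define J where "J = (\<Pi>\<^sub>E i\<in>{1..k}. {..length (\<gamma> i)})"
  define g where "g = (\<lambda>j. (\<lambda>i\<in>{1..k}. take (length (\<gamma> i) - j i) (\<gamma> i), \<lambda>i\<in>{1..k}. drop (length (\<gamma> i) - j i) (\<gamma> i)))"
  define g' where "g' = (\<lambda>p :: (nat \<Rightarrow> nat list) \<times> (nat \<Rightarrow> nat list). \<lambda>i\<in>{1..k}. length (snd p i))"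
  have w: "\<And>i. i \<in> {1..k} \<Longrightarrow> set (\<gamma> i) \<subseteq> {1..n i}" "\<And>i. i \<notin> {1..k} \<Longrightarrow> \<gamma> i = undefined"
    using \<gamma> unfolding words_def PiE_iff lists_eq_set extensional_def by blast+
  have gP: "g j \<in> P" for j
  proof -
    have "fst (g j) \<in> words k n" "snd (g j) \<in> words k n"
      unfolding words_def PiE_iff lists_eq_set g_def
      using w(1) by (fastforce dest: in_set_takeD in_set_dropD)+
    moreover have "cat k (fst (g j)) (snd (g j)) = \<gamma>"
      by (rule ext) (simp add: cat_def g_def w(2) del: One_nat_def)
    ultimately show ?thesis by (simp add: P_def)
  qed
  have split: "\<gamma> i = fst p i @ snd p i" if "p \<in> P" "i \<in> {1..k}" for p i
    using that unfolding P_def cat_def by (auto dest!: fun_cong[of _ _ i])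
  have g'J: "g' p \<in> J" if "p \<in> P" for p
    unfolding J_def g'_def using split[OF that] by (intro restrict_PiE_iff[THEN iffD2] ballI) simp
  have gg': "g (g' p) = p" if "p \<in> P" for p
  proof (rule prod_eqI)
    have p: "fst p \<in> words k n" "snd p \<in> words k n" using that by (auto simp: P_def)
    show "fst (g (g' p)) = fst p"
      by (rule words_eqI[OF _ p(1)]) (use gP[of "g' p"] split[OF that] in \<open>auto simp: P_def g_def g'_def\<close>)
    show "snd (g (g' p)) = snd p"
      by (rule words_eqI[OF _ p(2)]) (use gP[of "g' p"] split[OF that] in \<open>auto simp: P_def g_def g'_def\<close>)
  qed
  have g'g: "g' (g j) = j" if "j \<in> J" for j
  proof (rule extensionalityI)
    show "j \<in> extensional {1..k}" using that unfolding J_def PiE_def by blast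
    fix i assume i: "i \<in> {1..k}"
    hence "j i \<le> length (\<gamma> i)" using PiE_mem[OF that[unfolded J_def]] by simp
    thus "g' (g j) i = j i" using i by (simp add: g_def g'_def)
  qed (simp add: g'_def)
  have finJ: "finite J" unfolding J_def by (intro finite_PiE) auto
  have "P \<subseteq> g ` J" using gg' g'J by (metis image_iff subsetI)
  thus "finite P" using finJ finite_surj by blast
  have "(\<Sum>p\<in>P. \<Prod>i=1..k. f i (fst p i) (snd p i)) = (\<Sum>j\<in>J. \<Prod>i=1..k. f i (take (length (\<gamma> i) - j i) (\<gamma> i)) (drop (length (\<gamma> i) - j i) (\<gamma> i)))"
  proof (rule sum.reindex_bij_witness[of _ g g'])
    fix p assume p: "p \<in> P"
    show "(\<Prod>i=1..k. f i (take (length (\<gamma> i) - g' p i) (\<gamma> i)) (drop (length (\<gamma> i) - g' p i) (\<gamma> i))) =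
        (\<Prod>i=1..k. f i (fst p i) (snd p i))"
      by (intro prod.cong refl) (simp add: split[OF p] g'_def)
  qed (use gP g'J gg' g'g in auto)
  also have "\<dots> = (\<Prod>i=1..k. \<Sum>j\<le>length (\<gamma> i). f i (take (length (\<gamma> i) - j) (\<gamma> i)) (drop (length (\<gamma> i) - j) (\<gamma> i)))"
    unfolding J_def by (rule prod_sum_PiE[symmetric]) auto
  finally show "(\<Sum>p\<in>P. \<Prod>i=1..k. f i (fst p i) (snd p i)) = \<dots>" .
qed

text \<open>The term at 0 contributes t^m, the others (1 - t)(1 + t + ... + t^(m-1)) = 1 -
  t^m.\<close>

lemma telescope_sum:
  fixes t :: real
  shows "(\<Sum>j\<le>m. t ^ (m - j) * (if j = 0 then 1 else 1 - t)) = 1"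
proof (induction m)
  case (Suc m)
  have "(\<Sum>j\<le>m. t ^ (Suc m - j) * (if j = 0 then 1 else 1 - t)) =
      t * (\<Sum>j\<le>m. t ^ (m - j) * (if j = 0 then 1 else 1 - t))"
    unfolding sum_distrib_left by (intro sum.cong) (auto simp: Suc_diff_le)
  thus ?case using Suc by simp
qed simp

text \<open>The factor of one component in the square root of the defect operator.\<close>

definition defect :: "real \<Rightarrow> nat list \<Rightarrow> real" where
  "defect r s = (if s = [] then 1 else sqrt (1 - r\<^sup>2))"

lemma comparable_suffix_iff:
  assumes "comparable x y" "j \<le> length x"
  shows "(\<exists>b. y = b @ drop (length x - j) x) \<longleftrightarrow> j \<le> length y"
proof
  assume j: "j \<le> length y"
  obtain a b s where e: "x = a @ s" "y = b @ s" "a = [] \<or> b = []"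
    using assms(1) common_suffix_iff[of x "strip_common x y" y "strip_common y x"] by blast
  have "j \<le> length s" using j assms(2) e by auto
  hence "drop (length x - j) x = drop (length s - j) s" by (simp add: e)
  moreover have "y = (b @ take (length s - j) s) @ drop (length s - j) s" by (simp add: e)
  ultimately show "\<exists>b. y = b @ drop (length x - j) x" by metis
next
  assume "\<exists>b. y = b @ drop (length x - j) x"
  then obtain b where "y = b @ drop (length x - j) x" by blast
  hence "length y = length b + (length x - (length x - j))" by simp
  thus "j \<le> length y" using assms(2) by simp
qed

text \<open>Only common suffixes of the two words contribute. A suffix of length \<open>j\<close>
  leaves the unavoidable power \<open>q\<close> of \<open>r\<close> times a weight in r^2 that
  depends on \<open>m - j\<close>, and these weights sum to 1 by
  \<open>telescope_sum\<close>.\<close>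

lemma suffix_sum:
  assumes c: "comparable x y" and r: "0 \<le> r" "r \<le> 1"
  shows "(\<Sum>j\<le>length x. r ^ length (take (length x - j) x) * defect r (drop (length x - j) x) *
      (if \<exists>b. y = b @ drop (length x - j) x
       then r ^ (length y - length (drop (length x - j) x)) * defect r (drop (length x - j) x) else 0)) =
    r ^ (length (strip_common x y) + length (strip_common y x))"
proof -
  define m where "m = min (length x) (length y)"
  define q where "q = length (strip_common x y) + length (strip_common y x)"
  have d: "(defect r (drop (length x - j) x))\<^sup>2 = (if j = 0 then 1 else 1 - r\<^sup>2)" if "j \<le> length x" for j
    using that r by (auto simp: defect_def power_le_one)
  have "(\<Sum>j\<le>length x. r ^ length (take (length x - j) x) * defect r (drop (length x - j) x) *
      (if \<exists>b. y = b @ drop (length x - j) x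
       then r ^ (length y - length (drop (length x - j) x)) * defect r (drop (length x - j) x) else 0)) =
      (\<Sum>j\<le>length x. if j \<le> m then r ^ q * ((r\<^sup>2) ^ (m - j) * (if j = 0 then 1 else 1 - r\<^sup>2)) else 0)"
  proof (intro sum.cong refl)
    fix j assume "j \<in> {..length x}"
    hence j: "j \<le> length x" by simp
    \<comment> \<open>The two lengths add up to \<open>q + 2 * m\<close>.\<close>
    have e: "(length x - j) + (length y - j) = q + 2 * (m - j)" if "j \<le> length y"
      using j that by (auto simp: q_def m_def strip_common_def)
    have "r ^ (length x - j) * r ^ (length y - j) = r ^ q * (r\<^sup>2) ^ (m - j)" if "j \<le> length y"
      using e[OF that] by (metis power_add power_mult)
    thus "r ^ length (take (length x - j) x) * defect r (drop (length x - j) x) *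
      (if \<exists>b. y = b @ drop (length x - j) x
       then r ^ (length y - length (drop (length x - j) x)) * defect r (drop (length x - j) x) else 0) =
       (if j \<le> m then r ^ q * ((r\<^sup>2) ^ (m - j) * (if j = 0 then 1 else 1 - r\<^sup>2)) else 0)"
      unfolding comparable_suffix_iff[OF c j] d[OF j, symmetric]
      using j by (auto simp: m_def power2_eq_square)
  qed
  also have "\<dots> = (\<Sum>j\<le>m. r ^ q * ((r\<^sup>2) ^ (m - j) * (if j = 0 then 1 else 1 - r\<^sup>2)))"
    by (rule sum.mono_neutral_cong_right) (auto simp: m_def)
  also have "\<dots> = r ^ q"
    unfolding sum_distrib_left[symmetric] telescope_sum by simp
  finally show ?thesis by (simp add: q_def)
qed

text \<open>The sum over splittings of the tuple factors over the components, and each factor is an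
  instance of \<open>suffix_sum\<close>.\<close>

lemma split_sum:
  assumes \<eta>: "\<eta> \<in> words k n" and c: "comparable_words k \<eta> \<gamma>" and r: "0 \<le> r" "r \<le> 1"
  shows "(\<Sum>p\<in>{p. fst p \<in> words k n \<and> snd p \<in> words k n \<and> cat k (fst p) (snd p) = \<eta>}.
      \<Prod>i=1..k. r ^ length (fst p i) * defect r (snd p i) * (if \<exists>b. \<gamma> i = b @ snd p i
        then r ^ (length (\<gamma> i) - length (snd p i)) * defect r (snd p i) else 0)) = r ^ total_degree k \<eta> \<gamma>"
proof -
  let ?f = "\<lambda>i b s. r ^ length b * defect r s *
      (if \<exists>b. \<gamma> i = b @ s then r ^ (length (\<gamma> i) - length s) * defect r s else 0)"
  have "(\<Prod>i=1..k. \<Sum>j\<le>length (\<eta> i).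
      ?f i (take (length (\<eta> i) - j) (\<eta> i)) (drop (length (\<eta> i) - j) (\<eta> i))) =
      (\<Prod>i=1..k. r ^ (length (reduced k \<eta> \<gamma> i) + length (reduced k \<gamma> \<eta> i)))"
  proof (intro prod.cong refl)
    fix i assume i: "i \<in> {1..k}"
    hence "comparable (\<eta> i) (\<gamma> i)" using c by (simp only: comparable_words_def)
    from suffix_sum[OF this r] show "(\<Sum>j\<le>length (\<eta> i).
      ?f i (take (length (\<eta> i) - j) (\<eta> i)) (drop (length (\<eta> i) - j) (\<eta> i))) =
      r ^ (length (reduced k \<eta> \<gamma> i) + length (reduced k \<gamma> \<eta> i))"
      unfolding reduced_def restrict_apply'[OF i] .
  qed
  thus ?thesis
    unfolding sum_splits(2)[OF \<eta>, of ?f] total_degree_def power_sum .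
qed

section \<open>The kernel as a weighted composition operator over splittings\<close>

definition split_weight :: "nat \<Rightarrow> (nat \<Rightarrow> nat) \<Rightarrow> real \<Rightarrow> (nat \<Rightarrow> nat list) \<times> (nat \<Rightarrow> nat list) \<Rightarrow> real" where
  "split_weight k n r p = of_bool (fst p \<in> words k n \<and> snd p \<in> words k n) *
    (\<Prod>i=1..k. r ^ length (fst p i) * defect r (snd p i))"

abbreviation cat_pair :: "nat \<Rightarrow> (nat \<Rightarrow> nat list) \<times> (nat \<Rightarrow> nat list) \<Rightarrow> nat \<Rightarrow> nat list" where
  "cat_pair k p \<equiv> cat k (fst p) (snd p)"

text \<open>The squared weights over the splittings of a word tuple are the case of equal row and
  column in \<open>split_sum\<close>; the total degree is then 0, so they sum to exactly 1. This is
  the source of contractivity.\<close>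

lemma wmap_split_weight:
  assumes r: "0 \<le> r" "r \<le> 1"
  shows "wmap (cat_pair k) (split_weight k n r)"
  unfolding wmap_def
proof
  fix \<gamma>
  let ?F = "{p. cat_pair k p = \<gamma> \<and> split_weight k n r p \<noteq> 0}"
  let ?P = "{p. fst p \<in> words k n \<and> snd p \<in> words k n \<and> cat_pair k p = \<gamma>}"
  show "finite ?F \<and> (\<Sum>p\<in>?F. (split_weight k n r p)\<^sup>2) \<le> 1"
  proof (cases "\<gamma> \<in> words k n")
    case True
    have sub: "?F \<subseteq> ?P" by (auto simp: split_weight_def)
    have fin: "finite ?P" by (rule sum_splits(1)[OF True])
    let ?f = "\<lambda>i b s. r ^ length b * defect r s *
      (if \<exists>b. \<gamma> i = b @ s then r ^ (length (\<gamma> i) - length s) * defect r s else 0)"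
    have "(\<Sum>p\<in>?F. (split_weight k n r p)\<^sup>2) = (\<Sum>p\<in>?P. (split_weight k n r p)\<^sup>2)"
      by (rule sum.mono_neutral_left[OF fin sub]) auto
    also have "\<dots> = (\<Sum>p\<in>?P. \<Prod>i=1..k. ?f i (fst p i) (snd p i))"
    proof (intro sum.cong refl)
      fix p assume p: "p \<in> ?P"
      hence "\<gamma> i = fst p i @ snd p i" if "i \<in> {1..k}" for i
        using that by (auto simp: cat_def)
      thus "(split_weight k n r p)\<^sup>2 = (\<Prod>i=1..k. ?f i (fst p i) (snd p i))"
        using p unfolding split_weight_def power2_eq_square prod.distrib[symmetric]
        by (simp flip: prod.distrib)
    qed
    also have "\<dots> = r ^ total_degree k \<gamma> \<gamma>"
      by (rule split_sum[OF True _ r]) (simp add: comparable_words_def comparable_def)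
    also have "\<dots> = 1" by (simp add: total_degree_def reduced_def strip_common_def)
    finally show ?thesis using finite_subset[OF sub fin] by simp
  next
    case False
    hence "?F = {}" by (auto simp: split_weight_def intro: cat_words)
    thus ?thesis by (simp only: finite.emptyI sum.empty) simp
  qed
qed

text \<open>The summand of index \<beta> is the part of the image whose first index is \<beta>, so
  the infinite sum is the decomposition of that image over the fibres of \<open>fst\<close>.\<close>

lemma berezin_kernel_eq:
  assumes r: "0 \<le> r" "r \<le> 1"
  shows "berezin_kernel k n (\<lambda>i j. r *\<^sub>R S_op k n i j) = wpull (cat_pair k) (split_weight k n r)"
proof -
  let ?K = "wpull (cat_pair k) (split_weight k n r) ::
    (nat \<Rightarrow> nat list, complex) l2 \<Rightarrow>\<^sub>L ((nat \<Rightarrow> nat list) \<times> (nat \<Rightarrow> nat list), complex) l2"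
  let ?d = "delta_weight k n (sqrt (1 - r\<^sup>2)) {1..k}"
  have q: "0 \<le> sqrt (1 - r\<^sup>2)" "sqrt (1 - r\<^sup>2) \<le> 1" using r by (auto simp: power_le_one)
  let ?t = "\<lambda>h \<beta>. l2_tensor (mtensor k (\<lambda>i. ket (\<beta> i)))
       (sqrt_op (Delta_map k n (\<lambda>i j. r *\<^sub>R S_op k n i j) (id_mfock k n))
         (op_mword_adj (id_mfock k n) k (\<lambda>i j. r *\<^sub>R S_op k n i j) \<beta> h))"
  have t: "?t h \<beta> = l2_restrict (fst -` {\<beta>}) (?K h)" if \<beta>: "\<beta> \<in> words k n" for h \<beta>
  proof (rule l2_eqI)
    fix p :: "(nat \<Rightarrow> nat list) \<times> (nat \<Rightarrow> nat list)"
    obtain v w where p: "p = (v, w)" by (cases p)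
    have "coord (?t h \<beta>) (v, w) = (if v = \<beta> then
        (?d w * (r ^ (\<Sum>i=1..k. length (\<beta> i)) * of_bool (w \<in> words k n))) *\<^sub>R coord h (cat k \<beta> w) else 0)"
      unfolding sqrt_Delta[OF r] op_mword_adj_eq[OF r \<beta>] mtensor_ket[OF words_extensional[OF \<beta>]] coord_l2_tensor
        coord_diag[of ?d, OF delta_weight_bounds[OF q]] coord_wpull[OF wmap_scaled_inj[OF inj_cat r]]
      by (simp add: ket.rep_eq scaleC_complex_def)
    moreover have "split_weight k n r (\<beta>, w) = ?d w * (r ^ (\<Sum>i=1..k. length (\<beta> i)) * of_bool (w \<in> words k n))"
      using \<beta> by (simp add: split_weight_def delta_weight_def defect_def prod.distrib power_sum)
    ultimately show "coord (?t h \<beta>) p = coord (l2_restrict (fst -` {\<beta>}) (?K h)) p"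
      by (simp add: p l2_restrict.rep_eq coord_wpull[OF wmap_split_weight[OF r]])
  qed
  have "(\<Sum>\<^sub>\<infinity>\<beta>\<in>words k n. ?t h \<beta>) = ?K h" for h
  proof -
    \<comment> \<open>Indices that are no word tuples contribute nothing, so the sum may be extended
      to all indices.\<close>
    have 0: "l2_restrict (fst -` {\<beta>}) (?K h) = 0" if "\<beta> \<notin> words k n" for \<beta>
      using that by (intro l2_eqI)
        (auto simp: l2_restrict.rep_eq coord_wpull[OF wmap_split_weight[OF r]] split_weight_def)
    have "(?t h has_sum ?K h) (words k n) \<longleftrightarrow> ((\<lambda>\<beta>. l2_restrict (fst -` {\<beta>}) (?K h)) has_sum ?K h) UNIV"
      by (rule has_sum_cong_neutral) (auto simp: t 0)
    thus ?thesis using l2_restrict_has_sum[of fst "?K h"] by (auto intro: infsumI)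
  qed
  thus ?thesis
    unfolding berezin_kernel_def by (simp add: blinfun_apply_inverse)
qed

lemma berezin_ext_eq:
  assumes r: "0 \<le> r" "r \<le> 1" and A: "A \<in> bop UNIV UNIV"
  shows "berezin_ext k n (\<lambda>i j. r *\<^sub>R S_op k n i j) A =
    wpush (cat_pair k) (split_weight k n r) o\<^sub>L slicewise (words k n) A o\<^sub>L wpull (cat_pair k) (split_weight k n r)"
  unfolding berezin_ext_def berezin_kernel_eq[OF r] adj_wpull[OF wmap_split_weight[OF r]]
    op_vtensor_id[OF id_tensor_wpull[OF wmap_split_weight[OF r]]]
    op_vtensor_id[OF id_tensor_wpush[OF wmap_split_weight[OF r]]] op_l2_tensor_id_on[OF A] ..

text \<open>The bound does not depend on \<open>r\<close>; it supplies the supremum bound for the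
  series and the uniform bound for the strong limit.\<close>

lemma norm_berezin_ext_le:
  assumes r: "0 \<le> r" "r \<le> 1" and A: "A \<in> bop UNIV UNIV"
  shows "norm (berezin_ext k n (\<lambda>i j. r *\<^sub>R S_op k n i j) A) \<le> norm A"
proof -
  let ?V = "wpull (cat_pair k) (split_weight k n r) :: (nat \<Rightarrow> nat list, 'a) l2 \<Rightarrow>\<^sub>L ((nat \<Rightarrow> nat list) \<times> (nat \<Rightarrow> nat list), 'a) l2"
  let ?W = "wpush (cat_pair k) (split_weight k n r) :: ((nat \<Rightarrow> nat list) \<times> (nat \<Rightarrow> nat list), 'a) l2 \<Rightarrow>\<^sub>L (nat \<Rightarrow> nat list, 'a) l2"
  let ?A = "slicewise (words k n) A :: ((nat \<Rightarrow> nat list) \<times> (nat \<Rightarrow> nat list), 'a) l2 op"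
  have "norm (?W o\<^sub>L ?A o\<^sub>L ?V) \<le> norm (?W o\<^sub>L ?A) * norm ?V" by (rule norm_blinfun_compose)
  also have "\<dots> \<le> (norm ?W * norm ?A) * norm ?V" by (intro mult_right_mono norm_blinfun_compose) simp
  also have "\<dots> \<le> (1 * norm A) * 1"
    by (intro mult_mono norm_wpush norm_wpull norm_slicewise wmap_split_weight r) auto
  finally show ?thesis unfolding berezin_ext_eq[OF r A] by simp
qed

text \<open>The middle factor preserves the second index, so a splitting of \<eta> into \<alpha> and
  \<sigma> interacts only with the splitting of \<gamma> that has the same \<sigma>. By
  \<open>toeplitz_cat\<close> the entry of \<open>A\<close> at the prefixes equals the one at \<eta>
  and \<gamma>; it factors out, and the weights sum by \<open>split_sum\<close>.\<close>

lemma berezin_ext_entry: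
  assumes mt: "multi_toeplitz k n A" and r: "0 \<le> r" "r \<le> 1"
  shows "coord (berezin_ext k n (\<lambda>i j. r *\<^sub>R S_op k n i j) A (vket h \<gamma>)) \<eta> =
    r ^ total_degree k \<eta> \<gamma> *\<^sub>R coord (A (vket h \<gamma>)) \<eta>"
proof -
  have A: "A \<in> bop UNIV UNIV" using toeplitz_bop[OF mt] unfolding mfock_def in_bop_l2_on by blast
  let ?w = "split_weight k n r" and ?W = "words k n"
  note w = wmap_split_weight[OF r]
  let ?P = "{p. fst p \<in> ?W \<and> snd p \<in> ?W \<and> cat_pair k p = \<eta>}"
  let ?F = "{p. cat_pair k p = \<eta> \<and> ?w p \<noteq> 0}"
  let ?y = "slicewise ?W A (wpull (cat_pair k) ?w (vket h \<gamma>))"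
  \<comment> \<open>Weight of the splitting of \<open>\<gamma> i\<close> with second part
    \<open>s\<close>, and 0 if \<open>s\<close> is no suffix of it.\<close>
  let ?g = "\<lambda>i s. if \<exists>b. \<gamma> i = b @ s then r ^ (length (\<gamma> i) - length s) * defect r s else 0"
  have y: "coord ?y p = (of_bool (\<gamma> \<in> ?W) * (\<Prod>i=1..k. ?g i (snd p i))) *\<^sub>R coord (A (vket h \<gamma>)) \<eta>"
    if p: "p \<in> ?P" for p
  proof -
    obtain \<alpha> \<sigma> where ps: "p = (\<alpha>, \<sigma>)" by (cases p)
    have pW: "\<alpha> \<in> ?W" "\<sigma> \<in> ?W" and \<eta>: "cat k \<alpha> \<sigma> = \<eta>" using p ps by auto
    show ?thesis
    proof (cases "\<exists>\<beta>\<in>?W. cat k \<beta> \<sigma> = \<gamma>")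
      case True
      then obtain \<beta> where \<beta>: "\<beta> \<in> ?W" "cat k \<beta> \<sigma> = \<gamma>" by blast
      \<comment> \<open>Cancelling the common suffix \<open>\<sigma>\<close> shows that the slice
        has a single nonzero coordinate at most.\<close>
      have uniq: "\<beta>' = \<beta>" if "\<beta>' \<in> ?W" "cat k \<beta>' \<sigma> = \<gamma>" for \<beta>'
      proof (rule words_eqI[OF that(1) \<beta>(1)])
        fix i assume "i \<in> {1..k}"
        thus "\<beta>' i = \<beta> i" using fun_cong[OF that(2)[folded \<beta>(2)], of i] by (simp add: cat_def)
      qed
      have "slice \<sigma> (wpull (cat_pair k) ?w (vket h \<gamma>)) = vket (?w (\<beta>, \<sigma>) *\<^sub>R h) \<beta>"
      proof (rule l2_eqI)
        fix v
        have "cat k v \<sigma> \<noteq> \<gamma> \<or> ?w (v, \<sigma>) = 0" if "v \<noteq> \<beta>"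
          using uniq[of v] that by (cases "v \<in> ?W") (auto simp: split_weight_def)
        thus "coord (slice \<sigma> (wpull (cat_pair k) ?w (vket h \<gamma>))) v = coord (vket (?w (\<beta>, \<sigma>) *\<^sub>R h) \<beta>) v"
          using \<beta>(2) by (simp add: coord_slice coord_wpull[OF w] coord_vket)
      qed
      hence "coord ?y p = ?w (\<beta>, \<sigma>) *\<^sub>R coord (A (vket h \<beta>)) \<alpha>"
        using pW by (simp add: ps coord_slicewise vket_linear blinfun.scaleR_right)
      also have "coord (A (vket h \<beta>)) \<alpha> = coord (A (vket h \<gamma>)) \<eta>"
        using toeplitz_cat[OF mt pW(1) \<beta>(1) pW(2)] \<eta> \<beta>(2) by simp
      also have "?w (\<beta>, \<sigma>) = of_bool (\<gamma> \<in> ?W) * (\<Prod>i=1..k. ?g i (snd p i))"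
      proof -
        have "\<gamma> i = \<beta> i @ \<sigma> i" if "i \<in> {1..k}" for i using that unfolding \<beta>(2)[symmetric] cat_def by simp
        hence "r ^ length (\<beta> i) * defect r (\<sigma> i) = ?g i (\<sigma> i)" if "i \<in> {1..k}" for i
          using that by auto
        hence "(\<Prod>i=1..k. r ^ length (\<beta> i) * defect r (\<sigma> i)) = (\<Prod>i=1..k. ?g i (\<sigma> i))"
          by (intro prod.cong) blast+
        moreover have "\<gamma> \<in> ?W" using cat_words[OF \<beta>(1) pW(2)] \<beta>(2) by simp
        ultimately show ?thesis
          unfolding split_weight_def ps fst_conv snd_conv using \<beta>(1) pW(2) by simp
      qed
      finally show ?thesis .
    next
      case False
      have "slice \<sigma> (wpull (cat_pair k) ?w (vket h \<gamma>)) = 0"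
        using False by (intro l2_eqI)
          (auto simp: coord_slice coord_wpull[OF w] coord_vket split_weight_def)
      hence "coord ?y p = 0" by (simp add: ps coord_slicewise blinfun.zero_right)
      \<comment> \<open>If all weights were nonzero, the prefixes left over in the components would
        assemble to a tuple \<beta>.\<close>
      moreover have "(\<Prod>i=1..k. ?g i (\<sigma> i)) = 0" if \<gamma>: "\<gamma> \<in> ?W"
      proof (rule ccontr)
        assume "(\<Prod>i=1..k. ?g i (\<sigma> i)) \<noteq> 0"
        hence "\<forall>i\<in>{1..k}. ?g i (\<sigma> i) \<noteq> 0" by (subst (asm) prod_zero_iff) auto
        hence "\<forall>i\<in>{1..k}. \<exists>b. \<gamma> i = b @ \<sigma> i" by (meson)
        then obtain b where b: "\<And>i. i \<in> {1..k} \<Longrightarrow> \<gamma> i = b i @ \<sigma> i" by metis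
        have "restrict b {1..k} \<in> ?W"
          using words_mem[OF \<gamma>] b unfolding words_def by (intro restrict_PiE_iff[THEN iffD2] ballI) fastforce
        moreover from this have "cat k (restrict b {1..k}) \<sigma> = \<gamma>"
          by (intro words_eqI[OF cat_words[OF _ pW(2)] \<gamma>]) (auto simp: cat_def b)
        ultimately show False using False by blast
      qed
      ultimately show ?thesis unfolding ps snd_conv by auto
    qed
  qed
  have out: "coord (A (vket h \<gamma>)) \<eta> = 0" if "\<not> (\<eta> \<in> ?W \<and> \<gamma> \<in> ?W)"
    by (rule toeplitz_outside[OF mt that])
  have "coord (berezin_ext k n (\<lambda>i j. r *\<^sub>R S_op k n i j) A (vket h \<gamma>)) \<eta> = (\<Sum>p\<in>?F. ?w p *\<^sub>R coord ?y p)"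
    by (simp add: berezin_ext_eq[OF r A] coord_wpush[OF w])
  also have "\<dots> = r ^ total_degree k \<eta> \<gamma> *\<^sub>R coord (A (vket h \<gamma>)) \<eta>"
  proof (cases "\<eta> \<in> ?W \<and> \<gamma> \<in> ?W \<and> comparable_words k \<eta> \<gamma>")
    case True
    hence \<eta>: "\<eta> \<in> ?W" and \<gamma>: "\<gamma> \<in> ?W" and c: "comparable_words k \<eta> \<gamma>" by auto
    have "(\<Sum>p\<in>?F. ?w p *\<^sub>R coord ?y p) = (\<Sum>p\<in>?P. ?w p *\<^sub>R coord ?y p)"
      by (rule sum.mono_neutral_left[OF sum_splits(1)[OF \<eta>]]) (auto simp: split_weight_def)
    also have "\<dots> = (\<Sum>p\<in>?P. (\<Prod>i=1..k. r ^ length (fst p i) * defect r (snd p i) * ?g i (snd p i)) *\<^sub>R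
        coord (A (vket h \<gamma>)) \<eta>)"
    proof (intro sum.cong refl)
      fix p assume p: "p \<in> ?P"
      hence "?w p = (\<Prod>i=1..k. r ^ length (fst p i) * defect r (snd p i))"
        by (simp add: split_weight_def)
      thus "?w p *\<^sub>R coord ?y p = (\<Prod>i=1..k. r ^ length (fst p i) * defect r (snd p i) * ?g i (snd p i)) *\<^sub>R
          coord (A (vket h \<gamma>)) \<eta>"
        unfolding y[OF p] prod.distrib[of _ "\<lambda>i. ?g i (snd p i)"] using \<gamma> by simp
    qed
    also have "\<dots> = r ^ total_degree k \<eta> \<gamma> *\<^sub>R coord (A (vket h \<gamma>)) \<eta>"
      unfolding scaleR_sum_left[symmetric] split_sum[OF \<eta> c r] ..
    finally show ?thesis .
  next
    case False
    hence A0: "coord (A (vket h \<gamma>)) \<eta> = 0" using out toeplitz_incomparable[OF mt] by blast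
    have "coord ?y p = 0" if "p \<in> ?F" for p
    proof -
      have "p \<in> ?P" using that by (auto simp: split_weight_def)
      from y[OF this] A0 show ?thesis by simp
    qed
    thus ?thesis using A0 by simp
  qed
  finally show ?thesis .
qed

section \<open>Convergence of the Fourier series\<close>

text \<open>The strong operator topology is the pullback along \<open>blinfun_apply\<close> of the
  product topology, in which limits are taken pointwise.\<close>

lemma limitin_strong_operator_topologyI:
  assumes "\<And>x. ((\<lambda>r. blinfun_apply (f r) x) \<longlongrightarrow> blinfun_apply A x) F"
  shows "limitin strong_operator_topology f A F"
proof -
  have "limitin (product_topology (\<lambda>x. euclidean) UNIV) (\<lambda>r. blinfun_apply (f r)) (blinfun_apply A) F"
    unfolding limitin_componentwise using assms by simp
  hence lim: "limitin euclidean (\<lambda>r. blinfun_apply (f r)) (blinfun_apply A) F"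
    by (simp add: euclidean_product_topology)
  show ?thesis
    unfolding limitin_def strong_operator_topology_topspace
  proof (intro conjI allI impI UNIV_I)
    fix U assume U: "openin strong_operator_topology U \<and> A \<in> U"
    then obtain V where V: "openin euclidean V" "U = blinfun_apply -` V"
      unfolding strong_operator_topology_def openin_pullback_topology by auto
    with U lim show "\<forall>\<^sub>F r in F. f r \<in> U" unfolding limitin_def by simp
  qed
qed

lemma phi_eqI: "iterated_zsums k (phi_part k n C r) s \<Longrightarrow> phi k n C r = s"
  unfolding phi_def by (rule the_equality) (auto dest: iterated_zsums_unique)

text \<open>The Toeplitz relation already holds for the formal entries: equal last letters cancel in
  the reduced words, different ones destroy comparability.\<close>

lemma fourier_entry_snoc:
  assumes i: "i \<in> {1..k}"
  shows "fourier_entry k C (\<eta>(i := \<eta> i @ [s])) (\<gamma>(i := \<gamma> i @ [t])) h = (if s = t then fourier_entry k C \<eta> \<gamma> h else 0)"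
proof -
  have cl: "comparable (x @ [s]) (y @ [t]) \<longleftrightarrow> s = t \<and> comparable x y" for x y and s t :: nat
    by (auto simp: comparable_def)
  have rl: "strip_common (x @ [s]) (y @ [t]) = strip_common x y" for x y and s t :: nat by (simp add: strip_common_def)
  have "comparable_words k (\<eta>(i := \<eta> i @ [s])) (\<gamma>(i := \<gamma> i @ [t])) \<longleftrightarrow> s = t \<and> comparable_words k \<eta> \<gamma>"
  proof
    assume c: "comparable_words k (\<eta>(i := \<eta> i @ [s])) (\<gamma>(i := \<gamma> i @ [t]))"
    have "comparable ((\<eta>(i := \<eta> i @ [s])) l) ((\<gamma>(i := \<gamma> i @ [t])) l)" if "l \<in> {1..k}" for l
      using c that unfolding comparable_words_def by blast
    from this[of i] this show "s = t \<and> comparable_words k \<eta> \<gamma>"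
      using i unfolding comparable_words_def by (metis cl fun_upd_other fun_upd_same)
  next
    assume "s = t \<and> comparable_words k \<eta> \<gamma>"
    thus "comparable_words k (\<eta>(i := \<eta> i @ [s])) (\<gamma>(i := \<gamma> i @ [t]))"
      unfolding comparable_words_def by (simp add: cl)
  qed
  moreover have "reduced k (\<eta>(i := \<eta> i @ [s])) (\<gamma>(i := \<gamma> i @ [t])) = reduced k \<eta> \<gamma>"
    "reduced k (\<gamma>(i := \<gamma> i @ [t])) (\<eta>(i := \<eta> i @ [s])) = reduced k \<gamma> \<eta>"
    unfolding reduced_def by (auto simp: rl)
  ultimately show ?thesis by (cases "s = t") (simp_all add: fourier_entry_def)
qed

text \<open>Index pairs of the series are already reduced, as \<open>fourier_index_match\<close>
  shows with the empty suffix in every component.\<close>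

lemma fourier_entry_fourier_index:
  assumes ab: "(\<alpha>, \<beta>) \<in> fourier_index k n ms"
  shows "fourier_entry k C \<alpha> \<beta> h = C \<alpha> \<beta> h"
proof -
  have w: "\<alpha> \<in> words k n" "\<beta> \<in> words k n" using ab by (auto simp: fourier_index_def)
  let ?e = "\<lambda>i\<in>{1..k}. [] :: nat list"
  have e: "?e \<in> words k n" by (simp add: words_def)
  have "cat k \<gamma> ?e = \<gamma>" if "\<gamma> \<in> words k n" for \<gamma>
    by (rule words_eqI[OF cat_words[OF that e] that]) (simp add: cat_def)
  thus ?thesis
    using fourier_index_match[OF w ab] e w unfolding fourier_entry_def by metis
qed

text \<open>Existence and value are separated: the norm estimate gives some sum, and comparing
  entries identifies it with the Berezin transform.\<close>

lemma toeplitz_phi_berezin: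
  assumes mt: "multi_toeplitz k n A" and fs: "has_fourier_series k n A C"
    and C: "\<And>\<alpha> \<beta> ms. length ms = k \<Longrightarrow> (\<alpha>, \<beta>) \<in> fourier_index k n ms \<Longrightarrow> C \<alpha> \<beta> \<in> bop UNIV UNIV"
    and r: "0 \<le> r" "r < 1"
  shows "iterated_zsums k (phi_part k n C r) (berezin_ext k n (\<lambda>i j. r *\<^sub>R S_op k n i j) A)"
proof -
  have "norm (phi_part k n C r ms) \<le> norm A * r ^ (\<Sum>m\<leftarrow>ms. nat \<bar>m\<bar>)" if "length ms = k" for ms
    by (rule norm_phi_part_le[OF mt fs _ that r(1)]) (rule C[OF that])
  then obtain s where s: "iterated_zsums k (phi_part k n C r) s"
    using iterated_zsums_bound[OF r, of k "phi_part k n C r" "norm A"] by blast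
  have se: "coord (s (vket h \<gamma>)) \<eta> =
    (if \<eta> \<in> words k n \<and> \<gamma> \<in> words k n then r ^ total_degree k \<eta> \<gamma> *\<^sub>R fourier_entry k C \<eta> \<gamma> h else 0)" for h \<gamma> \<eta>
    by (rule iterated_zsums_phi_entry[OF _ s]) (rule C)
  have "s = berezin_ext k n (\<lambda>i j. r *\<^sub>R S_op k n i j) A"
  proof (rule l2_blinfun_entry_eqI)
    fix h \<gamma> \<eta>
    show "coord (s (vket h \<gamma>)) \<eta> = coord (berezin_ext k n (\<lambda>i j. r *\<^sub>R S_op k n i j) A (vket h \<gamma>)) \<eta>"
      unfolding se berezin_ext_entry[OF mt r(1) less_imp_le[OF r(2)]]
      using toeplitz_fourier_entry[OF mt fs] toeplitz_outside[OF mt] by auto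
  qed
  with s show ?thesis by simp
qed

lemma berezin_tendsto:
  assumes mt: "multi_toeplitz k n A"
  shows "((\<lambda>r. blinfun_apply (berezin_ext k n (\<lambda>i j. r *\<^sub>R S_op k n i j) A) x) \<longlongrightarrow> A x) (at_left 1)"
proof (rule tendsto_from_vkets)
  have A: "A \<in> bop UNIV UNIV" using toeplitz_bop[OF mt] unfolding mfock_def in_bop_l2_on by blast
  have ev: "\<forall>\<^sub>F r :: real in at_left 1. 0 \<le> r \<and> r \<le> 1"
    using eventually_at_left_real[of 0 1] by (rule eventually_mono) auto
  thus "\<forall>\<^sub>F r in at_left 1. norm (berezin_ext k n (\<lambda>i j. r *\<^sub>R S_op k n i j) A) \<le> norm A"
    by (rule eventually_mono) (use norm_berezin_ext_le[OF _ _ A] in blast)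
  fix h \<gamma>
  show "((\<lambda>r. blinfun_apply (berezin_ext k n (\<lambda>i j. r *\<^sub>R S_op k n i j) A) (vket h \<gamma>)) \<longlongrightarrow> A (vket h \<gamma>)) (at_left 1)"
  proof (rule tendsto_l2_multiplier[where c = "\<lambda>r \<eta>. r ^ total_degree k \<eta> \<gamma>"])
    show "\<forall>\<^sub>F r in at_left 1. \<forall>\<eta>. \<bar>r ^ total_degree k \<eta> \<gamma>\<bar> \<le> 1 \<and>
        coord (berezin_ext k n (\<lambda>i j. r *\<^sub>R S_op k n i j) A (vket h \<gamma>)) \<eta> =
        r ^ total_degree k \<eta> \<gamma> *\<^sub>R coord (A (vket h \<gamma>)) \<eta>"
      using ev by (rule eventually_mono) (simp add: berezin_ext_entry[OF mt] power_le_one)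
    show "((\<lambda>r :: real. r ^ total_degree k \<eta> \<gamma>) \<longlongrightarrow> 1) (at_left 1)" for \<eta>
      by (rule tendsto_eq_intros | simp)+
  qed
qed

lemma toeplitz_from_bounded_phi:
  fixes C :: "'e::chilbert_space coeffs"
  assumes C: "\<And>\<alpha> \<beta> ms. length ms = k \<Longrightarrow> (\<alpha>, \<beta>) \<in> fourier_index k n ms \<Longrightarrow> C \<alpha> \<beta> \<in> bop UNIV UNIV"
    and conv: "\<And>r. 0 \<le> r \<Longrightarrow> r < 1 \<Longrightarrow> phi_convergent k n C r"
    and M: "\<And>r. 0 \<le> r \<Longrightarrow> r < 1 \<Longrightarrow> norm (phi k n C r) \<le> M"
  shows "\<exists>A. multi_toeplitz k n A \<and> has_fourier_series k n A C"
proof -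
  \<comment> \<open>The matrix of the operator to be constructed.\<close>
  define e where "e = (\<lambda>\<eta> \<gamma> h. if \<eta> \<in> words k n \<and> \<gamma> \<in> words k n then fourier_entry k C \<eta> \<gamma> h else 0)"
  \<comment> \<open>A sequence of radii in [0,1), starting at 0, is enough to construct
    \<open>A\<close>.\<close>
  define q where "q = (\<lambda>p. 1 - 1 / real (Suc p))"
  have q: "0 \<le> q p" "q p < 1" for p by (auto simp: q_def)
  have q1: "q \<longlonglongrightarrow> 1"
    unfolding q_def using tendsto_diff[OF tendsto_const LIMSEQ_inverse_real_of_nat, of 1]
    by (simp add: inverse_eq_divide)
  let ?T = "\<lambda>p. phi k n C (q p)"
  have T: "coord (?T p (vket h \<gamma>)) \<eta> = q p ^ total_degree k \<eta> \<gamma> *\<^sub>R e \<eta> \<gamma> h" for p h \<gamma> \<eta>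
  proof -
    obtain s where s: "iterated_zsums k (phi_part k n C (q p)) s"
      using conv[OF q] unfolding phi_convergent_def by blast
    have "coord (s (vket h \<gamma>)) \<eta> = (if \<eta> \<in> words k n \<and> \<gamma> \<in> words k n
        then q p ^ total_degree k \<eta> \<gamma> *\<^sub>R fourier_entry k C \<eta> \<gamma> h else 0)"
      by (rule iterated_zsums_phi_entry[OF _ s]) (rule C)
    thus ?thesis
      unfolding phi_eqI[OF s] by (simp add: e_def)
  qed
  have qd: "(\<lambda>p. q p ^ d) \<longlonglongrightarrow> 1" for d
    using tendsto_power[OF q1, of d] by simp
  \<comment> \<open>Columns of \<open>e\<close> are limits of columns of the approximants, so the
    uniform bound survives on every finite set of rows.\<close>
  have "(\<lambda>\<eta>. (norm (e \<eta> \<gamma> h))\<^sup>2) summable_on UNIV" for \<gamma> h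
  proof (rule nonneg_bdd_above_summable_on)
    have "(\<Sum>\<eta>\<in>F. (norm (e \<eta> \<gamma> h))\<^sup>2) \<le> (M * norm h)\<^sup>2" if F: "finite F" for F
    proof (rule LIMSEQ_le_const2)
      have "(\<lambda>p. \<Sum>\<eta>\<in>F. (norm (q p ^ total_degree k \<eta> \<gamma> *\<^sub>R e \<eta> \<gamma> h))\<^sup>2)
          \<longlonglongrightarrow> (\<Sum>\<eta>\<in>F. (norm (1 *\<^sub>R e \<eta> \<gamma> h))\<^sup>2)"
        by (intro tendsto_intros qd)
      thus "(\<lambda>p. \<Sum>\<eta>\<in>F. (norm (coord (?T p (vket h \<gamma>)) \<eta>))\<^sup>2) \<longlonglongrightarrow> (\<Sum>\<eta>\<in>F. (norm (e \<eta> \<gamma> h))\<^sup>2)"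
        by (simp add: T)
      have "(\<Sum>\<eta>\<in>F. (norm (coord (?T p (vket h \<gamma>)) \<eta>))\<^sup>2) \<le> (M * norm h)\<^sup>2" for p
      proof -
        have "norm (?T p (vket h \<gamma>)) \<le> norm (?T p) * norm (vket h \<gamma>)" by (rule norm_blinfun)
        also have "\<dots> \<le> M * norm h"
          unfolding norm_vket by (intro mult_right_mono M q) auto
        finally have "(norm (?T p (vket h \<gamma>)))\<^sup>2 \<le> (M * norm h)\<^sup>2" by (intro power_mono) auto
        with sum_coord_sq_le[OF F, of "?T p (vket h \<gamma>)"] show ?thesis by linarith
      qed
      thus "\<exists>N. \<forall>p\<ge>N. (\<Sum>\<eta>\<in>F. (norm (coord (?T p (vket h \<gamma>)) \<eta>))\<^sup>2) \<le> (M * norm h)\<^sup>2" by blast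
    qed
    thus "bdd_above (sum (\<lambda>\<eta>. (norm (e \<eta> \<gamma> h))\<^sup>2) ` {F. F \<subseteq> UNIV \<and> finite F})"
      by (auto intro!: bdd_aboveI2)
  qed simp
  hence co: "coord (Abs_l2 (\<lambda>\<eta>. e \<eta> \<gamma> h)) = (\<lambda>\<eta>. e \<eta> \<gamma> h)" for \<gamma> h
    by (simp add: Abs_l2_inverse)
  have lim: "(\<lambda>p. ?T p (vket h \<gamma>)) \<longlonglongrightarrow> Abs_l2 (\<lambda>\<eta>. e \<eta> \<gamma> h)" for h \<gamma>
    by (rule tendsto_l2_multiplier[where c = "\<lambda>p \<eta>. q p ^ total_degree k \<eta> \<gamma>"])
      (use q in \<open>auto simp: T co qd power_le_one less_imp_le\<close>)
  have "norm (?T p) \<le> M" for p by (rule M[OF q])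
  then obtain A where A: "\<And>x. (\<lambda>p. ?T p x) \<longlonglongrightarrow> blinfun_apply A x"
    using limit_op_from_vkets[of ?T M] convergentI[OF lim] by blast
  have Ae: "coord (A (vket h \<gamma>)) \<eta> = e \<eta> \<gamma> h" for h \<gamma> \<eta>
    using LIMSEQ_unique[OF A lim] by (simp add: co)
  \<comment> \<open>Complex linearity is inherited from the coefficients: reduced words of any two
    tuples form an index pair of the series.\<close>
  have esc: "e \<eta> \<gamma> (c *\<^sub>C h) = c *\<^sub>C e \<eta> \<gamma> h" for \<eta> \<gamma> c h
  proof -
    have "C (reduced k \<eta> \<gamma>) (reduced k \<gamma> \<eta>) \<in> bop UNIV UNIV" if "\<eta> \<in> words k n" "\<gamma> \<in> words k n"
      using C[OF fourier_degrees(2) reduced_index[OF that fourier_degrees(1)]] .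
    thus ?thesis unfolding e_def fourier_entry_def by (auto simp: bop_UNIV_scaleC)
  qed
  have "A \<in> bop UNIV UNIV"
    by (rule bop_UNIV_from_vkets, rule l2_eqI) (simp add: Ae esc)
  moreover have "coord (A x) \<eta> = 0" if "\<eta> \<notin> words k n" for x \<eta>
    by (rule l2_ext[where f = "\<lambda>x. coord (A x) \<eta>" and g = "\<lambda>x. 0"])
      (use that in \<open>auto simp: Ae e_def intro: bounded_linear_compose[OF bounded_linear_coord]
        blinfun.bounded_linear_right\<close>)
  moreover have "A (vket h \<gamma>) = 0" if "\<gamma> \<notin> words k n" for h \<gamma>
    by (rule l2_eqI) (use that in \<open>simp add: Ae e_def\<close>)
  ultimately have Ab: "A \<in> bop (mfock k n) (mfock k n)"
    unfolding mfock_def in_bop_l2_on by blast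
  have "multi_toeplitz k n A"
    unfolding multi_toeplitz_entry_iff[OF Ab]
  proof (intro ballI allI)
    fix i s t \<eta> \<gamma> h
    assume i: "i \<in> {1..k}" and st: "s \<in> {1..n i}" "t \<in> {1..n i}" and w: "\<eta> \<in> words k n" "\<gamma> \<in> words k n"
    have "\<eta>(i := \<eta> i @ [s]) \<in> words k n" "\<gamma>(i := \<gamma> i @ [t]) \<in> words k n"
      using words_append[OF w(1) i, of "[s]"] words_append[OF w(2) i, of "[t]"] st by auto
    thus "coord (A (vket h (\<gamma>(i := \<gamma> i @ [t])))) (\<eta>(i := \<eta> i @ [s])) =
        (if s = t then coord (A (vket h \<gamma>)) \<eta> else 0)"
      unfolding Ae e_def using w by (simp only: fourier_entry_snoc[OF i]) simp
  qed
  moreover have "has_fourier_series k n A C"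
    unfolding has_fourier_series_iff Ae
    by (auto simp: e_def fourier_entry_fourier_index) (auto simp: fourier_index_def)
  ultimately show ?thesis by blast
qed

theorem theorem1p6:
  fixes k :: nat and n :: "nat \<Rightarrow> nat" and C :: "'e::chilbert_space coeffs"
  assumes "1 \<le> k"
    and "\<forall>i\<in>{1..k}. 1 \<le> n i"
    and "\<forall>ms. length ms = k \<longrightarrow> (\<forall>(\<alpha>, \<beta>)\<in>fourier_index k n ms. C \<alpha> \<beta> \<in> bop UNIV UNIV)"
  shows "((\<exists>A. multi_toeplitz k n A \<and> has_fourier_series k n A C) \<longleftrightarrow>
           (\<forall>r\<in>{0..<1}. phi_convergent k n C r) \<and>
           bdd_above ((\<lambda>r. norm (phi k n C r)) ` {0..<1})) \<and>
         (\<forall>A. multi_toeplitz k n A \<and> has_fourier_series k n A C \<longrightarrow>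
           (\<forall>r\<in>{0..<1}. phi k n C r = berezin_ext k n (\<lambda>i j. r *\<^sub>R S_op k n i j) A) \<and>
           limitin strong_operator_topology
             (\<lambda>r. berezin_ext k n (\<lambda>i j. r *\<^sub>R S_op k n i j) A) A (at_left 1))"
proof -
  have C: "C \<alpha> \<beta> \<in> bop UNIV UNIV" if "length ms = k" "(\<alpha>, \<beta>) \<in> fourier_index k n ms" for \<alpha> \<beta> ms
    using assms(3) that by blast
  \<comment> \<open>One statement serves for convergence, for the value of \<open>phi\<close> and
    for the uniform bound.\<close>
  have B: "iterated_zsums k (phi_part k n C r) (berezin_ext k n (\<lambda>i j. r *\<^sub>R S_op k n i j) A)"
    if "multi_toeplitz k n A" "has_fourier_series k n A C" "r \<in> {0..<1}" for A r
    using that by (intro toeplitz_phi_berezin C) auto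
  have 1: "(\<forall>r\<in>{0..<1}. phi_convergent k n C r) \<and> bdd_above ((\<lambda>r. norm (phi k n C r)) ` {0..<1})"
    if A: "multi_toeplitz k n A" "has_fourier_series k n A C" for A
  proof (intro conjI ballI bdd_aboveI2)
    fix r :: real assume r: "r \<in> {0..<1}"
    show "phi_convergent k n C r"
      unfolding phi_convergent_def using B[OF A r] by blast
    have "A \<in> bop UNIV UNIV" using toeplitz_bop[OF A(1)] unfolding mfock_def in_bop_l2_on by blast
    thus "norm (phi k n C r) \<le> norm A"
      unfolding phi_eqI[OF B[OF A r]] using r by (intro norm_berezin_ext_le) auto
  qed
  have 2: "\<exists>A. multi_toeplitz k n A \<and> has_fourier_series k n A C"
    if conv: "\<forall>r\<in>{0..<1}. phi_convergent k n C r" and bdd: "bdd_above ((\<lambda>r. norm (phi k n C r)) ` {0..<1})"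
  proof -
    obtain M where "\<forall>r\<in>{0..<1}. norm (phi k n C r) \<le> M"
      using bdd unfolding bdd_above_def by auto
    thus ?thesis
      using conv by (intro toeplitz_from_bounded_phi[where M = M] C) auto
  qed
  show ?thesis
  proof (intro conjI iffI allI impI ballI)
    fix A and r :: real assume A: "multi_toeplitz k n A \<and> has_fourier_series k n A C"
    show "limitin strong_operator_topology (\<lambda>r. berezin_ext k n (\<lambda>i j. r *\<^sub>R S_op k n i j) A) A (at_left 1)"
      using A by (intro limitin_strong_operator_topologyI berezin_tendsto) blast
    assume "r \<in> {0..<1}"
    thus "phi k n C r = berezin_ext k n (\<lambda>i j. r *\<^sub>R S_op k n i j) A"
      by (rule phi_eqI[OF B[OF conjunct1[OF A] conjunct2[OF A]]])
  next
    assume "\<exists>A. multi_toeplitz k n A \<and> has_fourier_series k n A C"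
    then obtain A where A: "multi_toeplitz k n A" "has_fourier_series k n A C" by blast
    show "bdd_above ((\<lambda>r. norm (phi k n C r)) ` {0..<1})" by (rule conjunct2[OF 1[OF A]])
    fix r :: real assume "r \<in> {0..<1}"
    with conjunct1[OF 1[OF A]] show "phi_convergent k n C r" by (rule bspec)
  next
    assume "(\<forall>r\<in>{0..<1}. phi_convergent k n C r) \<and> bdd_above ((\<lambda>r. norm (phi k n C r)) ` {0..<1})"
    thus "\<exists>A. multi_toeplitz k n A \<and> has_fourier_series k n A C" using 2 by (elim conjE)
  qed
qed

end
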